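(* Let $\Lambda$ be a gentle algebra over an algebraically closed field $\mathbf{k}$. Suppose $(\sigma,\lambda)$ and $(\tau,\mu)$ are homotopy bands and $f^\bullet \colon B^\bullet_{\sigma,\lambda} \to B^\bullet_{\tau,\mu}$ is a double map with components $(f_L,f_R)$. Decompose $\sigma = \beta\sigma_L\sigma_C\sigma_R\alpha$ and $\tau = \delta\tau_L\tau_C\tau_R\gamma$ with respect to $f^\bullet$. Then there exist a homotopy band $\theta$ and an integer $k \geq 1$ such that $$\theta^k = \beta\,\sigma_L\, f_L\,\overline{\tau_L}\,\overline{\delta}\,\overline{\gamma}\,\overline{\tau_R}\,\overline{f_R}\,\sigma_R\,\alpha$$ and the mapping cone of $f^\bullet$ satisfies $$M^\bullet_{f^\bullet} \cong \bigoplus_{i=1}^k B^\bullet_{\theta,\,\omega^i\sqrt[k]{-\lambda\mu^{-1}}},$$ where $\omega$ is a primitive $k$-th root of unity.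
   Context: **Gentle algebras.** $\Lambda=\mathbf{k}Q/I$ is a finite-dimensional algebra, with $Q$ a finite quiver, $I$ generated by paths of length 2, at most two arrows starting and at most two arrows ending at each vertex, and for each arrow $b$: at most one arrow $a$ with $ba$ a path not in $I$, at most one $a$ with $ba$ a path in $I$, at most one arrow $c$ with $cb$ a path not in $I$, and at most one $c$ with $cb$ a path in $I$. For a path or arrow $p$, $s(p)$ and $e(p)$ are its start and end; paths compose right to left ($qp$ is $p$ followed by $q$). $P(x)$ is the indecomposable projective at $x$; a path $p$ nonzero in $\Lambda$ induces a map $P(e(p))\to P(s(p))$, also denoted $p$; the path $qp$ induces the map "first $q$, then $p$", and products of maps below are written in this path order. **Homotopy strings and bands.** A direct homotopy letter is a nontrivial path $p$ nonzero in $\Lambda$; an inverse homotopy letter is a formal inverse $\overline p$, with $s(\overline p)=e(p)$, $e(\overline p)=s(p)$. A (finite) homotopy string is a trivial word at a vertex, or a word $\sigma=\sigma_n\cdots\sigma_1$ of homotopy letters with $s(\sigma_{i+1})=e(\sigma_i)$ such that for consecutive letters: if $\sigma_{i+1},\sigma_i$ are both direct, then $\sigma_{i+1}\sigma_i$ is zero because the length two path at the junction is in $I$; if both are inverse, the same holds for $\overline{\sigma_i}\,\overline{\sigma_{i+1}}$; if $\sigma_{i+1}=p$, $\sigma_i=\overline q$, then $p,q$ have different first arrows; if $\sigma_{i+1}=\overline p$, $\sigma_i=q$, then $p,q$ have different last arrows. $\sigma$ is drawn as a diagram labelled from left to right by $\sigma_n,\dots,\sigma_1$, a direct letter being an arrow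 $\rightarrow$ and an inverse letter an arrow $\leftarrow$; vertices carry cohomological degrees, arrows raising degree by one. $\overline\sigma$ is the inverse word. A homotopy band is a nontrivial finite homotopy string $\sigma$ starting and ending at the same vertex and in the same degree (equally many direct and inverse letters), such that $\sigma^2$ is a homotopy string whose letters are the letters of the two copies of $\sigma$ (no merging), and $\sigma$ is not a proper power; bands are considered up to rotation (cyclic permutation) and inversion. A pair $(\sigma,\lambda)$ with $\lambda\in\mathbf{k}^*$ is also called a homotopy band. **Complexes.** For a band $\sigma$ and $\lambda\in\mathbf{k}^*$, the band complex $B^\bullet_{\sigma,\lambda}$ is the direct sum of the $P(x)$ over the vertices $x$ of the cyclic diagram of $\sigma$ (first and last vertex identified), placed in their degrees, with differential given by the letters, the scalar $\lambda$ multiplying one direct letter. The cohomological grading is suppressed in the notation: a complex attached to a word describing a mapping cone has the degrees inherited from the cone. The mapping cone $M^\bullet_{f^\bullet}$ of $f^\bullet\colon P^\bullet\to Q^\bullet$ is $\Sigma P^\bullet\oplus Q^\bullet$ with differential $\left[\begin{smallmatrix}-d_P&0\\ f&d_Q\end{smallmatrix}\right]$; isomorphisms are in the bounded derived category $\mathsf{D}^b(\Lambda)$. $\sqrt[k]{\nu}$ denotes some fixed $k$-th root of $\nu$. **Double maps.** A double map $f^\bullet\colon B^\bullet_{\sigma,\lambda}\to B^\bullet_{\tau,\mu}$ is a cochain map with exactly two nonzero components, given (up to nonzero scalars forced by the band parameters) by nontrivial paths $f_L,f_R$, as follows. After rotation and possibly inversion, $\sigma=\beta\sigma_L\sigma_C\sigma_R\alpha$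 and $\tau=\delta\tau_L\tau_C\tau_R\gamma$, where $\sigma_L,\sigma_C,\sigma_R$ (resp. $\tau_L,\tau_C,\tau_R$) are consecutive homotopy letters and $\sigma_C,\tau_C$ are direct; $f_L$ goes from the left end vertex of $\sigma_C$ to the left end vertex of $\tau_C$, and $f_R$ from the right end vertex of $\sigma_C$ to the right end vertex of $\tau_C$ (in equal degrees); $f_L\tau_C=\sigma_Cf_R\neq0$; and $\sigma_Lf_L=0$ if $\sigma_L$ is direct, $f_L\overline{\tau_L}=0$ if $\tau_L$ is inverse, $\overline{\sigma_R}f_R=0$ if $\sigma_R$ is inverse, $f_R\tau_R=0$ if $\tau_R$ is direct. This is the decomposition with respect to $f^\bullet$. The double maps considered are the singleton double maps of the canonical basis of $\mathrm{Hom}_{\mathsf{D}^b(\Lambda)}(B^\bullet_{\sigma,\lambda},B^\bullet_{\tau,\mu})$: there is a nontrivial path $f'$ with $\sigma_C=f_Lf'$ and $\tau_C=f'f_R$. *)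

theory Defs
  imports
    "HOL-Library.Function_Algebras"
    "HOL-Computational_Algebra.Polynomial"
    "Graph_Theory.Digraph"
begin

section \<open>Paths and gentle algebras\<close>

text \<open>
  A nontrivial path is the nonempty list of its arrows in written order: \<open>[b, a]\<close> is the
  path \<open>ba\<close>, that is, \<open>a\<close> followed by \<open>b\<close>.  Concatenation of lists is therefore the product of
  paths.  The ideal generated by paths of length two is given by the set \<open>I\<close> of its generators,
  \<open>(b, a) \<in> I\<close> standing for \<open>ba\<close>.  As this ideal is spanned by the paths having a
  subpath in \<open>I\<close>, a path is nonzero in \<open>kQ/I\<close> iff it has no such subpath.
\<close>

definition path_start :: "('v, 'a) pre_digraph \<Rightarrow> 'a list \<Rightarrow> 'v" where
  "path_start Q p = tail Q (last p)"

definition path_end :: "('v, 'a) pre_digraph \<Rightarrow> 'a list \<Rightarrow> 'v" where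
  "path_end Q p = head Q (hd p)"

definition nonzero_path :: "('v, 'a) pre_digraph \<Rightarrow> ('a \<times> 'a) set \<Rightarrow> 'a list \<Rightarrow> bool" where
  "nonzero_path Q I p \<longleftrightarrow> p \<noteq> [] \<and> set p \<subseteq> arcs Q \<and>
     successively (\<lambda>b a. tail Q b = head Q a \<and> (b, a) \<notin> I) p"

text \<open>Arbitrary paths, trivial ones included, are pairs of an arrow list and the start vertex.\<close>

type_synonym ('v, 'a) path = "'a list \<times> 'v"

definition path_basis :: "('v, 'a) pre_digraph \<Rightarrow> ('a \<times> 'a) set \<Rightarrow> ('v, 'a) path set" where
  "path_basis Q I =
     {(p, x). x \<in> verts Q \<and> (p \<noteq> [] \<longrightarrow> nonzero_path Q I p \<and> path_start Q p = x)}"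

definition path_target :: "('v, 'a) pre_digraph \<Rightarrow> ('v, 'a) path \<Rightarrow> 'v" where
  "path_target Q w = (if fst w = [] then snd w else path_end Q (fst w))"

locale gentle_algebra = fin_digraph Q
  for Q :: "('v, 'a) pre_digraph" +
  fixes I :: "('a \<times> 'a) set"
  assumes rels: "I \<subseteq> {(b, a). b \<in> arcs Q \<and> a \<in> arcs Q \<and> tail Q b = head Q a}"
    and finite_dimensional: "finite (path_basis Q I)"
    and at_most_two_out: "x \<in> verts Q \<Longrightarrow> card {a \<in> arcs Q. tail Q a = x} \<le> 2"
    and at_most_two_in: "x \<in> verts Q \<Longrightarrow> card {a \<in> arcs Q. head Q a = x} \<le> 2"
    and before_nonzero: "b \<in> arcs Q \<Longrightarrow>
          card {a \<in> arcs Q. tail Q b = head Q a \<and> (b, a) \<notin> I} \<le> 1"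
    and before_zero: "b \<in> arcs Q \<Longrightarrow>
          card {a \<in> arcs Q. tail Q b = head Q a \<and> (b, a) \<in> I} \<le> 1"
    and after_nonzero: "b \<in> arcs Q \<Longrightarrow>
          card {c \<in> arcs Q. tail Q c = head Q b \<and> (c, b) \<notin> I} \<le> 1"
    and after_zero: "b \<in> arcs Q \<Longrightarrow>
          card {c \<in> arcs Q. tail Q c = head Q b \<and> (c, b) \<in> I} \<le> 1"

text \<open>
  The algebra \<open>\<Lambda> = kQ/I\<close>, realised on its basis of nonzero paths: elements are
  coefficient functions supported on \<open>path_basis Q I\<close>, and the product is concatenation of
  paths, which is zero if the result is not in the basis.  Addition is pointwise.
\<close>

definition alg :: "('v, 'a) pre_digraph \<Rightarrow> ('a \<times> 'a) set \<Rightarrow> (('v, 'a) path \<Rightarrow> 'k::field) set" where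
  "alg Q I = {u. \<forall>w. u w \<noteq> 0 \<longrightarrow> w \<in> path_basis Q I}"

definition alg_mult :: "('v, 'a) pre_digraph \<Rightarrow> ('a \<times> 'a) set \<Rightarrow>
    (('v, 'a) path \<Rightarrow> 'k::field) \<Rightarrow> (('v, 'a) path \<Rightarrow> 'k) \<Rightarrow> ('v, 'a) path \<Rightarrow> 'k" where
  "alg_mult Q I u v = (\<lambda>(p, x). if (p, x) \<in> path_basis Q I
     then \<Sum>i\<le>length p. u (take i p, path_target Q (drop i p, x)) * v (drop i p, x)
     else 0)"

definition alg_one :: "('v, 'a) pre_digraph \<Rightarrow> ('v, 'a) path \<Rightarrow> 'k::field" where
  "alg_one Q = (\<lambda>(p, x). if p = [] \<and> x \<in> verts Q then 1 else 0)"

definition basis_elt :: "('v, 'a) path \<Rightarrow> ('v, 'a) path \<Rightarrow> 'k::field" where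
  "basis_elt w = (\<lambda>w'. if w' = w then 1 else 0)"

section \<open>Finitely generated left modules\<close>

text \<open>
  A left module over \<open>\<Lambda>\<close> is a subgroup of an ambient abelian group \<open>'m\<close> with an action of
  \<open>\<Lambda>\<close>; its vector space structure is the one coming from the scalars in \<open>\<Lambda>\<close>.
\<close>

record ('l, 'm) lmod =
  mcarrier :: "'m set"
  act :: "'l \<Rightarrow> 'm \<Rightarrow> 'm"

type_synonym ('v, 'a, 'k, 'm) qmod = "(('v, 'a) path \<Rightarrow> 'k, 'm) lmod"

definition fg_module :: "('v, 'a) pre_digraph \<Rightarrow> ('a \<times> 'a) set \<Rightarrow>
    ('v, 'a, 'k::field, 'm::ab_group_add) qmod \<Rightarrow> bool" where
  "fg_module Q I M \<longleftrightarrow>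
     0 \<in> mcarrier M \<and>
     (\<forall>m\<in>mcarrier M. \<forall>n\<in>mcarrier M. m - n \<in> mcarrier M) \<and>
     (\<forall>u\<in>alg Q I. \<forall>m\<in>mcarrier M. act M u m \<in> mcarrier M) \<and>
     (\<forall>u\<in>alg Q I. \<forall>m\<in>mcarrier M. \<forall>n\<in>mcarrier M. act M u (m + n) = act M u m + act M u n) \<and>
     (\<forall>u\<in>alg Q I. \<forall>v\<in>alg Q I. \<forall>m\<in>mcarrier M. act M (u + v) m = act M u m + act M v m) \<and>
     (\<forall>u\<in>alg Q I. \<forall>v\<in>alg Q I. \<forall>m\<in>mcarrier M.
        act M (alg_mult Q I u v) m = act M u (act M v m)) \<and>
     (\<forall>m\<in>mcarrier M. act M (alg_one Q) m = m) \<and>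
     (\<exists>S. finite S \<and> S \<subseteq> mcarrier M \<and>
        (\<forall>m\<in>mcarrier M. \<exists>c. (\<forall>s\<in>S. c s \<in> alg Q I) \<and> m = (\<Sum>s\<in>S. act M (c s) s)))"

definition module_hom :: "('v, 'a) pre_digraph \<Rightarrow> ('a \<times> 'a) set \<Rightarrow>
    ('v, 'a, 'k::field, 'm::ab_group_add) qmod \<Rightarrow> ('v, 'a, 'k, 'n::ab_group_add) qmod \<Rightarrow>
    ('m \<Rightarrow> 'n) set" where
  "module_hom Q I M N = {f.
     (\<forall>m\<in>mcarrier M. f m \<in> mcarrier N) \<and>
     (\<forall>m\<in>mcarrier M. \<forall>n\<in>mcarrier M. f (m + n) = f m + f n) \<and>
     (\<forall>u\<in>alg Q I. \<forall>m\<in>mcarrier M. f (act M u m) = act N u (f m))}"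

definition module_dsum :: "'i set \<Rightarrow> ('i \<Rightarrow> ('l, 'm::zero) lmod) \<Rightarrow> ('l, 'i \<Rightarrow> 'm) lmod" where
  "module_dsum S M = \<lparr>
     mcarrier = {u. \<forall>i. if i \<in> S then u i \<in> mcarrier (M i) else u i = 0},
     act = (\<lambda>a u i. if i \<in> S then act (M i) a (u i) else 0)\<rparr>"

text \<open>The indecomposable projective \<open>P(x) = \<Lambda>e\<^sub>x\<close>, with basis the nonzero paths starting at \<open>x\<close>.\<close>

definition proj :: "('v, 'a) pre_digraph \<Rightarrow> ('a \<times> 'a) set \<Rightarrow> 'v \<Rightarrow>
    ('v, 'a, 'k::field, ('v, 'a) path \<Rightarrow> 'k) qmod" where
  "proj Q I x = \<lparr>
     mcarrier = (\<lambda>u. alg_mult Q I u (basis_elt ([], x))) ` alg Q I,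
     act = alg_mult Q I\<rparr>"

text \<open>
  \<open>c\<close> times the map \<open>P(e(p)) \<rightarrow> P(s(p))\<close> induced by \<open>p\<close>: right multiplication by the path, so
  that \<open>qp\<close> induces first \<open>q\<close>, then \<open>p\<close>.
\<close>

definition path_map :: "('v, 'a) pre_digraph \<Rightarrow> ('a \<times> 'a) set \<Rightarrow> 'k::field \<Rightarrow> 'a list \<Rightarrow>
    (('v, 'a) path \<Rightarrow> 'k) \<Rightarrow> ('v, 'a) path \<Rightarrow> 'k" where
  "path_map Q I c p u = (\<lambda>w. c * alg_mult Q I u (basis_elt (p, path_start Q p)) w)"

section \<open>Bounded complexes and the bounded derived category\<close>

text \<open>Maps only matter on the carriers; the differential \<open>diff X n\<close> goes from degree \<open>n\<close> to \<open>n + 1\<close>.\<close>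

record ('l, 'm) cpx =
  obj :: "int \<Rightarrow> ('l, 'm) lmod"
  diff :: "int \<Rightarrow> 'm \<Rightarrow> 'm"

type_synonym ('v, 'a, 'k, 'm) qcpx = "(('v, 'a) path \<Rightarrow> 'k, 'm) cpx"

definition bounded_complex :: "('v, 'a) pre_digraph \<Rightarrow> ('a \<times> 'a) set \<Rightarrow>
    ('v, 'a, 'k::field, 'm::ab_group_add) qcpx \<Rightarrow> bool" where
  "bounded_complex Q I X \<longleftrightarrow>
     (\<forall>n. fg_module Q I (obj X n)) \<and>
     (\<forall>n. diff X n \<in> module_hom Q I (obj X n) (obj X (n + 1))) \<and>
     (\<forall>n. \<forall>x\<in>mcarrier (obj X n). diff X (n + 1) (diff X n x) = 0) \<and>
     (\<exists>N. \<forall>n. \<bar>n\<bar> > N \<longrightarrow> mcarrier (obj X n) = {0})"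

definition cochain_map :: "('v, 'a) pre_digraph \<Rightarrow> ('a \<times> 'a) set \<Rightarrow>
    ('v, 'a, 'k::field, 'm::ab_group_add) qcpx \<Rightarrow> ('v, 'a, 'k, 'n::ab_group_add) qcpx \<Rightarrow>
    (int \<Rightarrow> 'm \<Rightarrow> 'n) \<Rightarrow> bool" where
  "cochain_map Q I X Y f \<longleftrightarrow>
     (\<forall>n. f n \<in> module_hom Q I (obj X n) (obj Y n)) \<and>
     (\<forall>n. \<forall>x\<in>mcarrier (obj X n). f (n + 1) (diff X n x) = diff Y n (f n x))"

definition homotopic :: "('v, 'a) pre_digraph \<Rightarrow> ('a \<times> 'a) set \<Rightarrow>
    ('v, 'a, 'k::field, 'm::ab_group_add) qcpx \<Rightarrow> ('v, 'a, 'k, 'n::ab_group_add) qcpx \<Rightarrow>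
    (int \<Rightarrow> 'm \<Rightarrow> 'n) \<Rightarrow> (int \<Rightarrow> 'm \<Rightarrow> 'n) \<Rightarrow> bool" where
  "homotopic Q I X Y f g \<longleftrightarrow> (\<exists>h. \<forall>n.
     h n \<in> module_hom Q I (obj X n) (obj Y (n - 1)) \<and>
     (\<forall>x\<in>mcarrier (obj X n). f n x - g n x = diff Y (n - 1) (h n x) + h (n + 1) (diff X n x)))"

definition cocycles :: "('l, 'm::ab_group_add) cpx \<Rightarrow> int \<Rightarrow> 'm set" where
  "cocycles X n = {x \<in> mcarrier (obj X n). diff X n x = 0}"

definition coboundaries :: "('l, 'm::ab_group_add) cpx \<Rightarrow> int \<Rightarrow> 'm set" where
  "coboundaries X n = diff X (n - 1) ` mcarrier (obj X (n - 1))"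

text \<open>The two conditions say that the map induced on cohomology is injective and surjective.\<close>

definition quasi_iso :: "('v, 'a) pre_digraph \<Rightarrow> ('a \<times> 'a) set \<Rightarrow>
    ('v, 'a, 'k::field, 'm::ab_group_add) qcpx \<Rightarrow> ('v, 'a, 'k, 'n::ab_group_add) qcpx \<Rightarrow>
    (int \<Rightarrow> 'm \<Rightarrow> 'n) \<Rightarrow> bool" where
  "quasi_iso Q I X Y f \<longleftrightarrow> cochain_map Q I X Y f \<and>
     (\<forall>n. \<forall>x\<in>cocycles X n. f n x \<in> coboundaries Y n \<longrightarrow> x \<in> coboundaries X n) \<and>
     (\<forall>n. \<forall>y\<in>cocycles Y n. \<exists>x\<in>cocycles X n. y - f n x \<in> coboundaries Y n)"

text \<open>
  The bounded derived category is the localisation of the homotopy category of bounded complexes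
  of finitely generated modules at the quasi-isomorphisms.  A morphism from \<open>X\<close> to \<open>Y\<close> is an
  equivalence class of roofs \<open>(Z, s, f)\<close>, with \<open>s\<close> a quasi-isomorphism from \<open>Z\<close> to \<open>X\<close> and \<open>f\<close> a
  cochain map from \<open>Z\<close> to \<open>Y\<close>.  All complexes live in one ambient type \<open>'m\<close>.  This is no
  restriction as soon as \<open>'m\<close> contains an infinite-dimensional vector space over the ground field,
  for then it contains a copy of every finitely generated module.
\<close>

type_synonym ('v, 'a, 'k, 'm) roof =
  "('v, 'a, 'k, 'm) qcpx \<times> (int \<Rightarrow> 'm \<Rightarrow> 'm) \<times> (int \<Rightarrow> 'm \<Rightarrow> 'm)"

definition is_roof :: "('v, 'a) pre_digraph \<Rightarrow> ('a \<times> 'a) set \<Rightarrow>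
    ('v, 'a, 'k::field, 'm::ab_group_add) qcpx \<Rightarrow> ('v, 'a, 'k, 'm) qcpx \<Rightarrow>
    ('v, 'a, 'k, 'm) roof \<Rightarrow> bool" where
  "is_roof Q I X Y = (\<lambda>(Z, s, f).
     bounded_complex Q I Z \<and> quasi_iso Q I Z X s \<and> cochain_map Q I Z Y f)"

definition roof_equiv :: "('v, 'a) pre_digraph \<Rightarrow> ('a \<times> 'a) set \<Rightarrow>
    ('v, 'a, 'k::field, 'm::ab_group_add) qcpx \<Rightarrow> ('v, 'a, 'k, 'm) qcpx \<Rightarrow>
    ('v, 'a, 'k, 'm) roof \<Rightarrow> ('v, 'a, 'k, 'm) roof \<Rightarrow> bool" where
  "roof_equiv Q I X Y = (\<lambda>(Z, s, f) (Z', s', f').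
     \<exists>(W :: ('v, 'a, 'k, 'm) qcpx) u u'. bounded_complex Q I W \<and> cochain_map Q I W Z u \<and> cochain_map Q I W Z' u' \<and>
       quasi_iso Q I W X (\<lambda>n. s n \<circ> u n) \<and>
       homotopic Q I W X (\<lambda>n. s n \<circ> u n) (\<lambda>n. s' n \<circ> u' n) \<and>
       homotopic Q I W Y (\<lambda>n. f n \<circ> u n) (\<lambda>n. f' n \<circ> u' n))"

text \<open>\<open>H\<close> represents the composite of \<open>F\<close> from \<open>X\<close> to \<open>Y\<close> followed by \<open>G\<close> from \<open>Y\<close> to \<open>V\<close>.\<close>

definition roof_composite :: "('v, 'a) pre_digraph \<Rightarrow> ('a \<times> 'a) set \<Rightarrow>
    ('v, 'a, 'k::field, 'm::ab_group_add) qcpx \<Rightarrow>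
    ('v, 'a, 'k, 'm) roof \<Rightarrow> ('v, 'a, 'k, 'm) roof \<Rightarrow> ('v, 'a, 'k, 'm) roof \<Rightarrow> bool" where
  "roof_composite Q I Y = (\<lambda>(Z, s, f) (Z', t, g) H.
     \<exists>W u v. bounded_complex Q I W \<and> quasi_iso Q I W Z u \<and> cochain_map Q I W Z' v \<and>
       homotopic Q I W Y (\<lambda>n. f n \<circ> u n) (\<lambda>n. t n \<circ> v n) \<and>
       H = (W, \<lambda>n. s n \<circ> u n, \<lambda>n. g n \<circ> v n))"

definition roof_id :: "('v, 'a, 'k::field, 'm::ab_group_add) qcpx \<Rightarrow> ('v, 'a, 'k, 'm) roof" where
  "roof_id X = (X, \<lambda>n. id, \<lambda>n. id)"

definition derived_iso :: "('v, 'a) pre_digraph \<Rightarrow> ('a \<times> 'a) set \<Rightarrow>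
    ('v, 'a, 'k::field, 'm::ab_group_add) qcpx \<Rightarrow> ('v, 'a, 'k, 'm) qcpx \<Rightarrow> bool" where
  "derived_iso Q I X Y \<longleftrightarrow> bounded_complex Q I X \<and> bounded_complex Q I Y \<and>
     (\<exists>F G H K. is_roof Q I X Y F \<and> is_roof Q I Y X G \<and>
        roof_composite Q I Y F G H \<and> roof_equiv Q I X X H (roof_id X) \<and>
        roof_composite Q I X G F K \<and> roof_equiv Q I Y Y K (roof_id Y))"

definition complex_dsum :: "'i set \<Rightarrow> ('i \<Rightarrow> ('l, 'm::zero) cpx) \<Rightarrow> ('l, 'i \<Rightarrow> 'm) cpx" where
  "complex_dsum S X = \<lparr>
     obj = (\<lambda>n. module_dsum S (\<lambda>i. obj (X i) n)),
     diff = (\<lambda>n u i. if i \<in> S then diff (X i) n (u i) else 0)\<rparr>"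

text \<open>Index \<open>0\<close> is the summand \<open>\<Sigma>P\<close> and index \<open>1\<close> the summand \<open>R\<close> of the cone of \<open>f : P \<rightarrow> R\<close>.\<close>

definition mapping_cone :: "('l, 'm::ab_group_add) cpx \<Rightarrow> ('l, 'm) cpx \<Rightarrow> (int \<Rightarrow> 'm \<Rightarrow> 'm) \<Rightarrow>
    ('l, nat \<Rightarrow> 'm) cpx" where
  "mapping_cone P R f = \<lparr>
     obj = (\<lambda>n. module_dsum {0, 1} (\<lambda>i. if i = 0 then obj P (n + 1) else obj R n)),
     diff = (\<lambda>n u i. if i = 0 then - diff P (n + 1) (u 0)
                     else if i = 1 then f (n + 1) (u 0) + diff R n (u 1)
                     else 0)\<rparr>"

section \<open>Homotopy strings and bands\<close>

text \<open>
  A word \<open>\<sigma>\<^sub>n \<dots> \<sigma>\<^sub>1\<close> is the list of its letters in written order, which is the left to right order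
  of its diagram.
\<close>

datatype 'a letter = Direct "'a list" | Inverse "'a list"

fun letter_path :: "'a letter \<Rightarrow> 'a list" where
  "letter_path (Direct p) = p"
| "letter_path (Inverse p) = p"

fun is_direct :: "'a letter \<Rightarrow> bool" where
  "is_direct (Direct p) = True"
| "is_direct (Inverse p) = False"

fun inv_letter :: "'a letter \<Rightarrow> 'a letter" where
  "inv_letter (Direct p) = Inverse p"
| "inv_letter (Inverse p) = Direct p"

definition inv_word :: "'a letter list \<Rightarrow> 'a letter list" where
  "inv_word \<sigma> = rev (map inv_letter \<sigma>)"

definition word_power :: "'a letter list \<Rightarrow> nat \<Rightarrow> 'a letter list" where
  "word_power \<sigma> k = concat (replicate k \<sigma>)"

fun letter_start :: "('v, 'a) pre_digraph \<Rightarrow> 'a letter \<Rightarrow> 'v" where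
  "letter_start Q (Direct p) = path_start Q p"
| "letter_start Q (Inverse p) = path_end Q p"

fun letter_end :: "('v, 'a) pre_digraph \<Rightarrow> 'a letter \<Rightarrow> 'v" where
  "letter_end Q (Direct p) = path_end Q p"
| "letter_end Q (Inverse p) = path_start Q p"

text \<open>Recall that the first arrow of a path \<open>p\<close> is \<open>last p\<close> and its last arrow is \<open>hd p\<close>.\<close>

fun letters_compatible :: "('a \<times> 'a) set \<Rightarrow> 'a letter \<Rightarrow> 'a letter \<Rightarrow> bool" where
  "letters_compatible I (Direct p) (Direct q) \<longleftrightarrow> (last p, hd q) \<in> I"
| "letters_compatible I (Inverse p) (Inverse q) \<longleftrightarrow> (last q, hd p) \<in> I"
| "letters_compatible I (Direct p) (Inverse q) \<longleftrightarrow> last p \<noteq> last q"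
| "letters_compatible I (Inverse p) (Direct q) \<longleftrightarrow> hd p \<noteq> hd q"

definition nontrivial_homotopy_string ::
    "('v, 'a) pre_digraph \<Rightarrow> ('a \<times> 'a) set \<Rightarrow> 'a letter list \<Rightarrow> bool" where
  "nontrivial_homotopy_string Q I \<sigma> \<longleftrightarrow> \<sigma> \<noteq> [] \<and>
     (\<forall>l\<in>set \<sigma>. nonzero_path Q I (letter_path l)) \<and>
     successively (\<lambda>l l'. letter_start Q l = letter_end Q l' \<and> letters_compatible I l l') \<sigma>"

definition homotopy_band ::
    "('v, 'a) pre_digraph \<Rightarrow> ('a \<times> 'a) set \<Rightarrow> 'a letter list \<Rightarrow> bool" where
  "homotopy_band Q I \<sigma> \<longleftrightarrow>
     nontrivial_homotopy_string Q I \<sigma> \<and>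
     letter_start Q (last \<sigma>) = letter_end Q (hd \<sigma>) \<and>
     length (filter is_direct \<sigma>) = length (filter (Not \<circ> is_direct) \<sigma>) \<and>
     nontrivial_homotopy_string Q I (word_power \<sigma> 2) \<and>
     \<not> (\<exists>\<rho> m. m \<ge> 2 \<and> \<sigma> = word_power \<rho> m)"

section \<open>Band complexes\<close>

text \<open>
  The vertices of the diagram of \<open>\<sigma>\<close> are numbered \<open>0, \<dots>, length \<sigma>\<close> from left to right, so that
  the letter \<open>\<sigma> ! i\<close> joins vertex \<open>i\<close> and vertex \<open>i + 1\<close>; in the cyclic diagram vertex \<open>length \<sigma>\<close>
  is vertex \<open>0\<close>.  The grading is fixed by the degree \<open>d\<close> of vertex \<open>0\<close>.
\<close>

definition vertex_degree :: "'a letter list \<Rightarrow> int \<Rightarrow> nat \<Rightarrow> int" where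
  "vertex_degree \<sigma> d i =
     d + (\<Sum>l\<leftarrow>take i \<sigma>. if is_direct l then 1 else - 1)"

definition next_vertex :: "'a letter list \<Rightarrow> nat \<Rightarrow> nat" where
  "next_vertex \<sigma> i = Suc i mod length \<sigma>"

definition direct_position :: "'a letter list \<Rightarrow> nat \<Rightarrow> bool" where
  "direct_position \<sigma> r \<longleftrightarrow> r < length \<sigma> \<and> is_direct (\<sigma> ! r)"

text \<open>The scalar multiplies the letter at position \<open>r\<close>, which is meant to be direct.\<close>

definition band_complex :: "('v, 'a) pre_digraph \<Rightarrow> ('a \<times> 'a) set \<Rightarrow>
    'a letter list \<Rightarrow> int \<Rightarrow> nat \<Rightarrow> 'k::field \<Rightarrow>
    ('v, 'a, 'k, nat \<Rightarrow> ('v, 'a) path \<Rightarrow> 'k) qcpx" where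
  "band_complex Q I \<sigma> d r \<nu> = \<lparr>
     obj = (\<lambda>n. module_dsum {i. i < length \<sigma> \<and> vertex_degree \<sigma> d i = n}
                            (\<lambda>i. proj Q I (letter_end Q (\<sigma> ! i)))),
     diff = (\<lambda>n u j. \<Sum>i<length \<sigma>.
       (let c = (if i = r then \<nu> else 1) in
        case \<sigma> ! i of
          Direct p \<Rightarrow> if j = next_vertex \<sigma> i then path_map Q I c p (u i) else 0
        | Inverse p \<Rightarrow> if j = i then path_map Q I c p (u (next_vertex \<sigma> i)) else 0))\<rparr>"

section \<open>Double maps\<close>

text \<open>
  Decompositions \<open>\<sigma> = \<beta>\<sigma>\<^sub>L\<sigma>\<^sub>C\<sigma>\<^sub>R\<alpha>\<close> and \<open>\<tau> = \<delta>\<tau>\<^sub>L\<tau>\<^sub>C\<tau>\<^sub>R\<gamma>\<close> are given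
  by the direct letters \<open>\<sigma>\<^sub>C, \<tau>\<^sub>C\<close> and by the words
  \<open>A = \<beta>\<sigma>\<^sub>L\<close>, \<open>B = \<sigma>\<^sub>R\<alpha>\<close>, \<open>A' = \<delta>\<tau>\<^sub>L\<close>, \<open>B' = \<tau>\<^sub>R\<gamma>\<close>.
  Bands being cyclic, \<open>A\<close> or \<open>B\<close> may be empty, and \<open>\<sigma>\<^sub>L\<close>, \<open>\<sigma>\<^sub>R\<close> are the cyclic neighbours of
  \<open>\<sigma>\<^sub>C\<close>.  So every rotation of \<open>\<sigma>\<close> is allowed, as are the bands with
  two letters, where \<open>\<sigma>\<^sub>L\<close> and \<open>\<sigma>\<^sub>R\<close> are the same letter.
\<close>

definition left_neighbour :: "'a letter list \<Rightarrow> 'a letter list \<Rightarrow> 'a letter" where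
  "left_neighbour A B = last (B @ A)"

definition right_neighbour :: "'a letter list \<Rightarrow> 'a letter list \<Rightarrow> 'a letter" where
  "right_neighbour A B = hd (B @ A)"

definition double_map_paths :: "('v, 'a) pre_digraph \<Rightarrow> ('a \<times> 'a) set \<Rightarrow>
    'a letter list \<Rightarrow> 'a list \<Rightarrow> 'a letter list \<Rightarrow>
    'a letter list \<Rightarrow> 'a list \<Rightarrow> 'a letter list \<Rightarrow> 'a list \<Rightarrow> 'a list \<Rightarrow> bool" where
  "double_map_paths Q I A \<sigma>C B A' \<tau>C B' fL fR \<longleftrightarrow>
     nonzero_path Q I fL \<and> path_end Q fL = path_end Q \<sigma>C \<and> path_start Q fL = path_end Q \<tau>C \<and>
     nonzero_path Q I fR \<and> path_end Q fR = path_start Q \<sigma>C \<and> path_start Q fR = path_start Q \<tau>C \<and>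
     fL @ \<tau>C = \<sigma>C @ fR \<and> nonzero_path Q I (\<sigma>C @ fR) \<and>
     (\<forall>p. left_neighbour A B = Direct p \<longrightarrow> \<not> nonzero_path Q I (p @ fL)) \<and>
     (\<forall>p. left_neighbour A' B' = Inverse p \<longrightarrow> \<not> nonzero_path Q I (fL @ p)) \<and>
     (\<forall>p. right_neighbour A B = Inverse p \<longrightarrow> \<not> nonzero_path Q I (p @ fR)) \<and>
     (\<forall>p. right_neighbour A' B' = Direct p \<longrightarrow> \<not> nonzero_path Q I (fR @ p)) \<and>
     (\<exists>f'. nonzero_path Q I f' \<and> \<sigma>C = fL @ f' \<and> \<tau>C = f' @ fR)"

text \<open>
  The scalars \<open>a, b\<close> are constrained by the requirement that \<open>f\<close> is a cochain map.
\<close>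

definition double_map :: "('v, 'a) pre_digraph \<Rightarrow> ('a \<times> 'a) set \<Rightarrow>
    'a letter list \<Rightarrow> 'a list \<Rightarrow> 'a letter list \<Rightarrow> int \<Rightarrow> nat \<Rightarrow> 'k::field \<Rightarrow>
    'a letter list \<Rightarrow> 'a list \<Rightarrow> 'a letter list \<Rightarrow> int \<Rightarrow> nat \<Rightarrow> 'k \<Rightarrow>
    'a list \<Rightarrow> 'a list \<Rightarrow>
    (int \<Rightarrow> (nat \<Rightarrow> ('v, 'a) path \<Rightarrow> 'k) \<Rightarrow> (nat \<Rightarrow> ('v, 'a) path \<Rightarrow> 'k)) \<Rightarrow> bool" where
  "double_map Q I A \<sigma>C B d r \<nu> A' \<tau>C B' d' r' \<nu>' fL fR f \<longleftrightarrow>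
     (let \<sigma> = A @ [Direct \<sigma>C] @ B; \<tau> = A' @ [Direct \<tau>C] @ B';
          X = band_complex Q I \<sigma> d r \<nu>; Y = band_complex Q I \<tau> d' r' \<nu>';
          iL = length A; iR = next_vertex \<sigma> iL; jL = length A'; jR = next_vertex \<tau> jL
      in double_map_paths Q I A \<sigma>C B A' \<tau>C B' fL fR \<and>
         vertex_degree \<sigma> d iL = vertex_degree \<tau> d' jL \<and>
         cochain_map Q I X Y f \<and>
         (\<exists>a b. a \<noteq> 0 \<and> b \<noteq> 0 \<and>
            (\<forall>n. \<forall>u\<in>mcarrier (obj X n). f n u =
               (\<lambda>j. if j = jL then path_map Q I a fL (u iL)
                    else if j = jR then path_map Q I b fR (u iR)
                    else 0))))"

definition primitive_root_of_unity :: "nat \<Rightarrow> 'k::field \<Rightarrow> bool" where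
  "primitive_root_of_unity k \<omega> \<longleftrightarrow> \<omega> ^ k = 1 \<and> (\<forall>j. 0 < j \<and> j < k \<longrightarrow> \<omega> ^ j \<noteq> 1)"

end

theory Submission
  imports Defs
begin

text \<open>
  In the cone, \<open>\<sigma>\<^sub>C\<close>, \<open>\<tau>\<^sub>C\<close>, \<open>f\<^sub>L\<close> and \<open>f\<^sub>R\<close> form a square which anticommutes, as the shift changes
  the sign of \<open>\<sigma>\<^sub>C\<close>.  Since \<open>\<sigma>\<^sub>C = f\<^sub>Lf'\<close> and \<open>\<tau>\<^sub>C = f'f\<^sub>R\<close>, adding a multiple of
  \<open>f'\<close> composed with the coordinate at the left end of \<open>\<tau>\<^sub>C\<close> to the coordinate at the right end of
  \<open>\<sigma>\<^sub>C\<close> removes \<open>\<sigma>\<^sub>C\<close> and \<open>\<tau>\<^sub>C\<close> from the differential, and nothing new appears because \<open>f'\<close>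
  meets the neighbouring letters in relations (\<open>isomorphic_complexes_cancel_square\<close>).  What is left
  is a single cycle, which runs through \<open>\<sigma>\<close> without \<open>\<sigma>\<^sub>C\<close>, crosses to \<open>\<tau>\<close> by \<open>f\<^sub>L\<close>, runs
  backwards through \<open>\<tau>\<close> without \<open>\<tau>\<^sub>C\<close> and returns by \<open>f\<^sub>R\<close>: the word of the statement
  (\<open>isomorphic_complexes_closed_walk\<close>, \<open>cone_isomorphic_word_complex\<close>).  That the square of this word
  is again a string follows from the vanishing conditions on a double map and the string conditions
  for \<open>\<sigma>\<close> and \<open>\<tau>\<close> (\<open>cone_word_closed\<close>).

  The complex of a cyclic word with scalars at all of its letters depends, up to rescaling the
  vertices, only on the product of these scalars around the cycle, the scalar of an inverse letter
  being inverted.  In the cone the signs of the odd number of remaining letters of \<open>\<sigma>\<close> give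
  \<open>-1\<close>, the letters of \<open>\<tau>\<close> are inverted, and if one of the parameters \<open>\<lambda>\<close>, \<open>\<mu>\<close> sits at a cancelled letter, it reappears in the ratio of the two
  scalars of the double map; the product is \<open>-\<lambda>\<mu>\<^bsup>-1\<^esup>\<close> (\<open>square_scalars\<close>,
  \<open>transport_cone_word\<close>).

  The word may be a proper power \<open>\<theta>\<^sup>k\<close>.  Its cyclic diagram is then a \<open>k\<close>-fold covering of that of
  \<open>\<theta>\<close>, and a band complex of \<open>\<theta>\<close> pulls back to it if the \<open>k\<close>-th power of its scalar is the
  product above.  The \<open>k\<close> pullbacks for the scalars \<open>\<omega>\<^sup>i\<nu>\<close>, where \<open>\<nu>\<close> is one such scalar,
  decompose the large complex, like the characters of a cyclic group decompose its regular
  representation (\<open>isomorphic_complexes_power\<close>).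

  All these isomorphisms are strict isomorphisms of complexes.  To treat cones and band complexes
  alike, complexes are attached to diagrams whose edges are labelled by letters.
\<close>

section \<open>The path algebra and its projective modules\<close>

lemma nonzero_path_append:
  assumes "p \<noteq> []" "q \<noteq> []"
  shows "nonzero_path Q I (p @ q) \<longleftrightarrow> nonzero_path Q I p \<and> nonzero_path Q I q \<and>
    path_start Q p = path_end Q q \<and> (last p, hd q) \<notin> I"
  using assms
  by (auto simp: nonzero_path_def successively_append_iff path_start_def path_end_def)

lemma path_start_append: "q \<noteq> [] \<Longrightarrow> path_start Q (p @ q) = path_start Q q"
  by (simp add: path_start_def)

lemma path_end_append: "p \<noteq> [] \<Longrightarrow> path_end Q (p @ q) = path_end Q p"
  by (simp add: path_end_def)

lemma nonzero_path_take: "nonzero_path Q I p \<Longrightarrow> take i p \<noteq> [] \<Longrightarrow> nonzero_path Q I (take i p)"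
  and nonzero_path_drop: "nonzero_path Q I p \<Longrightarrow> drop i p \<noteq> [] \<Longrightarrow> nonzero_path Q I (drop i p)"
  using nonzero_path_append[of "take i p" "drop i p" Q I]
  by (cases "take i p = []"; cases "drop i p = []"; force)+

lemma alg_mult_add_left: "alg_mult Q I (u + u') v = alg_mult Q I u v + alg_mult Q I u' v"
  by (auto simp: alg_mult_def fun_eq_iff sum.distrib distrib_right)

lemma alg_mult_add_right: "alg_mult Q I u (v + v') = alg_mult Q I u v + alg_mult Q I u v'"
  by (auto simp: alg_mult_def fun_eq_iff sum.distrib distrib_left)

lemma alg_mult_0_left [simp]: "alg_mult Q I 0 v = 0"
  by (auto simp: alg_mult_def fun_eq_iff)

lemma alg_mult_0_right [simp]: "alg_mult Q I u 0 = 0"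
  by (auto simp: alg_mult_def fun_eq_iff)

lemma alg_mult_scale_left:
  "alg_mult Q I (\<lambda>w. c * u w) v = (\<lambda>w. c * alg_mult Q I u v w)"
  by (auto simp: alg_mult_def fun_eq_iff sum_distrib_left mult.assoc)

lemma alg_mult_scale_right:
  "alg_mult Q I u (\<lambda>w. c * v w) = (\<lambda>w. c * alg_mult Q I u v w)"
  by (auto simp: alg_mult_def fun_eq_iff sum_distrib_left mult.left_commute)

lemma alg_mult_in_alg: "alg_mult Q I u v \<in> alg Q I"
  by (auto simp: alg_def alg_mult_def split: if_splits)

lemma alg_0 [simp]: "0 \<in> alg Q I"
  by (simp add: alg_def)

lemma alg_add: "u \<in> alg Q I \<Longrightarrow> v \<in> alg Q I \<Longrightarrow> u + v \<in> alg Q I"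
  by (force simp: alg_def)

lemma alg_sum: "(\<And>j. j \<in> J \<Longrightarrow> c j \<in> alg Q I) \<Longrightarrow> sum c J \<in> alg Q I"
  by (induction J rule: infinite_finite_induct) (auto intro: alg_add)

lemma alg_one_in_alg [simp]: "alg_one Q \<in> alg Q I"
  by (auto simp: alg_def alg_one_def path_basis_def split: if_splits)

lemma path_target_append:
  "path_target Q (p, path_target Q (q, x)) = path_target Q (p @ q, x)"
  by (auto simp: path_target_def path_end_def)

text \<open>
  Counts the ways to cut a path at two places by the later or by the earlier cut.
\<close>

lemma sum_triangle_swap:
  fixes F :: "nat \<Rightarrow> nat \<Rightarrow> 'b::comm_monoid_add"
  shows "(\<Sum>i\<le>n. \<Sum>j\<le>i. F j i) = (\<Sum>j\<le>n. \<Sum>l\<le>n - j. F j (j + l))"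
proof -
  have "(\<Sum>i\<le>n. \<Sum>j\<le>i. F j i) = (\<Sum>j\<le>n. \<Sum>i\<in>{j..n}. F j i)"
    by (simp add: sum.Sigma, rule sum.reindex_bij_witness[of _ prod.swap prod.swap]) auto
  also have "(\<Sum>j\<le>n. \<Sum>i\<in>{j..n}. F j i) = (\<Sum>j\<le>n. \<Sum>l\<le>n - j. F j (j + l))"
  proof (rule sum.cong)
    fix j assume "j \<in> {..n}"
    then show "(\<Sum>i\<in>{j..n}. F j i) = (\<Sum>l\<le>n - j. F j (j + l))"
      by (intro sum.reindex_bij_witness[of _ "\<lambda>l. j + l" "\<lambda>i. i - j"]) auto
  qed simp
  finally show ?thesis .
qed

context wf_digraph
begin

lemma nonzero_path_ends:
  assumes "nonzero_path G I p"
  shows "path_start G p \<in> verts G" "path_end G p \<in> verts G"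
  using assms last_in_set[of p] hd_in_set[of p]
  by (auto simp: nonzero_path_def path_start_def path_end_def simp del: last_in_set hd_in_set)

lemma path_target_in_verts: "(p, x) \<in> path_basis G I \<Longrightarrow> path_target G (p, x) \<in> verts G"
  by (auto simp: path_basis_def path_target_def nonzero_path_ends)

lemma path_basis_drop:
  "(p, x) \<in> path_basis G I \<Longrightarrow> (drop i p, x) \<in> path_basis G I"
  using path_start_append[of "drop i p" G "take i p"]
  by (auto simp: path_basis_def nonzero_path_drop)

lemma path_basis_take:
  assumes "(p, x) \<in> path_basis G I"
  shows "(take i p, path_target G (drop i p, x)) \<in> path_basis G I"
proof (cases "take i p = []")
  case True
  then show ?thesis
    using path_target_in_verts[OF path_basis_drop[OF assms, of i]] by (simp add: path_basis_def)
next
  case False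
  have *: "path_start G (take i p) = path_target G (drop i p, x)"
    using nonzero_path_append[OF False, of "drop i p" G I] assms False
    by (cases "drop i p = []") (auto simp: path_target_def path_basis_def)
  then show ?thesis
    using path_target_in_verts[OF path_basis_drop[OF assms, of i]] assms False
    by (auto simp: path_basis_def nonzero_path_take)
qed

text \<open>
  The product reads its factors only on the basis, and subpaths of basis paths are basis paths.
  So associativity needs no conditions on the supports; only the unit law does.
\<close>

lemma alg_mult_assoc:
  fixes u v w :: "('a, 'b) path \<Rightarrow> 'k::field"
  shows "alg_mult G I (alg_mult G I u v) w = alg_mult G I u (alg_mult G I v w)"
proof (rule ext, clarify)
  fix p x
  show "alg_mult G I (alg_mult G I u v) w (p, x) = alg_mult G I u (alg_mult G I v w) (p, x)"
  proof (cases "(p, x) \<in> path_basis G I")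
    case False
    then show ?thesis by (simp add: alg_mult_def)
  next
    case True
    let ?t = "\<lambda>i. path_target G (drop i p, x)"
    have "alg_mult G I (alg_mult G I u v) w (p, x) =
        (\<Sum>i\<le>length p. (\<Sum>j\<le>i. u (take j (take i p), path_target G (drop j (take i p), ?t i)) *
            v (drop j (take i p), ?t i)) * w (drop i p, x))"
      using True path_basis_take[OF True] by (auto simp: alg_mult_def intro!: sum.cong)
    also have "\<dots> = (\<Sum>i\<le>length p. \<Sum>j\<le>i. u (take j p, ?t j) * v (take (i - j) (drop j p), ?t i)
            * w (drop i p, x))"
    proof (intro sum.cong refl)
      fix i assume "i \<in> {..length p}"
      have *: "path_target G (drop j (take i p), ?t i) = ?t j" if "j \<le> i" for j
      proof -
        have "drop j p = drop j (take i p) @ drop i p"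
          using that by (metis append_take_drop_id drop_append drop_eq_Nil2 drop_take le_add_diff_inverse
              le_add_diff_inverse2 drop_drop take_drop)
        then show ?thesis by (simp add: path_target_append)
      qed
      show "(\<Sum>j\<le>i. u (take j (take i p), path_target G (drop j (take i p), ?t i)) *
            v (drop j (take i p), ?t i)) * w (drop i p, x) =
          (\<Sum>j\<le>i. u (take j p, ?t j) * v (take (i - j) (drop j p), ?t i) * w (drop i p, x))"
        unfolding sum_distrib_right by (intro sum.cong refl) (simp add: * min_absorb1, simp add: drop_take)
    qed
    also have "\<dots> = (\<Sum>j\<le>length p. \<Sum>l\<le>length p - j.
        u (take j p, ?t j) * v (take l (drop j p), ?t (j + l)) * w (drop (j + l) p, x))"
      using sum_triangle_swap[of "\<lambda>j i. u (take j p, ?t j) * v (take (i - j) (drop j p), ?t i)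
            * w (drop i p, x)" "length p"] by simp
    also have "\<dots> = (\<Sum>j\<le>length p. u (take j p, ?t j) * (\<Sum>l\<le>length p - j.
        v (take l (drop j p), ?t (j + l)) * w (drop (j + l) p, x)))"
      by (simp add: sum_distrib_left mult.assoc)
    also have "\<dots> = alg_mult G I u (alg_mult G I v w) (p, x)"
      using True path_basis_drop[OF True]
      by (auto simp: alg_mult_def add.commute intro!: sum.cong)
    finally show ?thesis .
  qed
qed

lemma alg_mult_one_left:
  assumes "u \<in> alg G I"
  shows "alg_mult G I (alg_one G) u = u"
proof (rule ext, clarify)
  fix p x
  show "alg_mult G I (alg_one G) u (p, x) = u (p, x)"
  proof (cases "(p, x) \<in> path_basis G I")
    case True
    have "(\<Sum>i\<le>length p. alg_one G (take i p, path_target G (drop i p, x)) * u (drop i p, x)) =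
        (\<Sum>i\<in>{0}. alg_one G (take i p, path_target G (drop i p, x)) * u (drop i p, x))"
      by (rule sum.mono_neutral_right) (auto simp: alg_one_def)
    then show ?thesis
      using True path_target_in_verts[OF True] by (simp add: alg_mult_def alg_one_def)
  next
    case False
    then show ?thesis using assms by (auto simp: alg_mult_def alg_def)
  qed
qed

lemma alg_mult_trivial_path:
  "alg_mult G I u (basis_elt ([], x)) =
    (\<lambda>w. if w \<in> path_basis G I \<and> snd w = x then u w else 0)"
proof (rule ext, clarify)
  fix p y
  have *: "(\<Sum>i\<le>length p. u (take i p, path_target G (drop i p, y)) * basis_elt ([], x) (drop i p, y)) =
      (\<Sum>i\<in>{length p}. u (take i p, path_target G (drop i p, y)) * basis_elt ([], x) (drop i p, y))"
    by (rule sum.mono_neutral_right) (auto simp: basis_elt_def)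
  show "alg_mult G I u (basis_elt ([], x)) (p, y) =
      (if (p, y) \<in> path_basis G I \<and> snd (p, y) = x then u (p, y) else 0)"
    using * by (auto simp: alg_mult_def path_target_def basis_elt_def)
qed

text \<open>
  Right multiplication by \<open>e\<^sub>x\<close> restricts a coefficient function to the paths starting at \<open>x\<close>.
\<close>

lemma mcarrier_proj:
  "mcarrier (proj G I x) =
    {u :: ('a, 'b) path \<Rightarrow> 'k::field. \<forall>w. u w \<noteq> 0 \<longrightarrow> w \<in> path_basis G I \<and> snd w = x}"
  (is "_ = ?R")
proof -
  have "u \<in> mcarrier (proj G I x)" if "u \<in> ?R" for u :: "('a, 'b) path \<Rightarrow> 'k"
  proof -
    have "u = alg_mult G I u (basis_elt ([], x))" "u \<in> alg G I"
      using that by (auto simp: alg_mult_trivial_path fun_eq_iff alg_def)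
    then show ?thesis by (auto simp: proj_def)
  qed
  moreover have "u \<in> ?R" if "u \<in> mcarrier (proj G I x)" for u :: "('a, 'b) path \<Rightarrow> 'k"
    using that by (auto simp: proj_def alg_mult_trivial_path alg_def split: if_splits)
  ultimately show ?thesis by blast
qed

lemma proj_in_alg: "u \<in> mcarrier (proj G I x) \<Longrightarrow> u \<in> alg G I"
  by (auto simp: mcarrier_proj alg_def)

lemma proj_add:
  "u \<in> mcarrier (proj G I x) \<Longrightarrow> v \<in> mcarrier (proj G I x) \<Longrightarrow> u + v \<in> mcarrier (proj G I x)"
  unfolding mcarrier_proj mem_Collect_eq plus_fun_apply by (metis add.right_neutral)

lemma proj_diff:
  "u \<in> mcarrier (proj G I x) \<Longrightarrow> v \<in> mcarrier (proj G I x) \<Longrightarrow> u - v \<in> mcarrier (proj G I x)"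
  unfolding mcarrier_proj mem_Collect_eq fun_diff_def by (metis diff_self)

lemma proj_0 [simp]: "0 \<in> mcarrier (proj G I x)"
  by (simp add: mcarrier_proj)

lemma proj_sum:
  "(\<And>j. j \<in> J \<Longrightarrow> u j \<in> mcarrier (proj G I x)) \<Longrightarrow> sum u J \<in> mcarrier (proj G I x)"
  by (induction J rule: infinite_finite_induct) (auto intro: proj_add)

lemma proj_scale:
  "u \<in> mcarrier (proj G I x) \<Longrightarrow> (\<lambda>w. c * u w) \<in> mcarrier (proj G I x)"
  by (auto simp: mcarrier_proj)

lemma fg_module_proj:
  assumes "x \<in> verts G"
  shows "fg_module G I (proj G I x :: ('a, 'b, 'k::field, ('a, 'b) path \<Rightarrow> 'k) qmod)"
proof -
  let ?P = "proj G I x :: ('a, 'b, 'k, ('a, 'b) path \<Rightarrow> 'k) qmod"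
  let ?e = "basis_elt ([], x) :: ('a, 'b) path \<Rightarrow> 'k"
  have act: "act ?P = alg_mult G I" by (simp add: proj_def)
  have closed: "alg_mult G I u m \<in> mcarrier ?P" if "m \<in> mcarrier ?P" for u m
    using that by (auto simp: proj_def alg_mult_assoc[symmetric] alg_mult_in_alg)
  have e: "?e \<in> mcarrier ?P"
    using assms by (auto simp: mcarrier_proj basis_elt_def path_basis_def split: if_splits)
  have gen: "m \<in> alg G I" "m = alg_mult G I m ?e" if "m \<in> mcarrier ?P" for m
    using that by (auto simp: mcarrier_proj alg_mult_trivial_path alg_def fun_eq_iff)
  have "\<exists>S. finite S \<and> S \<subseteq> mcarrier ?P \<and>
        (\<forall>m\<in>mcarrier ?P. \<exists>c. (\<forall>s\<in>S. c s \<in> alg G I) \<and> m = (\<Sum>s\<in>S. act ?P (c s) s))"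
  proof (intro exI[of _ "{?e}"] conjI ballI)
    fix m assume "m \<in> mcarrier ?P"
    then show "\<exists>c. (\<forall>s\<in>{?e}. c s \<in> alg G I) \<and> m = (\<Sum>s\<in>{?e}. act ?P (c s) s)"
      using gen by (intro exI[of _ "\<lambda>_. m"]) (simp add: act)
  qed (use e in auto)
  moreover have "m - n \<in> mcarrier ?P" if "m \<in> mcarrier ?P" "n \<in> mcarrier ?P" for m n
    using that proj_diff by blast
  ultimately show ?thesis
    unfolding fg_module_def
    by (auto simp: act closed alg_mult_add_left alg_mult_add_right alg_mult_assoc
        alg_mult_one_left proj_in_alg)
qed

lemma path_basis_elt_mult:
  fixes p q :: "'b list"
  assumes "p \<noteq> []" "q \<noteq> []"
  shows "alg_mult G I (basis_elt (p, path_start G p)) (basis_elt (q, path_start G q)) =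
    (if nonzero_path G I (p @ q) then basis_elt (p @ q, path_start G q) else (0 :: _ \<Rightarrow> 'k::field))"
    (is "alg_mult G I ?u ?v = ?r")
proof (rule ext, clarify)
  fix r y
  let ?F = "\<lambda>i. ?u (take i r, path_target G (drop i r, y)) * ?v (drop i r, y) :: 'k"
  have F0: "?F i = 0" if "i \<le> length r" "i \<noteq> length p" for i
  proof -
    have "length (take i r) \<noteq> length p" using that by simp
    then show ?thesis by (auto simp: basis_elt_def)
  qed
  show "alg_mult G I ?u ?v (r, y) = ?r (r, y)"
  proof (cases "(r, y) \<in> path_basis G I")
    case False
    have "(r, y) \<noteq> (p @ q, path_start G q)" if "nonzero_path G I (p @ q)"
      using False that nonzero_path_ends(1)[OF that] assms
      by (auto simp: path_basis_def path_start_append)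
    then show ?thesis using False by (auto simp: alg_mult_def basis_elt_def)
  next
    case True
    show ?thesis
    proof (cases "r = p @ q \<and> y = path_start G q")
      case True': True
      then have nz: "nonzero_path G I (p @ q)"
        using True assms by (auto simp: path_basis_def)
      have "path_target G (q, y) = path_start G p"
        using nz assms True' by (auto simp: nonzero_path_append path_target_def)
      then have "?F (length p) = 1"
        using True' by (simp add: basis_elt_def)
      moreover have "(\<Sum>i\<le>length r. ?F i) = (\<Sum>i\<in>{length p}. ?F i)"
        using F0 True' by (intro sum.mono_neutral_right) auto
      ultimately show ?thesis using True True' nz by (simp add: alg_mult_def basis_elt_def)
    next
      case False
      have "?F i = 0" if "i \<le> length r" for i
        using False append_take_drop_id[of i r] by (auto simp: basis_elt_def)
      then have "(\<Sum>i\<le>length r. ?F i) = 0"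
        by (intro sum.neutral) blast
      moreover have "?r (r, y) = 0"
        using False by (auto simp: basis_elt_def)
      ultimately show ?thesis by (simp add: alg_mult_def)
    qed
  qed
qed

end

subsection \<open>Maps between projectives induced by paths\<close>

lemma path_map_add: "path_map Q I c p (u + v) = path_map Q I c p u + path_map Q I c p v"
  by (auto simp: path_map_def alg_mult_add_left fun_eq_iff distrib_left)

lemma path_map_0 [simp]: "path_map Q I c p 0 = 0"
  by (auto simp: path_map_def fun_eq_iff)

lemma path_map_sum: "path_map Q I c p (\<Sum>j\<in>J. u j) = (\<Sum>j\<in>J. path_map Q I c p (u j))"
  using sum_comp_morphism[where h="path_map Q I c p" and g=u and A=J]
  by (simp add: path_map_add comp_def)

lemma path_map_scale:
  "path_map Q I c p (\<lambda>w. b * u w) = path_map Q I (b * c) p u"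
  "(\<lambda>w. b * path_map Q I c p u w) = path_map Q I (b * c) p u"
  by (auto simp: path_map_def alg_mult_scale_left fun_eq_iff)

lemma path_map_uminus: "- path_map Q I c p u = path_map Q I (- c) p u"
  by (auto simp: path_map_def fun_eq_iff)

context wf_digraph
begin

lemma path_map_alg_mult: "path_map G I c p (alg_mult G I a u) = alg_mult G I a (path_map G I c p u)"
  by (simp add: path_map_def alg_mult_assoc alg_mult_scale_right)

lemma path_map_in_proj: "path_map G I c p u \<in> mcarrier (proj G I (path_start G p))"
proof -
  have "x = path_start G p" if nz: "alg_mult G I u (basis_elt (p, path_start G p)) (r, x) \<noteq> 0" for r x
  proof (rule ccontr)
    assume "x \<noteq> path_start G p"
    then have "alg_mult G I u (basis_elt (p, path_start G p)) (r, x) = 0"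
      by (simp add: alg_mult_def basis_elt_def)
    with nz show False by contradiction
  qed
  then show ?thesis
    using alg_mult_in_alg[of G I u "basis_elt (p, path_start G p)"]
    by (auto simp: path_map_def mcarrier_proj alg_def)
qed

lemma path_map_comp:
  assumes "p \<noteq> []" "q \<noteq> []"
  shows "path_map G I c q (path_map G I b p u) =
    (if nonzero_path G I (p @ q) then path_map G I (b * c) (p @ q) u else 0)"
proof -
  have "path_map G I c q (path_map G I b p u) =
      (\<lambda>w. b * c * alg_mult G I u (alg_mult G I (basis_elt (p, path_start G p))
         (basis_elt (q, path_start G q))) w)"
    by (simp add: path_map_def alg_mult_scale_left alg_mult_assoc mult_ac)
  then show ?thesis
    using assms by (auto simp: path_basis_elt_mult path_map_def path_start_append fun_eq_iff)
qed

text \<open>The scalar of a map between projectives is read off from the image of the generator.\<close>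

lemma path_map_trivial_path:
  fixes c :: "'k::field"
  assumes "nonzero_path G I p"
  shows "path_map G I c p (basis_elt ([], path_end G p)) (p, path_start G p) = c"
proof -
  have p: "p \<noteq> []" and pb: "(p, path_start G p) \<in> path_basis G I"
    using assms nonzero_path_ends(1)[OF assms] by (auto simp: path_basis_def nonzero_path_def)
  let ?F = "\<lambda>i. basis_elt ([], path_end G p) (take i p, path_target G (drop i p, path_start G p)) *
      basis_elt (p, path_start G p) (drop i p, path_start G p) :: 'k"
  have "(\<Sum>i\<le>length p. ?F i) = (\<Sum>i\<in>{0}. ?F i)"
    by (rule sum.mono_neutral_right) (use p in \<open>auto simp: basis_elt_def\<close>)
  also have "\<dots> = 1" using p by (simp add: basis_elt_def path_target_def)
  finally show ?thesis using pb by (simp add: path_map_def alg_mult_def)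
qed

end

section \<open>Finitely generated modules and bounded complexes\<close>

lemma sum_fun_apply: "(\<Sum>j\<in>J. u j) x = (\<Sum>j\<in>J. u j x)"
  using sum_comp_morphism[where h="\<lambda>f. f x" and g=u and A=J] by (simp add: comp_def)

lemma fg_module_closed:
  assumes "fg_module Q I M"
  shows "0 \<in> mcarrier M"
    and "m \<in> mcarrier M \<Longrightarrow> n \<in> mcarrier M \<Longrightarrow> m + n \<in> mcarrier M"
    and "u \<in> alg Q I \<Longrightarrow> m \<in> mcarrier M \<Longrightarrow> act M u m \<in> mcarrier M"
    and "u \<in> alg Q I \<Longrightarrow> v \<in> alg Q I \<Longrightarrow> m \<in> mcarrier M \<Longrightarrow> act M (u + v) m = act M u m + act M v m"
    and "u \<in> alg Q I \<Longrightarrow> act M u 0 = 0"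
    and "m \<in> mcarrier M \<Longrightarrow> act M 0 m = 0"
    and "u \<in> alg Q I \<Longrightarrow> m \<in> mcarrier M \<Longrightarrow> n \<in> mcarrier M \<Longrightarrow> act M u (m + n) = act M u m + act M u n"
    and "m \<in> mcarrier M \<Longrightarrow> - m \<in> mcarrier M"
proof -
  show zero: "0 \<in> mcarrier M" using assms by (simp add: fg_module_def)
  have diff: "m - n \<in> mcarrier M" if "m \<in> mcarrier M" "n \<in> mcarrier M" for m n
    using assms that by (simp add: fg_module_def)
  show "m + n \<in> mcarrier M" if "m \<in> mcarrier M" "n \<in> mcarrier M"
    using diff[OF that(1) diff[OF zero that(2)]] by simp
  show "act M u m \<in> mcarrier M" if "u \<in> alg Q I" "m \<in> mcarrier M"
    using assms that by (simp add: fg_module_def)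
  show add: "act M (u + v) m = act M u m + act M v m"
    if "u \<in> alg Q I" "v \<in> alg Q I" "m \<in> mcarrier M" for u v m
    using assms that by (simp add: fg_module_def)
  show "act M u 0 = 0" if "u \<in> alg Q I"
  proof -
    have "act M u (0 + 0) = act M u 0 + act M u 0"
      using assms that zero by (simp only: fg_module_def)
    then show ?thesis by simp
  qed
  show "act M 0 m = 0" if "m \<in> mcarrier M"
    using add[OF alg_0 alg_0 that] by simp
  show "act M u (m + n) = act M u m + act M u n"
    if "u \<in> alg Q I" "m \<in> mcarrier M" "n \<in> mcarrier M"
    using assms that by (simp add: fg_module_def)
  show "- m \<in> mcarrier M" if "m \<in> mcarrier M"
    using diff[OF zero that] by simp
qed

lemma fg_module_act_sum:
  assumes "fg_module Q I M" "m \<in> mcarrier M" "finite J" "\<And>j. j \<in> J \<Longrightarrow> c j \<in> alg Q I"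
  shows "act M (sum c J) m = (\<Sum>j\<in>J. act M (c j) m)"
  using assms(3,4)
proof (induction J rule: finite_induct)
  case empty
  show ?case unfolding sum.empty by (rule fg_module_closed(6)[OF assms(1,2)])
next
  case (insert j J)
  have *: "act M (c j + sum c J) m = act M (c j) m + act M (sum c J) m"
    using insert.prems by (intro fg_module_closed(4)[OF assms(1)] alg_sum assms(2)) auto
  have IH: "act M (sum c J) m = (\<Sum>j\<in>J. act M (c j) m)"
    using insert.prems by (intro insert.IH) auto
  show ?case
    unfolding sum.insert[OF insert.hyps] * IH ..
qed

lemma module_dsum_carrier:
  "u \<in> mcarrier (module_dsum S M) \<longleftrightarrow> (\<forall>i\<in>S. u i \<in> mcarrier (M i)) \<and> (\<forall>i. i \<notin> S \<longrightarrow> u i = 0)"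
  by (auto simp: module_dsum_def)

lemma module_dsum_act:
  "act (module_dsum S M) a u = (\<lambda>i. if i \<in> S then act (M i) a (u i) else 0)"
  by (simp add: module_dsum_def)

lemma fg_module_dsum:
  fixes M :: "'i \<Rightarrow> ('v, 'a, 'k::field, 'm::ab_group_add) qmod"
  assumes "finite S" and M: "\<And>i. i \<in> S \<Longrightarrow> fg_module Q I (M i)"
  shows "fg_module Q I (module_dsum S M)"
proof -
  let ?D = "module_dsum S M"
  have "\<exists>T. \<forall>i\<in>S. finite (T i) \<and> T i \<subseteq> mcarrier (M i) \<and>
      (\<forall>m\<in>mcarrier (M i). \<exists>c. (\<forall>s\<in>T i. c s \<in> alg Q I) \<and> m = (\<Sum>s\<in>T i. act (M i) (c s) s))"
    by (rule bchoice) (use M in \<open>simp add: fg_module_def\<close>)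
  then obtain T where "\<forall>i\<in>S. finite (T i) \<and> T i \<subseteq> mcarrier (M i) \<and>
      (\<forall>m\<in>mcarrier (M i). \<exists>c. (\<forall>s\<in>T i. c s \<in> alg Q I) \<and> m = (\<Sum>s\<in>T i. act (M i) (c s) s))"
    by (rule exE)
  then have T: "\<And>i. i \<in> S \<Longrightarrow> finite (T i)" "\<And>i. i \<in> S \<Longrightarrow> T i \<subseteq> mcarrier (M i)"
    and gen: "\<And>i m. i \<in> S \<Longrightarrow> m \<in> mcarrier (M i) \<Longrightarrow>
      \<exists>c. (\<forall>s\<in>T i. c s \<in> alg Q I) \<and> m = (\<Sum>s\<in>T i. act (M i) (c s) s)"
    by simp_all
  define g where "g = (\<lambda>(i::'i, s) j. if j = i then s else (0::'m))"
  let ?J = "Sigma S T"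
  have J: "finite ?J" using assms(1) T(1) by blast
  have g: "g q \<in> mcarrier ?D" if "q \<in> ?J" for q
    using that T(2) M by (fastforce simp: g_def module_dsum_carrier fg_module_closed(1))
  have act_add: "act ?D (a + b) u = act ?D a u + act ?D b u"
    if "a \<in> alg Q I" "b \<in> alg Q I" "u \<in> mcarrier ?D" for a b u
    using that(3) fg_module_closed(4)[OF M that(1,2)]
    by (auto simp: module_dsum_act module_dsum_carrier fun_eq_iff)
  have fam: "\<exists>c. (\<forall>q\<in>?J. c q \<in> alg Q I) \<and> m = (\<Sum>q\<in>?J. act ?D (c q) (g q))"
    if m: "m \<in> mcarrier ?D" for m
  proof -
    have "\<exists>c. \<forall>i\<in>S. (\<forall>s\<in>T i. c i s \<in> alg Q I) \<and> m i = (\<Sum>s\<in>T i. act (M i) (c i s) s)"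
      by (rule bchoice) (use gen m in \<open>simp add: module_dsum_carrier\<close>)
    then obtain c where "\<forall>i\<in>S. (\<forall>s\<in>T i. c i s \<in> alg Q I) \<and> m i = (\<Sum>s\<in>T i. act (M i) (c i s) s)"
      by (rule exE)
    then have c: "\<And>i s. i \<in> S \<Longrightarrow> s \<in> T i \<Longrightarrow> c i s \<in> alg Q I"
      "\<And>i. i \<in> S \<Longrightarrow> m i = (\<Sum>s\<in>T i. act (M i) (c i s) s)"
      by blast+
    have m_eq: "m j = (\<Sum>q\<in>?J. act ?D (case q of (i, s) \<Rightarrow> c i s) (g q)) j" for j
    proof (cases "j \<in> S")
      case False
      then show ?thesis using m by (simp add: sum_fun_apply module_dsum_act module_dsum_carrier)
    next
      case True
      have "(\<Sum>q\<in>?J. act ?D (case q of (i, s) \<Rightarrow> c i s) (g q)) j =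
          (\<Sum>q\<in>?J. act (M j) (case q of (i, s) \<Rightarrow> c i s) (g q j))"
        using True by (simp add: sum_fun_apply module_dsum_act)
      also have "\<dots> = (\<Sum>i\<in>S. \<Sum>s\<in>T i. act (M j) (c i s) (g (i, s) j))"
        using assms(1) T(1) by (simp add: sum.Sigma split_def)
      also have "\<dots> = (\<Sum>i\<in>S. if i = j then \<Sum>s\<in>T j. act (M j) (c j s) s else 0)"
        using fg_module_closed(5)[OF M[OF True]] c(1)
        by (intro sum.cong refl) (auto simp: g_def intro!: sum.neutral)
      also have "\<dots> = m j" using assms(1) True c(2) by simp
      finally show ?thesis by simp
    qed
    show ?thesis
    proof (intro exI[of _ "\<lambda>q. case q of (i, s) \<Rightarrow> c i s"] conjI ballI)
      show "m = (\<Sum>q\<in>?J. act ?D (case q of (i, s) \<Rightarrow> c i s) (g q))"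
        by (rule ext) (rule m_eq)
    qed (use c(1) in auto)
  qed
  have "\<exists>c. (\<forall>s\<in>g ` ?J. c s \<in> alg Q I) \<and> m = (\<Sum>s\<in>g ` ?J. act ?D (c s) s)"
    if m: "m \<in> mcarrier ?D" for m
  proof -
    obtain c where c: "\<forall>q\<in>?J. c q \<in> alg Q I" "m = (\<Sum>q\<in>?J. act ?D (c q) (g q))"
      using fam[OF m] by blast
    (* Generators of different summands may be equal (to zero); then their coefficients are added. *)
    let ?c = "\<lambda>s. \<Sum>q\<in>{q \<in> ?J. g q = s}. c q"
    have act_sum: "act ?D (sum c K) u = (\<Sum>q\<in>K. act ?D (c q) u)"
      if "K \<subseteq> ?J" "u \<in> mcarrier ?D" for K u
    proof -
      have "act ?D (sum c K) u i = (\<Sum>q\<in>K. act ?D (c q) u) i" for i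
      proof (cases "i \<in> S")
        case True
        then have "act (M i) (sum c K) (u i) = (\<Sum>q\<in>K. act (M i) (c q) (u i))"
          using that c(1) finite_subset[OF that(1) J]
          by (intro fg_module_act_sum[OF M]) (auto simp: module_dsum_carrier)
        with True show ?thesis by (simp add: module_dsum_act sum_fun_apply)
      qed (simp add: module_dsum_act sum_fun_apply)
      then show ?thesis by (rule ext)
    qed
    have "m = (\<Sum>s\<in>g ` ?J. \<Sum>q\<in>{q \<in> ?J. g q = s}. act ?D (c q) (g q))"
      unfolding c(2) by (rule sum.image_gen[OF J])
    also have "\<dots> = (\<Sum>s\<in>g ` ?J. act ?D (?c s) s)"
    proof (rule sum.cong[OF refl])
      fix s assume "s \<in> g ` ?J"
      then have "s \<in> mcarrier ?D" using g by blast
      then have "act ?D (?c s) s = (\<Sum>q\<in>{q \<in> ?J. g q = s}. act ?D (c q) s)"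
        by (intro act_sum) auto
      also have "\<dots> = (\<Sum>q\<in>{q \<in> ?J. g q = s}. act ?D (c q) (g q))"
        by (rule sum.cong) auto
      finally show "(\<Sum>q\<in>{q \<in> ?J. g q = s}. act ?D (c q) (g q)) = act ?D (?c s) s" ..
    qed
    finally have "m = (\<Sum>s\<in>g ` ?J. act ?D (?c s) s)" .
    moreover have "?c s \<in> alg Q I" for s using c(1) by (intro alg_sum) auto
    ultimately show ?thesis by (intro exI[of _ ?c]) blast
  qed
  then have fin: "\<exists>T. finite T \<and> T \<subseteq> mcarrier ?D \<and>
      (\<forall>m\<in>mcarrier ?D. \<exists>c. (\<forall>s\<in>T. c s \<in> alg Q I) \<and> m = (\<Sum>s\<in>T. act ?D (c s) s))"
    using J g by (intro exI[of _ "g ` ?J"]) blast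
  have ax: "\<And>i m n. i \<in> S \<Longrightarrow> m \<in> mcarrier (M i) \<Longrightarrow> n \<in> mcarrier (M i) \<Longrightarrow> m - n \<in> mcarrier (M i)"
    "\<And>i u m. i \<in> S \<Longrightarrow> u \<in> alg Q I \<Longrightarrow> m \<in> mcarrier (M i) \<Longrightarrow> act (M i) u m \<in> mcarrier (M i)"
    "\<And>i u m n. i \<in> S \<Longrightarrow> u \<in> alg Q I \<Longrightarrow> m \<in> mcarrier (M i) \<Longrightarrow> n \<in> mcarrier (M i) \<Longrightarrow>
        act (M i) u (m + n) = act (M i) u m + act (M i) u n"
    "\<And>i u v m. i \<in> S \<Longrightarrow> u \<in> alg Q I \<Longrightarrow> v \<in> alg Q I \<Longrightarrow> m \<in> mcarrier (M i) \<Longrightarrow>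
        act (M i) (alg_mult Q I u v) m = act (M i) u (act (M i) v m)"
    "\<And>i m. i \<in> S \<Longrightarrow> m \<in> mcarrier (M i) \<Longrightarrow> act (M i) (alg_one Q) m = m"
    "\<And>i. i \<in> S \<Longrightarrow> 0 \<in> mcarrier (M i)"
    using M by (simp_all add: fg_module_def)
  show ?thesis
    unfolding fg_module_def
  proof (intro conjI ballI)
    show "0 \<in> mcarrier ?D" using ax(6) by (simp add: module_dsum_carrier)
  next
    fix m n assume "m \<in> mcarrier ?D" "n \<in> mcarrier ?D"
    then show "m - n \<in> mcarrier ?D" using ax(1) by (simp add: module_dsum_carrier)
  next
    fix u :: "('v, 'a) path \<Rightarrow> 'k" and m assume "u \<in> alg Q I" "m \<in> mcarrier ?D"
    then show "act ?D u m \<in> mcarrier ?D"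
      using ax(2) by (simp add: module_dsum_carrier module_dsum_act)
  next
    fix u :: "('v, 'a) path \<Rightarrow> 'k" and m n assume "u \<in> alg Q I" "m \<in> mcarrier ?D" "n \<in> mcarrier ?D"
    then show "act ?D u (m + n) = act ?D u m + act ?D u n"
      using ax(3) by (auto simp: module_dsum_carrier module_dsum_act fun_eq_iff)
  next
    fix u v :: "('v, 'a) path \<Rightarrow> 'k" and m assume "u \<in> alg Q I" "v \<in> alg Q I" "m \<in> mcarrier ?D"
    then show "act ?D (u + v) m = act ?D u m + act ?D v m" by (rule act_add)
  next
    fix u v :: "('v, 'a) path \<Rightarrow> 'k" and m assume "u \<in> alg Q I" "v \<in> alg Q I" "m \<in> mcarrier ?D"
    then show "act ?D (alg_mult Q I u v) m = act ?D u (act ?D v m)"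
      using ax(4) by (auto simp: module_dsum_carrier module_dsum_act fun_eq_iff)
  next
    fix m assume "m \<in> mcarrier ?D"
    then show "act ?D (alg_one Q) m = m"
      using ax(5) by (auto simp: module_dsum_carrier module_dsum_act fun_eq_iff)
  qed (rule fin)
qed

lemma module_homD:
  assumes "f \<in> module_hom Q I M N"
  shows "m \<in> mcarrier M \<Longrightarrow> f m \<in> mcarrier N"
    and "m \<in> mcarrier M \<Longrightarrow> n \<in> mcarrier M \<Longrightarrow> f (m + n) = f m + f n"
    and "u \<in> alg Q I \<Longrightarrow> m \<in> mcarrier M \<Longrightarrow> f (act M u m) = act N u (f m)"
  using assms by (simp_all add: module_hom_def)

lemma module_hom_zero: "f \<in> module_hom Q I M N \<Longrightarrow> 0 \<in> mcarrier M \<Longrightarrow> f 0 = 0"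
  using module_homD(2)[of f Q I M N 0 0] by simp

lemma module_hom_comp:
  "f \<in> module_hom Q I M N \<Longrightarrow> g \<in> module_hom Q I N P \<Longrightarrow> g \<circ> f \<in> module_hom Q I M P"
  by (simp add: module_hom_def)

lemma cochain_map_comp:
  assumes "cochain_map Q I X Y f" "cochain_map Q I Y Z g"
  shows "cochain_map Q I X Z (\<lambda>n. g n \<circ> f n)"
proof -
  have "f n x \<in> mcarrier (obj Y n)" if "x \<in> mcarrier (obj X n)" for n x
    using assms(1) that module_homD(1) unfolding cochain_map_def by blast
  moreover have "g n \<circ> f n \<in> module_hom Q I (obj X n) (obj Z n)" for n
    using assms module_hom_comp unfolding cochain_map_def by blast
  ultimately show ?thesis using assms by (simp add: cochain_map_def)
qed

lemma cochain_map_id: "cochain_map Q I X X (\<lambda>n. id)"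
  by (simp add: cochain_map_def module_hom_def)

lemma homotopic_if_equal:
  assumes X: "bounded_complex Q I X" and Y: "bounded_complex Q I Y"
    and eq: "\<And>n x. x \<in> mcarrier (obj X n) \<Longrightarrow> f n x = g n x"
  shows "homotopic Q I X Y f g"
  unfolding homotopic_def
proof (intro exI[of _ "\<lambda>_ _. 0"] allI conjI ballI)
  fix n x assume x: "x \<in> mcarrier (obj X n)"
  have Y': "fg_module Q I (obj Y n)" "diff Y n \<in> module_hom Q I (obj Y n) (obj Y (n + 1))" for n
    using Y by (simp_all add: bounded_complex_def)
  show "f n x - g n x = diff Y (n - 1) 0 + 0"
    using eq[OF x] module_hom_zero[OF Y'(2) fg_module_closed(1)[OF Y'(1)]] by simp
next
  fix n
  have "fg_module Q I (obj Y (n - 1))" using Y by (simp add: bounded_complex_def)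
  from fg_module_closed(1,5)[OF this]
  show "(\<lambda>_. 0) \<in> module_hom Q I (obj X n) (obj Y (n - 1))"
    by (simp add: module_hom_def)
qed

lemma quasi_iso_id: "bounded_complex Q I X \<Longrightarrow> quasi_iso Q I X X (\<lambda>n. id)"
proof -
  assume X: "bounded_complex Q I X"
  have "0 \<in> coboundaries X n" for n
  proof -
    have Y': "fg_module Q I (obj X (n-1))" "diff X (n-1) \<in> module_hom Q I (obj X (n-1)) (obj X n)"
      using X spec[of "\<lambda>n. diff X n \<in> module_hom Q I (obj X n) (obj X (n + 1))" "n - 1"]
      by (simp_all add: bounded_complex_def)
    then show ?thesis
      unfolding coboundaries_def using module_hom_zero[OF Y'(2) fg_module_closed(1)[OF Y'(1)]]
        fg_module_closed(1)[OF Y'(1)] by force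
  qed
  then show ?thesis
    unfolding quasi_iso_def by (auto simp: cochain_map_id intro!: bexI)
qed

text \<open>
  The isomorphisms needed here are strict, that is, given by mutually inverse cochain maps; they
  may relate complexes with different ambient groups.
\<close>

definition isomorphic_complexes :: "('v, 'a) pre_digraph \<Rightarrow> ('a \<times> 'a) set \<Rightarrow>
    ('v, 'a, 'k::field, 'm::ab_group_add) qcpx \<Rightarrow> ('v, 'a, 'k, 'n::ab_group_add) qcpx \<Rightarrow> bool" where
  "isomorphic_complexes Q I X Y \<longleftrightarrow> (\<exists>\<phi> \<psi>. cochain_map Q I X Y \<phi> \<and> cochain_map Q I Y X \<psi> \<and>
     (\<forall>n. \<forall>x\<in>mcarrier (obj X n). \<psi> n (\<phi> n x) = x) \<and>
     (\<forall>n. \<forall>y\<in>mcarrier (obj Y n). \<phi> n (\<psi> n y) = y))"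

lemma isomorphic_complexes_sym: "isomorphic_complexes Q I X Y \<Longrightarrow> isomorphic_complexes Q I Y X"
  unfolding isomorphic_complexes_def by blast

lemma isomorphic_complexes_trans:
  assumes "isomorphic_complexes Q I X Y" "isomorphic_complexes Q I Y Z"
  shows "isomorphic_complexes Q I X Z"
proof -
  obtain f f' where f: "cochain_map Q I X Y f" "cochain_map Q I Y X f'"
    "\<And>n x. x \<in> mcarrier (obj X n) \<Longrightarrow> f' n (f n x) = x"
    "\<And>n y. y \<in> mcarrier (obj Y n) \<Longrightarrow> f n (f' n y) = y"
    using assms(1) unfolding isomorphic_complexes_def by blast
  obtain g g' where g: "cochain_map Q I Y Z g" "cochain_map Q I Z Y g'"
    "\<And>n x. x \<in> mcarrier (obj Y n) \<Longrightarrow> g' n (g n x) = x"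
    "\<And>n y. y \<in> mcarrier (obj Z n) \<Longrightarrow> g n (g' n y) = y"
    using assms(2) unfolding isomorphic_complexes_def by blast
  have "f n x \<in> mcarrier (obj Y n)" if "x \<in> mcarrier (obj X n)" for n x
    using f(1) that module_homD(1) unfolding cochain_map_def by blast
  moreover have "g' n x \<in> mcarrier (obj Y n)" if "x \<in> mcarrier (obj Z n)" for n x
    using g(2) that module_homD(1) unfolding cochain_map_def by blast
  ultimately show ?thesis
    unfolding isomorphic_complexes_def
    using f(3,4) g(3,4) cochain_map_comp[OF f(1) g(1)] cochain_map_comp[OF g(2) f(2)]
    by (intro exI[of _ "\<lambda>n. g n \<circ> f n"] exI[of _ "\<lambda>n. f' n \<circ> g' n"]) (auto simp: comp_def)
qed

text \<open>The inverse of a bijective cochain map commutes with the differentials by itself.\<close>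

lemma isomorphic_complexesI:
  assumes \<phi>: "cochain_map Q I X Y \<phi>"
    and \<psi>: "\<And>n. \<psi> n \<in> module_hom Q I (obj Y n) (obj X n)"
    and d: "\<And>n x. x \<in> mcarrier (obj X n) \<Longrightarrow> diff X n x \<in> mcarrier (obj X (n + 1))"
    and inv: "\<And>n x. x \<in> mcarrier (obj X n) \<Longrightarrow> \<psi> n (\<phi> n x) = x"
      "\<And>n y. y \<in> mcarrier (obj Y n) \<Longrightarrow> \<phi> n (\<psi> n y) = y"
  shows "isomorphic_complexes Q I X Y"
proof -
  have "\<psi> (n + 1) (diff Y n y) = diff X n (\<psi> n y)" if y: "y \<in> mcarrier (obj Y n)" for n y
  proof -
    have m: "\<psi> n y \<in> mcarrier (obj X n)" using module_homD(1)[OF \<psi> y] .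
    have "diff Y n y = diff Y n (\<phi> n (\<psi> n y))" using inv(2)[OF y] by simp
    also have "\<dots> = \<phi> (n + 1) (diff X n (\<psi> n y))" using \<phi> m by (simp add: cochain_map_def)
    finally show ?thesis using inv(1)[OF d[OF m]] by simp
  qed
  then have "cochain_map Q I Y X \<psi>" using \<psi> by (simp add: cochain_map_def)
  then show ?thesis using \<phi> inv unfolding isomorphic_complexes_def by blast
qed

text \<open>
  Cochain maps are roofs whose quasi-isomorphism is the identity, so two mutually inverse ones give
  mutually inverse roofs; the homotopies required are zero.
\<close>

lemma derived_iso_if_isomorphic:
  assumes X: "bounded_complex Q I X" and Y: "bounded_complex Q I Y"
    and iso: "isomorphic_complexes Q I X Y"
  shows "derived_iso Q I X Y"
proof -
  obtain f g where f: "cochain_map Q I X Y f" and g: "cochain_map Q I Y X g"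
    and gf: "\<And>n x. x \<in> mcarrier (obj X n) \<Longrightarrow> g n (f n x) = x"
    and fg: "\<And>n y. y \<in> mcarrier (obj Y n) \<Longrightarrow> f n (g n y) = y"
    using iso unfolding isomorphic_complexes_def by blast
  have comp: "roof_composite Q I Y (X, \<lambda>n. id, f) (Y, \<lambda>n. id, g) (X, \<lambda>n. id, \<lambda>n. g n \<circ> f n)"
    if X: "bounded_complex Q I X" and Y: "bounded_complex Q I Y" and f: "cochain_map Q I X Y f"
    for X Y :: "('a, 'b, 'c, 'd) qcpx" and f g
    unfolding roof_composite_def
    unfolding prod.case
    by (rule exI[of _ X], rule exI[of _ "\<lambda>n. id"], rule exI[of _ f])
      (simp add: X f quasi_iso_id[OF X] homotopic_if_equal[OF X Y])
  have equiv: "roof_equiv Q I X X (X, \<lambda>n. id, \<lambda>n. g n \<circ> f n) (roof_id X)"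
    if X: "bounded_complex Q I X" and gf: "\<And>n x. x \<in> mcarrier (obj X n) \<Longrightarrow> g n (f n x) = x"
    for X :: "('a, 'b, 'c, 'd) qcpx" and f g
    unfolding roof_equiv_def roof_id_def
    unfolding prod.case
    by (rule exI[of _ X], rule exI[of _ "\<lambda>n. id"], rule exI[of _ "\<lambda>n. id"])
      (simp add: X gf quasi_iso_id[OF X] homotopic_if_equal[OF X X] cochain_map_id)
  have "is_roof Q I X Y (X, \<lambda>n. id, f)" "is_roof Q I Y X (Y, \<lambda>n. id, g)"
    using X Y f g quasi_iso_id by (auto simp: is_roof_def)
  then show ?thesis
    unfolding derived_iso_def
    using X Y comp[OF X Y f] comp[OF Y X g] equiv[of X g f, OF X gf] equiv[of Y f g, OF Y fg] by blast
qed

lemma bounded_complex_dsum: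
  assumes "finite S" and X: "\<And>i. i \<in> S \<Longrightarrow> bounded_complex Q I (X i)"
  shows "bounded_complex Q I (complex_dsum S X)"
proof -
  have fg: "fg_module Q I (obj (X i) n)"
    and hom: "diff (X i) n \<in> module_hom Q I (obj (X i) n) (obj (X i) (n + 1))"
    and d2: "x \<in> mcarrier (obj (X i) n) \<Longrightarrow> diff (X i) (n + 1) (diff (X i) n x) = 0"
    if "i \<in> S" for i n x
    using X[OF that] by (simp_all add: bounded_complex_def)
  have "\<exists>N. \<forall>i\<in>S. \<forall>n. \<bar>n\<bar> > N i \<longrightarrow> mcarrier (obj (X i) n) = {0}"
    by (rule bchoice) (use X in \<open>simp add: bounded_complex_def\<close>)
  then obtain N where N: "\<And>i n. i \<in> S \<Longrightarrow> \<bar>n\<bar> > N i \<Longrightarrow> mcarrier (obj (X i) n) = {0}"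
    by blast
  have bd: "mcarrier (obj (complex_dsum S X) n) = {0}" if "\<bar>n\<bar> > (\<Sum>i\<in>S. \<bar>N i\<bar>)" for n
  proof -
    have "mcarrier (obj (X i) n) = {0}" if i: "i \<in> S" for i
      using member_le_sum[OF i, of "\<lambda>i. \<bar>N i\<bar>"] assms(1) \<open>\<bar>n\<bar> > _\<close> by (intro N[OF i]) auto
    then have "u i = 0" if "u \<in> mcarrier (obj (complex_dsum S X) n)" for u i
      using that by (cases "i \<in> S") (auto simp: complex_dsum_def module_dsum_carrier)
    then have "u = 0" if "u \<in> mcarrier (obj (complex_dsum S X) n)" for u
      using that by (intro ext) simp
    moreover have "0 \<in> mcarrier (obj (complex_dsum S X) n)"
      using fg_module_closed(1)[OF fg] by (simp add: complex_dsum_def module_dsum_carrier)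
    ultimately show ?thesis by blast
  qed
  have "diff (complex_dsum S X) n \<in>
      module_hom Q I (obj (complex_dsum S X) n) (obj (complex_dsum S X) (n + 1))" for n
    using hom by (auto simp: complex_dsum_def module_hom_def module_dsum_carrier module_dsum_act fun_eq_iff)
  moreover have "diff (complex_dsum S X) (n + 1) (diff (complex_dsum S X) n x) = 0"
    if "x \<in> mcarrier (obj (complex_dsum S X) n)" for n x
    using that d2 by (auto simp: complex_dsum_def module_dsum_carrier fun_eq_iff)
  ultimately show ?thesis
    using bd fg_module_dsum[of S Q I "\<lambda>i. obj (X i) _"] assms(1) fg
    unfolding bounded_complex_def by (auto simp: complex_dsum_def)
qed

lemma bounded_complex_mapping_cone:
  assumes P: "bounded_complex Q I P" and R: "bounded_complex Q I R" and f: "cochain_map Q I P R f"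
  shows "bounded_complex Q I (mapping_cone P R f)"
proof -
  let ?C = "mapping_cone P R f"
  have fg: "fg_module Q I (obj P n)" "fg_module Q I (obj R n)"
    and hom: "diff P n \<in> module_hom Q I (obj P n) (obj P (n + 1))"
      "diff R n \<in> module_hom Q I (obj R n) (obj R (n + 1))"
      "f n \<in> module_hom Q I (obj P n) (obj R n)"
    and d2: "x \<in> mcarrier (obj P n) \<Longrightarrow> diff P (n + 1) (diff P n x) = 0"
      "y \<in> mcarrier (obj R n) \<Longrightarrow> diff R (n + 1) (diff R n y) = 0"
    and comm: "x \<in> mcarrier (obj P n) \<Longrightarrow> f (n + 1) (diff P n x) = diff R n (f n x)"
    for n x y
    using assms by (simp_all add: bounded_complex_def cochain_map_def)
  have neg: "- x \<in> mcarrier M" "h (- x) = - h x"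
    if "fg_module Q I M" "h \<in> module_hom Q I M N" "x \<in> mcarrier M" for M and N :: "('a, 'b, 'c, 'd) qmod" and h and x :: 'd
  proof -
    show m: "- x \<in> mcarrier M" by (rule fg_module_closed(8)[OF that(1,3)])
    have "h x + h (- x) = 0"
      using module_homD(2)[OF that(2,3) m] module_hom_zero[OF that(2) fg_module_closed(1)[OF that(1)]]
      by simp
    then show "h (- x) = - h x" by (simp add: eq_neg_iff_add_eq_0 add.commute)
  qed
  have act_neg: "act M u (- x) = - act M u x" if "fg_module Q I M" "u \<in> alg Q I" "x \<in> mcarrier M"
    for M :: "('a, 'b, 'c, 'd) qmod" and u x
  proof -
    have "act M u (x + - x) = act M u x + act M u (- x)"
      by (rule fg_module_closed(7)[OF that fg_module_closed(8)[OF that(1,3)]])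
    then show ?thesis using fg_module_closed(5)[OF that(1,2)]
      by (simp add: eq_neg_iff_add_eq_0 add.commute)
  qed
  have obj: "mcarrier (obj ?C n) = {u. u 0 \<in> mcarrier (obj P (n + 1)) \<and> u 1 \<in> mcarrier (obj R n) \<and>
      (\<forall>i. i \<noteq> 0 \<and> i \<noteq> 1 \<longrightarrow> u i = 0)}" for n
    by (auto simp: mapping_cone_def module_dsum_carrier)
  have act: "act (obj ?C n) a u = (\<lambda>i. if i = 0 then act (obj P (n + 1)) a (u 0)
      else if i = 1 then act (obj R n) a (u 1) else 0)" for n a u
    by (auto simp: mapping_cone_def module_dsum_act)
  have d: "diff ?C n u = (\<lambda>i. if i = 0 then - diff P (n + 1) (u 0)
      else if i = 1 then f (n + 1) (u 0) + diff R n (u 1) else 0)" for n u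
    by (simp add: mapping_cone_def)
  have "fg_module Q I (obj ?C n)" for n
    unfolding mapping_cone_def using fg by (auto intro!: fg_module_dsum)
  moreover have "diff ?C n \<in> module_hom Q I (obj ?C n) (obj ?C (n + 1))" for n
  proof -
    have "diff ?C n u \<in> mcarrier (obj ?C (n + 1))" if "u \<in> mcarrier (obj ?C n)" for u
    proof -
      have u: "u 0 \<in> mcarrier (obj P (n + 1))" "u 1 \<in> mcarrier (obj R n)"
        using that by (auto simp: obj)
      have "- diff P (n + 1) (u 0) \<in> mcarrier (obj P (n + 1 + 1))"
        by (rule neg(1)[OF fg(1) hom(1)]) (rule module_homD(1)[OF hom(1) u(1)])
      moreover have "f (n + 1) (u 0) + diff R n (u 1) \<in> mcarrier (obj R (n + 1))"
        by (intro fg_module_closed(2)[OF fg(2)] module_homD(1)[OF hom(3) u(1)]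
            module_homD(1)[OF hom(2) u(2)])
      ultimately show ?thesis by (simp add: obj d)
    qed
    moreover have "diff ?C n (u + v) = diff ?C n u + diff ?C n v"
      if "u \<in> mcarrier (obj ?C n)" "v \<in> mcarrier (obj ?C n)" for u v
      using that module_homD(2)[OF hom(1)] module_homD(2)[OF hom(2)] module_homD(2)[OF hom(3)]
      by (auto simp: obj d fun_eq_iff algebra_simps)
    moreover have "diff ?C n (act (obj ?C n) a u) = act (obj ?C (n + 1)) a (diff ?C n u)"
      if a: "a \<in> alg Q I" and "u \<in> mcarrier (obj ?C n)" for a u
    proof -
      have u: "u 0 \<in> mcarrier (obj P (n + 1))" "u 1 \<in> mcarrier (obj R n)"
        using that by (auto simp: obj)
      have "act (obj R (n + 1)) a (f (n + 1) (u 0) + diff R n (u 1)) =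
          act (obj R (n + 1)) a (f (n + 1) (u 0)) + act (obj R (n + 1)) a (diff R n (u 1))"
        by (rule fg_module_closed(7)[OF fg(2) a module_homD(1)[OF hom(3) u(1)]
              module_homD(1)[OF hom(2) u(2)]])
      moreover have "- diff P (n + 1) (act (obj P (n + 1)) a (u 0)) =
          act (obj P (n + 1 + 1)) a (- diff P (n + 1) (u 0))"
        using module_homD(3)[OF hom(1) a u(1)] act_neg[OF fg(1) a module_homD(1)[OF hom(1) u(1)]] by simp
      ultimately show ?thesis
        using module_homD(3)[OF hom(2) a u(2)] module_homD(3)[OF hom(3) a u(1)]
        by (auto simp: act d fun_eq_iff)
    qed
    ultimately show ?thesis by (simp add: module_hom_def)
  qed
  moreover have "diff ?C (n + 1) (diff ?C n u) = 0" if "u \<in> mcarrier (obj ?C n)" for n u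
  proof -
    have u: "u 0 \<in> mcarrier (obj P (n + 1))" "u 1 \<in> mcarrier (obj R n)"
      using that by (auto simp: obj)
    have "diff P (n + 1 + 1) (- diff P (n + 1) (u 0)) = 0"
      using neg(2)[OF fg(1) hom(1) module_homD(1)[OF hom(1) u(1)]] d2(1)[OF u(1)] by simp
    moreover have "f (n + 1 + 1) (- diff P (n + 1) (u 0)) = - f (n + 1 + 1) (diff P (n + 1) (u 0))"
      by (rule neg(2)[OF fg(1) hom(3) module_homD(1)[OF hom(1) u(1)]])
    moreover have "diff R (n + 1) (f (n + 1) (u 0) + diff R n (u 1)) = diff R (n + 1) (f (n + 1) (u 0))"
      using module_homD(2)[OF hom(2) module_homD(1)[OF hom(3) u(1)] module_homD(1)[OF hom(2) u(2)]]
        d2(2)[OF u(2)] by simp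
    ultimately show ?thesis
      using comm[OF u(1)] by (auto simp: d fun_eq_iff)
  qed
  moreover have "\<exists>N. \<forall>n. \<bar>n\<bar> > N \<longrightarrow> mcarrier (obj ?C n) = {0}"
  proof -
    obtain N N' where N: "\<And>n. \<bar>n\<bar> > N \<Longrightarrow> mcarrier (obj P n) = {0}"
      "\<And>n. \<bar>n\<bar> > N' \<Longrightarrow> mcarrier (obj R n) = {0}"
      using P R unfolding bounded_complex_def by blast
    have "mcarrier (obj ?C n) = {0}" if "\<bar>n\<bar> > \<bar>N\<bar> + \<bar>N'\<bar> + 1" for n
    proof -
      have "mcarrier (obj P (n + 1)) = {0}" "mcarrier (obj R n) = {0}" using that by (auto intro!: N)
      then have "u i = 0" if "u \<in> mcarrier (obj ?C n)" for u i
        using that unfolding obj by (cases "i = 0 \<or> i = 1") auto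
      then have "u = 0" if "u \<in> mcarrier (obj ?C n)" for u
        using that by (intro ext) simp
      moreover have "0 \<in> mcarrier (obj ?C n)"
        unfolding obj using fg_module_closed(1)[OF fg(1)] fg_module_closed(1)[OF fg(2)] by simp
      ultimately show ?thesis by blast
    qed
    then show ?thesis by blast
  qed
  ultimately show ?thesis unfolding bounded_complex_def by blast
qed

lemma sum_additive_on:
  assumes "0 \<in> C" "h 0 = 0" "\<And>x y. x \<in> C \<Longrightarrow> y \<in> C \<Longrightarrow> x + y \<in> C \<and> h (x + y) = h x + h y"
    and "\<And>j. j \<in> J \<Longrightarrow> u j \<in> C"
  shows "sum u J \<in> C \<and> h (sum u J) = (\<Sum>j\<in>J. h (u j))"
  using assms(4)
proof (induction J rule: infinite_finite_induct)
  case (insert j J)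
  then show ?case using assms(3)[of "u j" "sum u J"] by simp
qed (use assms in auto)

lemma module_hom_into_dsum:
  fixes M :: "('v, 'a, 'k::field, 'm::ab_group_add) qmod"
  assumes "\<And>i. i \<in> S \<Longrightarrow> f i \<in> module_hom Q I M (N i)"
  shows "(\<lambda>m i. if i \<in> S then f i m else 0) \<in> module_hom Q I M (module_dsum S N)"
  unfolding module_hom_def
proof (intro CollectI conjI ballI)
  fix m n assume "m \<in> mcarrier M" "n \<in> mcarrier M"
  then show "(\<lambda>i. if i \<in> S then f i (m + n) else 0) =
      (\<lambda>i. if i \<in> S then f i m else 0) + (\<lambda>i. if i \<in> S then f i n else 0)"
    using module_homD(2)[OF assms] by (intro ext) simp
next
  fix a :: "('v, 'a) path \<Rightarrow> 'k" and m assume "a \<in> alg Q I" "m \<in> mcarrier M"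
  then show "(\<lambda>i. if i \<in> S then f i (act M a m) else 0) =
      act (module_dsum S N) a (\<lambda>i. if i \<in> S then f i m else 0)"
    using module_homD(3)[OF assms] by (intro ext) (simp add: module_dsum_act)
qed (use module_homD(1)[OF assms] in \<open>simp add: module_dsum_carrier\<close>)

lemma cochain_map_from_dsum:
  assumes Y: "bounded_complex Q I Y" and f: "\<And>i. i \<in> S \<Longrightarrow> cochain_map Q I (X i) Y (f i)"
  shows "cochain_map Q I (complex_dsum S X) Y (\<lambda>n v. \<Sum>i\<in>S. f i n (v i))"
proof -
  have fg: "fg_module Q I (obj Y n)" and dY: "diff Y n \<in> module_hom Q I (obj Y n) (obj Y (n + 1))" for n
    using Y by (simp_all add: bounded_complex_def)
  have hom: "f i n \<in> module_hom Q I (obj (X i) n) (obj Y n)"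
    and comm: "x \<in> mcarrier (obj (X i) n) \<Longrightarrow> f i (n + 1) (diff (X i) n x) = diff Y n (f i n x)"
    if "i \<in> S" for i n x
    using f[OF that] by (simp_all add: cochain_map_def)
  have comp: "v i \<in> mcarrier (obj (X i) n)" if "v \<in> mcarrier (obj (complex_dsum S X) n)" "i \<in> S" for v i n
    using that by (simp add: complex_dsum_def module_dsum_carrier)
  have closed: "x \<in> mcarrier (obj Y n) \<Longrightarrow> y \<in> mcarrier (obj Y n) \<Longrightarrow> x + y \<in> mcarrier (obj Y n)" for x y n
    by (rule fg_module_closed(2)[OF fg])
  have im: "f i n (v i) \<in> mcarrier (obj Y n)"
    if "v \<in> mcarrier (obj (complex_dsum S X) n)" "i \<in> S" for v i n
    using module_homD(1)[OF hom[OF that(2)] comp[OF that]] .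
  have sum_in: "(\<Sum>i\<in>S. f i n (v i)) \<in> mcarrier (obj Y n)"
    if "v \<in> mcarrier (obj (complex_dsum S X) n)" for v n
    using sum_additive_on[of "mcarrier (obj Y n)" "\<lambda>x. x" S "\<lambda>i. f i n (v i)"]
      fg_module_closed(1)[OF fg] closed im[OF that] by simp
  have "(\<Sum>i\<in>S. f i n (act (obj (complex_dsum S X) n) a v i)) = act (obj Y n) a (\<Sum>i\<in>S. f i n (v i))"
    if a: "a \<in> alg Q I" and v: "v \<in> mcarrier (obj (complex_dsum S X) n)" for a v n
  proof -
    have "act (obj Y n) a (\<Sum>i\<in>S. f i n (v i)) = (\<Sum>i\<in>S. act (obj Y n) a (f i n (v i)))"
      using sum_additive_on[of "mcarrier (obj Y n)" "act (obj Y n) a" S "\<lambda>i. f i n (v i)"]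
        fg_module_closed(1)[OF fg] fg_module_closed(5)[OF fg a] fg_module_closed(7)[OF fg a] closed im[OF v]
      by simp
    also have "\<dots> = (\<Sum>i\<in>S. f i n (act (obj (X i) n) a (v i)))"
      using module_homD(3)[OF hom a comp[OF v]] by (intro sum.cong) simp_all
    finally show ?thesis by (simp add: complex_dsum_def module_dsum_act)
  qed
  moreover have "(\<Sum>i\<in>S. f i n ((u + v) i)) = (\<Sum>i\<in>S. f i n (u i)) + (\<Sum>i\<in>S. f i n (v i))"
    if u: "u \<in> mcarrier (obj (complex_dsum S X) n)" and v: "v \<in> mcarrier (obj (complex_dsum S X) n)" for u v n
    unfolding sum.distrib[symmetric]
    using module_homD(2)[OF hom comp[OF u] comp[OF v]] by (intro sum.cong) simp_all
  moreover have "(\<Sum>i\<in>S. f i (n + 1) (diff (complex_dsum S X) n v i)) = diff Y n (\<Sum>i\<in>S. f i n (v i))"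
    if v: "v \<in> mcarrier (obj (complex_dsum S X) n)" for v n
  proof -
    have "diff Y n (\<Sum>i\<in>S. f i n (v i)) = (\<Sum>i\<in>S. diff Y n (f i n (v i)))"
      using sum_additive_on[of "mcarrier (obj Y n)" "diff Y n" S "\<lambda>i. f i n (v i)"]
        fg_module_closed(1)[OF fg] module_hom_zero[OF dY fg_module_closed(1)[OF fg]]
        module_homD(2)[OF dY] closed im[OF v]
      by simp
    also have "\<dots> = (\<Sum>i\<in>S. f i (n + 1) (diff (X i) n (v i)))"
      using comm comp[OF v] by (intro sum.cong) simp_all
    finally show ?thesis by (simp add: complex_dsum_def)
  qed
  ultimately show ?thesis
    unfolding cochain_map_def module_hom_def using sum_in by simp
qed

lemma module_hom_cong:
  assumes "fg_module Q I M" "\<And>u. u \<in> mcarrier M \<Longrightarrow> f u = g u" "g \<in> module_hom Q I M N"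
  shows "f \<in> module_hom Q I M N"
  using assms fg_module_closed(2,3)[OF assms(1)] by (simp add: module_hom_def)

section \<open>Complexes given by diagrams\<close>

text \<open>
  A diagram has a projective at each vertex and one component of the differential for each edge.
  As in the diagram of a word an edge has a left and a right end and is labelled by a letter,
  which also tells its direction.  Band complexes and cones of double maps are both of this form.
\<close>

record ('i, 'l, 'v, 'a, 'k) diagram =
  vertices :: "'i set"
  place :: "'i \<Rightarrow> 'v"
  vdeg :: "'i \<Rightarrow> int"
  edges :: "'l set"
  left_end :: "'l \<Rightarrow> 'i"
  right_end :: "'l \<Rightarrow> 'i"
  label :: "'l \<Rightarrow> 'a letter"
  weight :: "'l \<Rightarrow> 'k"

definition source :: "('i, 'l, 'v, 'a, 'k) diagram \<Rightarrow> 'l \<Rightarrow> 'i" where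
  "source D e = (if is_direct (label D e) then left_end D e else right_end D e)"

definition target :: "('i, 'l, 'v, 'a, 'k) diagram \<Rightarrow> 'l \<Rightarrow> 'i" where
  "target D e = (if is_direct (label D e) then right_end D e else left_end D e)"

definition edge_path :: "('i, 'l, 'v, 'a, 'k) diagram \<Rightarrow> 'l \<Rightarrow> 'a list" where
  "edge_path D e = letter_path (label D e)"

definition diagram_complex :: "('v, 'a) pre_digraph \<Rightarrow> ('a \<times> 'a) set \<Rightarrow>
    ('i, 'l, 'v, 'a, 'k::field) diagram \<Rightarrow> ('v, 'a, 'k, 'i \<Rightarrow> ('v, 'a) path \<Rightarrow> 'k) qcpx" where
  "diagram_complex Q I D = \<lparr>
     obj = (\<lambda>n. module_dsum {i \<in> vertices D. vdeg D i = n} (\<lambda>i. proj Q I (place D i))),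
     diff = (\<lambda>n u j. \<Sum>e\<in>edges D. if target D e = j
       then path_map Q I (weight D e) (edge_path D e) (u (source D e)) else 0)\<rparr>"

definition wf_diagram :: "('v, 'a) pre_digraph \<Rightarrow> ('a \<times> 'a) set \<Rightarrow>
    ('i, 'l, 'v, 'a, 'k) diagram \<Rightarrow> bool" where
  "wf_diagram Q I D \<longleftrightarrow> finite (vertices D) \<and> finite (edges D) \<and> place D ` vertices D \<subseteq> verts Q \<and>
     (\<forall>e\<in>edges D. left_end D e \<in> vertices D \<and> right_end D e \<in> vertices D \<and>
        nonzero_path Q I (edge_path D e) \<and>
        place D (left_end D e) = letter_end Q (label D e) \<and>
        place D (right_end D e) = letter_start Q (label D e) \<and>
        vdeg D (right_end D e) = vdeg D (left_end D e) + (if is_direct (label D e) then 1 else - 1))"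

lemma wf_diagram_edge:
  assumes "wf_diagram Q I D" "e \<in> edges D"
  shows "source D e \<in> vertices D" "target D e \<in> vertices D"
    "nonzero_path Q I (edge_path D e)" "edge_path D e \<noteq> []"
    "place D (source D e) = path_end Q (edge_path D e)"
    "place D (target D e) = path_start Q (edge_path D e)"
    "vdeg D (target D e) = vdeg D (source D e) + 1"
proof -
  have *: "left_end D e \<in> vertices D \<and> right_end D e \<in> vertices D \<and>
        nonzero_path Q I (edge_path D e) \<and>
        place D (left_end D e) = letter_end Q (label D e) \<and>
        place D (right_end D e) = letter_start Q (label D e) \<and>
        vdeg D (right_end D e) = vdeg D (left_end D e) + (if is_direct (label D e) then 1 else - 1)"
    using assms unfolding wf_diagram_def by blast
  then show "nonzero_path Q I (edge_path D e)" by blast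
  then show "edge_path D e \<noteq> []" by (simp add: nonzero_path_def)
  show "source D e \<in> vertices D" "target D e \<in> vertices D"
    "place D (source D e) = path_end Q (edge_path D e)"
    "place D (target D e) = path_start Q (edge_path D e)"
    "vdeg D (target D e) = vdeg D (source D e) + 1"
    using * by (cases "label D e"; simp add: source_def target_def edge_path_def)+
qed

text \<open>
  Two consecutive components of the differential compose to zero if their paths meet in a relation.
  The diagram of a cone is not null, as it contains a square.
\<close>

definition null_diagram :: "('a \<times> 'a) set \<Rightarrow> ('i, 'l, 'v, 'a, 'k) diagram \<Rightarrow> bool" where
  "null_diagram I D \<longleftrightarrow> (\<forall>e\<in>edges D. \<forall>e'\<in>edges D. target D e = source D e' \<longrightarrow>
     (last (edge_path D e), hd (edge_path D e')) \<in> I)"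

lemma diagram_diff:
  "finite (edges D) \<Longrightarrow> diff (diagram_complex Q I D) n u j =
    (\<Sum>e\<in>{e \<in> edges D. target D e = j}. path_map Q I (weight D e) (edge_path D e) (u (source D e)))"
  by (simp add: diagram_complex_def sum.inter_filter)

lemma scale_sum:
  fixes u :: "'j \<Rightarrow> 'w \<Rightarrow> 'k::field"
  shows "(\<lambda>w. c * (\<Sum>j\<in>J. u j) w) = (\<Sum>j\<in>J. (\<lambda>w. c * u j w))"
  by (rule ext) (simp add: sum_fun_apply sum_distrib_left)

lemma path_map_if: "path_map Q I c p (if b then u else 0) = (if b then path_map Q I c p u else 0)"
  by simp

context wf_digraph
begin

lemma proj_act: "act (proj G I x) = alg_mult G I"
  by (simp add: proj_def)

lemma dsum_proj_carrier:
  "u \<in> mcarrier (module_dsum S (\<lambda>i. proj G I (x i))) \<longleftrightarrow>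
    (\<forall>i\<in>S. u i \<in> mcarrier (proj G I (x i))) \<and> (\<forall>i. i \<notin> S \<longrightarrow> u i = 0)"
  by (rule module_dsum_carrier)

text \<open>
  On a sum of projectives \<open>\<Lambda>\<close> acts by multiplication of every coordinate, the coordinates outside
  the index set being zero anyway.
\<close>

lemma dsum_proj_act:
  assumes "u \<in> mcarrier (module_dsum S (\<lambda>i. proj G I (x i)))"
  shows "act (module_dsum S (\<lambda>i. proj G I (x i))) a u = (\<lambda>i. alg_mult G I a (u i))"
proof
  fix i show "act (module_dsum S (\<lambda>i. proj G I (x i))) a u i = alg_mult G I a (u i)"
    using assms by (cases "i \<in> S") (simp_all add: module_dsum_act dsum_proj_carrier proj_act)
qed

lemma alg_mult_sum_right: "alg_mult G I a (\<Sum>j\<in>J. u j) = (\<Sum>j\<in>J. alg_mult G I a (u j))"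
  using sum_comp_morphism[where h="alg_mult G I a" and g=u and A=J]
  by (simp add: alg_mult_add_right comp_def)

lemma module_hom_dsum_projI:
  assumes "\<And>u. u \<in> mcarrier (module_dsum S (\<lambda>i. proj G I (x i))) \<Longrightarrow>
      \<phi> u \<in> mcarrier (module_dsum T (\<lambda>j. proj G I (y j)))"
    and "\<And>u v. \<phi> (u + v) = \<phi> u + \<phi> v"
    and "\<And>a u. \<phi> (\<lambda>i. alg_mult G I a (u i)) = (\<lambda>j. alg_mult G I a (\<phi> u j))"
  shows "\<phi> \<in> module_hom G I (module_dsum S (\<lambda>i. proj G I (x i))) (module_dsum T (\<lambda>j. proj G I (y j)))"
  unfolding module_hom_def using assms by (simp add: dsum_proj_act)

lemma diagram_diff_carrier:
  assumes D: "wf_diagram G I D" and u: "u \<in> mcarrier (obj (diagram_complex G I D) n)"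
  shows "diff (diagram_complex G I D) n u \<in> mcarrier (obj (diagram_complex G I D) (n + 1))"
proof -
  have u0: "u i = 0" if "i \<in> vertices D" "vdeg D i \<noteq> n" for i
    using u that by (simp add: diagram_complex_def dsum_proj_carrier)
  have "diff (diagram_complex G I D) n u j \<in> mcarrier (proj G I (place D j))" for j
    unfolding diagram_complex_def cpx.simps
  proof (rule proj_sum)
    fix e assume "e \<in> edges D"
    from wf_diagram_edge(6)[OF D this]
    show "(if target D e = j then path_map G I (weight D e) (edge_path D e) (u (source D e)) else 0)
        \<in> mcarrier (proj G I (place D j))"
      using path_map_in_proj[of I "weight D e" "edge_path D e" "u (source D e)"] by auto
  qed
  moreover have "diff (diagram_complex G I D) n u j = 0"
    if "\<not> (j \<in> vertices D \<and> vdeg D j = n + 1)" for j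
    unfolding diagram_complex_def cpx.simps
  proof (rule sum.neutral, intro ballI)
    fix e assume e: "e \<in> edges D"
    have "u (source D e) = 0" if "target D e = j"
      using wf_diagram_edge[OF D e] that \<open>\<not> _\<close> by (intro u0) auto
    then show "(if target D e = j then path_map G I (weight D e) (edge_path D e) (u (source D e)) else 0) = 0"
      by simp
  qed
  ultimately show ?thesis by (simp add: diagram_complex_def dsum_proj_carrier)
qed

lemma diagram_diff_hom:
  assumes D: "wf_diagram G I D"
  shows "diff (diagram_complex G I D) n \<in>
    module_hom G I (obj (diagram_complex G I D) n) (obj (diagram_complex G I D) (n + 1))"
proof -
  have "diff (diagram_complex G I D) n (u + v) =
      diff (diagram_complex G I D) n u + diff (diagram_complex G I D) n v" for u v
    by (rule ext) (simp add: diagram_complex_def path_map_add sum.distrib[symmetric] if_distrib cong: if_cong)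
  moreover have "diff (diagram_complex G I D) n (\<lambda>i. alg_mult G I a (u i)) =
      (\<lambda>j. alg_mult G I a (diff (diagram_complex G I D) n u j))" for a u
    by (rule ext) (auto simp: diagram_complex_def path_map_alg_mult alg_mult_sum_right intro!: sum.cong)
  ultimately show ?thesis
    using diagram_diff_carrier[OF D, of _ n] unfolding diagram_complex_def cpx.simps
    by (intro module_hom_dsum_projI) auto
qed

lemma fg_module_diagram:
  "wf_diagram G I D \<Longrightarrow> fg_module G I (obj (diagram_complex G I D) n)"
  unfolding diagram_complex_def cpx.simps
  by (rule fg_module_dsum) (auto simp: wf_diagram_def intro!: fg_module_proj)

lemma bounded_complex_diagram:
  assumes D: "wf_diagram G I D" and null: "null_diagram I D"
  shows "bounded_complex G I (diagram_complex G I D)"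
proof -
  let ?X = "diagram_complex G I D"
  have fin: "finite (vertices D)" using D by (simp add: wf_diagram_def)
  have fg: "fg_module G I (obj ?X n)" for n by (rule fg_module_diagram[OF D])
  have d2: "diff ?X (n + 1) (diff ?X n u) = 0" for n u
  proof
    fix j
    have "diff ?X (n + 1) (diff ?X n u) j =
        (\<Sum>e'\<in>edges D. if target D e' = j then (\<Sum>e\<in>edges D. if target D e = source D e'
          then path_map G I (weight D e') (edge_path D e')
                (path_map G I (weight D e) (edge_path D e) (u (source D e))) else 0) else 0)"
      by (simp add: diagram_complex_def path_map_sum path_map_if cong: if_cong)
    also have "\<dots> = 0"
    proof (rule sum.neutral, intro ballI)
      fix e' assume e': "e' \<in> edges D"
      have "(\<Sum>e\<in>edges D. if target D e = source D e'
          then path_map G I (weight D e') (edge_path D e')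
                (path_map G I (weight D e) (edge_path D e) (u (source D e))) else 0) = 0"
      proof (rule sum.neutral, intro ballI)
        fix e assume e: "e \<in> edges D"
        show "(if target D e = source D e'
          then path_map G I (weight D e') (edge_path D e')
                (path_map G I (weight D e) (edge_path D e) (u (source D e))) else 0) = 0"
        proof (cases "target D e = source D e'")
          case True
          then have "(last (edge_path D e), hd (edge_path D e')) \<in> I"
            using null e e' by (auto simp: null_diagram_def)
          then have "\<not> nonzero_path G I (edge_path D e @ edge_path D e')"
            using wf_diagram_edge(4)[OF D e] wf_diagram_edge(4)[OF D e']
            by (simp add: nonzero_path_append)
          then show ?thesis
            using wf_diagram_edge(4)[OF D e] wf_diagram_edge(4)[OF D e']
            by (simp add: path_map_comp)
        qed simp
      qed
      then show "(if target D e' = j then (\<Sum>e\<in>edges D. if target D e = source D e'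
          then path_map G I (weight D e') (edge_path D e')
                (path_map G I (weight D e) (edge_path D e) (u (source D e))) else 0) else 0) = 0"
        by simp
    qed
    finally show "diff ?X (n + 1) (diff ?X n u) j = 0 j" by simp
  qed
  have bd: "mcarrier (obj ?X n) = {0}" if "\<bar>n\<bar> > (\<Sum>i\<in>vertices D. \<bar>vdeg D i\<bar>)" for n
  proof -
    have "vdeg D i \<noteq> n" if i: "i \<in> vertices D" for i
      using member_le_sum[OF i, of "\<lambda>i. \<bar>vdeg D i\<bar>"] fin \<open>\<bar>n\<bar> > _\<close> by auto
    then have *: "{i \<in> vertices D. vdeg D i = n} = {}" by blast
    show ?thesis
      unfolding diagram_complex_def cpx.simps * by (auto simp: dsum_proj_carrier intro!: ext)
  qed
  show ?thesis
    unfolding bounded_complex_def using fg d2 bd diagram_diff_hom[OF D] by blast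
qed

lemma diagram_complex_act:
  "u \<in> mcarrier (obj (diagram_complex G I D) n) \<Longrightarrow>
    act (obj (diagram_complex G I D) n) s u = (\<lambda>i. alg_mult G I s (u i))"
  unfolding diagram_complex_def cpx.simps by (rule dsum_proj_act)

subsection \<open>Pulling back along maps of diagrams\<close>

lemma pullback_hom:
  fixes \<rho> :: "'j \<Rightarrow> 'i" and h :: "'j \<Rightarrow> 'k::field"
  assumes "\<And>l. l \<in> T \<Longrightarrow> \<rho> l \<in> S \<and> x (\<rho> l) = y l"
  shows "(\<lambda>(u :: 'i \<Rightarrow> ('a, 'b) path \<Rightarrow> 'k) l. if l \<in> T then (\<lambda>w. h l * u (\<rho> l) w) else 0) \<in>
    module_hom G I (module_dsum S (\<lambda>i. proj G I (x i))) (module_dsum T (\<lambda>j. proj G I (y j)))"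
proof (rule module_hom_dsum_projI)
  fix u :: "'i \<Rightarrow> ('a, 'b) path \<Rightarrow> 'k"
  assume u: "u \<in> mcarrier (module_dsum S (\<lambda>i. proj G I (x i)))"
  have "(\<lambda>w. h l * u (\<rho> l) w) \<in> mcarrier (proj G I (y l))" if "l \<in> T" for l
    using assms[OF that] u by (intro proj_scale) (auto simp: dsum_proj_carrier)
  then show "(\<lambda>l. if l \<in> T then \<lambda>w. h l * u (\<rho> l) w else 0) \<in> mcarrier (module_dsum T (\<lambda>j. proj G I (y j)))"
    by (simp add: dsum_proj_carrier)
next
  fix a :: "('a, 'b) path \<Rightarrow> 'k" and u :: "'i \<Rightarrow> ('a, 'b) path \<Rightarrow> 'k"
  show "(\<lambda>l. if l \<in> T then \<lambda>w. h l * alg_mult G I a (u (\<rho> l)) w else 0) =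
    (\<lambda>j. alg_mult G I a (if j \<in> T then \<lambda>w. h j * u (\<rho> j) w else 0))"
    by (rule ext) (simp add: alg_mult_scale_right)
qed (auto simp: fun_eq_iff distrib_left)

text \<open>
  A map of diagrams that is bijective on the edges into corresponding vertices, like a covering,
  pulls elements back to elements, with coordinates rescaled by \<open>h\<close> so as to match the weights.
\<close>

lemma cochain_map_pullback:
  fixes D :: "('i, 'l, 'a, 'b, 'k::field) diagram" and D' :: "('j, 'm, 'a, 'b, 'k) diagram"
  assumes D: "wf_diagram G I D" and D': "wf_diagram G I D'"
    and vert: "\<And>l. l \<in> vertices D' \<Longrightarrow> \<rho> l \<in> vertices D \<and> place D (\<rho> l) = place D' l \<and> vdeg D (\<rho> l) = vdeg D' l"
    and cover: "\<And>l. l \<in> vertices D' \<Longrightarrow>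
      bij_betw r {m \<in> edges D'. target D' m = l} {e \<in> edges D. target D e = \<rho> l}"
    and edge: "\<And>m. m \<in> edges D' \<Longrightarrow> edge_path D (r m) = edge_path D' m \<and> source D (r m) = \<rho> (source D' m)"
    and wt: "\<And>m. m \<in> edges D' \<Longrightarrow> h (source D' m) * weight D' m = h (target D' m) * weight D (r m)"
  shows "cochain_map G I (diagram_complex G I D) (diagram_complex G I D')
    (\<lambda>n u l. if l \<in> vertices D' then (\<lambda>w. h l * u (\<rho> l) w) else 0)"
    (is "cochain_map G I ?X ?Y ?f")
proof -
  have hom: "?f n \<in> module_hom G I (obj ?X n) (obj ?Y n)" for n
  proof -
    have eq: "u \<in> mcarrier (obj ?X n) \<Longrightarrow> ?f n u = (\<lambda>l. if l \<in> {l \<in> vertices D'. vdeg D' l = n} then (\<lambda>w. h l * u (\<rho> l) w) else 0)" for u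
      using vert by (intro ext) (auto simp: diagram_complex_def dsum_proj_carrier)
    have hom: "(\<lambda>u l. if l \<in> {l \<in> vertices D'. vdeg D' l = n} then (\<lambda>w. h l * u (\<rho> l) w) else 0)
        \<in> module_hom G I (obj ?X n) (obj ?Y n)"
      unfolding diagram_complex_def cpx.simps using vert by (intro pullback_hom) auto
    show ?thesis by (rule module_hom_cong[OF fg_module_diagram[OF D] eq hom])
  qed
  have *: "?f (n + 1) (diff ?X n u) l = diff ?Y n (?f n u) l" if "u \<in> mcarrier (obj ?X n)" for n u l
  proof (cases "l \<in> vertices D'")
    case False
    then have "target D' m \<noteq> l" if "m \<in> edges D'" for m
      using wf_diagram_edge(2)[OF D' that] by blast
    then show ?thesis using False by (auto simp: diagram_complex_def intro!: sum.neutral)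
  next
    case True
    have fin: "finite (edges D)" "finite (edges D')" using D D' by (auto simp: wf_diagram_def)
    have "?f (n + 1) (diff ?X n u) l =
        (\<Sum>e\<in>{e \<in> edges D. target D e = \<rho> l}. path_map G I (h l * weight D e) (edge_path D e) (u (source D e)))"
      using True by (simp add: diagram_diff[OF fin(1)] scale_sum path_map_scale(2))
    also have "\<dots> = (\<Sum>m\<in>{m \<in> edges D'. target D' m = l}.
        path_map G I (h l * weight D (r m)) (edge_path D (r m)) (u (source D (r m))))"
      by (rule sum.reindex_bij_betw[OF cover[OF True], symmetric])
    also have "\<dots> = (\<Sum>m\<in>{m \<in> edges D'. target D' m = l}.
        path_map G I (weight D' m) (edge_path D' m) (?f n u (source D' m)))"
    proof (rule sum.cong[OF refl])
      fix m assume "m \<in> {m \<in> edges D'. target D' m = l}"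
      then have m: "m \<in> edges D'" "target D' m = l" by auto
      then show "path_map G I (h l * weight D (r m)) (edge_path D (r m)) (u (source D (r m))) =
          path_map G I (weight D' m) (edge_path D' m) (?f n u (source D' m))"
        using edge[OF m(1)] wt[OF m(1)] wf_diagram_edge(1)[OF D' m(1)] by (simp add: path_map_scale(1))
    qed
    also have "\<dots> = diff ?Y n (?f n u) l"
      by (simp add: diagram_diff[OF fin(2)])
    finally show ?thesis .
  qed
  have "?f (n + 1) (diff ?X n u) = diff ?Y n (?f n u)" if "u \<in> mcarrier (obj ?X n)" for n u
    by (rule ext) (rule *[OF that])
  then show ?thesis using hom by (simp add: cochain_map_def)
qed

lemma isomorphic_complexes_relabel:
  fixes D :: "('i, 'l, 'a, 'b, 'k::field) diagram" and D' :: "('j, 'm, 'a, 'b, 'k) diagram"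
  assumes D: "wf_diagram G I D" and D': "wf_diagram G I D'"
    and \<rho>: "bij_betw \<rho> (vertices D') (vertices D)" and r: "bij_betw r (edges D') (edges D)"
    and vert: "\<And>l. l \<in> vertices D' \<Longrightarrow> place D (\<rho> l) = place D' l \<and> vdeg D (\<rho> l) = vdeg D' l"
    and edge: "\<And>m. m \<in> edges D' \<Longrightarrow> label D (r m) = label D' m \<and> weight D (r m) = weight D' m \<and>
      left_end D (r m) = \<rho> (left_end D' m) \<and> right_end D (r m) = \<rho> (right_end D' m)"
  shows "isomorphic_complexes G I (diagram_complex G I D) (diagram_complex G I D')"
proof -
  let ?f = "\<lambda>u l. if l \<in> vertices D' then (\<lambda>w. 1 * u (\<rho> l) w) else (0 :: _ \<Rightarrow> 'k)"
  let ?inv = "inv_into (vertices D') \<rho>"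
  let ?g = "\<lambda>u l. if l \<in> vertices D then (\<lambda>w. 1 * u (?inv l) w) else (0 :: _ \<Rightarrow> 'k)"
  have st: "source D (r m) = \<rho> (source D' m)" "target D (r m) = \<rho> (target D' m)" if "m \<in> edges D'" for m
    using edge[OF that] by (auto simp: source_def target_def)
  have \<rho>_in: "\<rho> l \<in> vertices D" if "l \<in> vertices D'" for l
    using \<rho> that by (auto simp: bij_betw_def)
  have inj: "\<rho> l = \<rho> l' \<longleftrightarrow> l = l'" if "l \<in> vertices D'" "l' \<in> vertices D'" for l l'
    using \<rho> that by (auto simp: bij_betw_def inj_on_eq_iff)
  have inv: "?inv i \<in> vertices D'" "\<rho> (?inv i) = i" if "i \<in> vertices D" for i
    using \<rho> that by (auto simp: bij_betw_def f_inv_into_f inv_into_into)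
  have "cochain_map G I (diagram_complex G I D) (diagram_complex G I D') (\<lambda>n. ?f)"
  proof (rule cochain_map_pullback[OF D D', where r=r])
    fix l assume l: "l \<in> vertices D'"
    have "r ` {m \<in> edges D'. target D' m = l} = {e \<in> edges D. target D e = \<rho> l}"
    proof (intro equalityI subsetI)
      fix e assume e: "e \<in> {e \<in> edges D. target D e = \<rho> l}"
      then obtain m where "m \<in> edges D'" "e = r m" using r by (auto simp: bij_betw_def)
      then show "e \<in> r ` {m \<in> edges D'. target D' m = l}"
        using e st inj[OF wf_diagram_edge(2)[OF D'] l] by auto
    qed (use r st in \<open>auto simp: bij_betw_def\<close>)
    moreover have "inj_on r {m \<in> edges D'. target D' m = l}"
      using r by (auto simp: bij_betw_def inj_on_def)
    ultimately show "bij_betw r {m \<in> edges D'. target D' m = l} {e \<in> edges D. target D e = \<rho> l}"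
      by (simp add: bij_betw_def)
  qed (use vert \<rho>_in edge st in \<open>auto simp: edge_path_def\<close>)
  moreover have "?g \<in> module_hom G I (obj (diagram_complex G I D') n) (obj (diagram_complex G I D) n)" for n
  proof -
    have eq: "?g u = (\<lambda>l. if l \<in> {l \<in> vertices D. vdeg D l = n} then (\<lambda>w. 1 * u (?inv l) w) else 0)"
      if "u \<in> mcarrier (obj (diagram_complex G I D') n)" for u
      using that vert[OF inv(1)] inv by (intro ext) (auto simp: diagram_complex_def dsum_proj_carrier)
    have hom: "(\<lambda>u l. if l \<in> {l \<in> vertices D. vdeg D l = n} then (\<lambda>w. 1 * u (?inv l) w) else 0)
        \<in> module_hom G I (obj (diagram_complex G I D') n) (obj (diagram_complex G I D) n)"
      unfolding diagram_complex_def cpx.simps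
      by (rule pullback_hom) (use inv vert[OF inv(1)] in auto)
    show ?thesis by (rule module_hom_cong[OF fg_module_diagram[OF D'] eq hom])
  qed
  moreover have "?g (?f u) = u" if "u \<in> mcarrier (obj (diagram_complex G I D) n)" for u n
    using that inv by (intro ext) (auto simp: diagram_complex_def dsum_proj_carrier)
  moreover have "?f (?g u) = u" if "u \<in> mcarrier (obj (diagram_complex G I D') n)" for u n
    using that \<rho>_in \<rho> by (intro ext) (auto simp: diagram_complex_def dsum_proj_carrier bij_betw_def)
  ultimately show ?thesis
    using diagram_diff_carrier[OF D] by (intro isomorphic_complexesI[where \<phi>="\<lambda>n. ?f" and \<psi>="\<lambda>n. ?g"]) auto
qed

end

subsection \<open>Cancelling a commuting square\<close>

context wf_digraph
begin

text \<open>
  Two sides \<open>s\<close>, \<open>x\<close> of a square start at one corner and two sides \<open>t\<close>, \<open>y\<close> end at the opposite one,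
  and a path \<open>p\<close> leads from the end of \<open>x\<close> to the end of \<open>s\<close>, so that \<open>s\<close> is \<open>x\<close> followed by \<open>p\<close> and
  \<open>t\<close> is \<open>p\<close> followed by \<open>y\<close>.  The unipotent change of basis that adds a multiple of \<open>p\<close> removes
  \<open>s\<close> and \<open>t\<close> from the differential.  By the last two conditions it creates no other components.
\<close>

lemma isomorphic_complexes_cancel_square:
  fixes D :: "('i, 'l, 'a, 'b, 'k::field) diagram"
  assumes D: "wf_diagram G I D"
    and in_edges: "s \<in> edges D" "t \<in> edges D" "x \<in> edges D" "y \<in> edges D"
    and square: "source D s = source D x" "target D x = source D t"
      "target D s = source D y" "target D t = target D y"
    and ne: "source D t \<noteq> source D y"
    and factor: "edge_path D s = edge_path D x @ p" "edge_path D t = p @ edge_path D y" "p \<noteq> []"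
    and weights: "weight D s = - (weight D x * c)" "weight D t = c * weight D y"
    and into: "\<And>e. e \<in> edges D \<Longrightarrow> target D e = source D t \<Longrightarrow> e \<noteq> x \<Longrightarrow>
      \<not> nonzero_path G I (edge_path D e @ p)"
    and out: "\<And>e. e \<in> edges D \<Longrightarrow> source D e = source D y \<Longrightarrow> e \<noteq> y \<Longrightarrow>
      \<not> nonzero_path G I (p @ edge_path D e)"
  shows "isomorphic_complexes G I (diagram_complex G I D)
    (diagram_complex G I (D\<lparr>edges := edges D - {s, t}\<rparr>))"
proof -
  let ?D' = "D\<lparr>edges := edges D - {s, t}\<rparr>"
  let ?X = "diagram_complex G I D" and ?Y = "diagram_complex G I ?D'"
  let ?v = "source D t" and ?v' = "source D y"
  define \<phi> :: "'k \<Rightarrow> ('i \<Rightarrow> ('a, 'b) path \<Rightarrow> 'k) \<Rightarrow> 'i \<Rightarrow> ('a, 'b) path \<Rightarrow> 'k" where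
    "\<phi> b u = (\<lambda>j. u j + (if j = ?v' then path_map G I b p (u ?v) else 0))" for b u
  define summand where
    "summand e j u = (if target D e = j then path_map G I (weight D e) (edge_path D e) (u (source D e)) else 0)"
    for e j and u :: "'i \<Rightarrow> ('a, 'b) path \<Rightarrow> 'k"
  note E = wf_diagram_edge[OF D]
  have fin: "finite (edges D)" using D by (simp add: wf_diagram_def)
  have D': "source ?D' = source D" "target ?D' = target D" "edge_path ?D' = edge_path D"
    by (auto simp: source_def target_def edge_path_def fun_eq_iff)
  have "vdeg D ?v = vdeg D (source D s) + 1" "vdeg D ?v' = vdeg D (source D s) + 1"
    using E(7)[OF in_edges(3)] E(7)[OF in_edges(1)] square by simp_all
  then have vdeg: "vdeg D ?v' = vdeg D ?v" "s \<noteq> t" "y \<noteq> s" "x \<noteq> t"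
    using square E(7)[OF in_edges(1)] E(7)[OF in_edges(2)] by auto
  have neq: "y \<noteq> t" "x \<noteq> s" using ne square by auto
  have pl: "place D ?v' = path_start G p"
    using E(6)[OF in_edges(1)] square factor by (simp add: path_start_append)
  have obj_eq: "obj ?Y n = obj ?X n" for n by (simp add: diagram_complex_def)
  have hom: "\<phi> b \<in> module_hom G I (obj ?X n) (obj ?X n)" for b n
    unfolding diagram_complex_def cpx.simps
  proof (rule module_hom_dsum_projI)
    fix u :: "'i \<Rightarrow> ('a, 'b) path \<Rightarrow> 'k"
    assume u: "u \<in> mcarrier (module_dsum {i \<in> vertices D. vdeg D i = n} (\<lambda>i. proj G I (place D i)))"
    have "\<phi> b u j \<in> mcarrier (proj G I (place D j))" if "j \<in> vertices D" "vdeg D j = n" for j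
      unfolding \<phi>_def using u that pl path_map_in_proj[of I b p "u ?v"]
      by (intro proj_add) (auto simp: dsum_proj_carrier)
    moreover have "\<phi> b u j = 0" if not: "\<not> (j \<in> vertices D \<and> vdeg D j = n)" for j
    proof -
      have "u j = 0" using u not by (auto simp: dsum_proj_carrier)
      moreover have "u ?v = 0" if "j = ?v'"
        using u not that vdeg(1) E(1)[OF in_edges(4)] by (auto simp: dsum_proj_carrier)
      ultimately show ?thesis by (simp add: \<phi>_def)
    qed
    ultimately show "\<phi> b u \<in> mcarrier (module_dsum {i \<in> vertices D. vdeg D i = n} (\<lambda>i. proj G I (place D i)))"
      by (simp add: dsum_proj_carrier)
  next
    fix u v :: "'i \<Rightarrow> ('a, 'b) path \<Rightarrow> 'k" show "\<phi> b (u + v) = \<phi> b u + \<phi> b v"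
      by (rule ext) (simp add: \<phi>_def path_map_add)
  next
    fix a and u :: "'i \<Rightarrow> ('a, 'b) path \<Rightarrow> 'k" show "\<phi> b (\<lambda>i. alg_mult G I a (u i)) = (\<lambda>j. alg_mult G I a (\<phi> b u j))"
      by (rule ext) (simp add: \<phi>_def path_map_alg_mult alg_mult_add_right)
  qed
  have comm: "\<phi> c (diff ?X n u) j = diff ?Y n (\<phi> c u) j" for n u j
  proof -
    have X: "diff ?X n u j = (\<Sum>e\<in>edges D. summand e j u)" for j
      by (simp add: diagram_complex_def summand_def)
    have zero_in: "path_map G I c p (summand e ?v u) = 0" if "e \<in> edges D - {x}" for e
      using into[of e] that E(4)[of e] factor(3) by (auto simp: summand_def path_map_comp)
    have "path_map G I c p (diff ?X n u ?v) = (\<Sum>e\<in>edges D. path_map G I c p (summand e ?v u))"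
      by (simp add: X path_map_sum)
    also have "\<dots> = (\<Sum>e\<in>{x}. path_map G I c p (summand e ?v u))"
      by (rule sum.mono_neutral_right) (use fin in_edges zero_in in auto)
    also have "\<dots> = path_map G I (weight D x * c) (edge_path D s) (u (source D s))"
      using square factor E(3)[OF in_edges(1)] E(4)[OF in_edges(3)]
      by (simp add: summand_def path_map_comp)
    also have "\<dots> = - summand s ?v' u"
      using weights(1) square(3) by (simp add: summand_def path_map_uminus)
    finally have "\<phi> c (diff ?X n u) j = (\<Sum>e\<in>edges D. summand e j u) - summand s j u"
      using square(3) by (auto simp: \<phi>_def X summand_def)
    also have "\<dots> = (\<Sum>e\<in>edges D - {s, t}. summand e j u) + summand t j u"
    proof -
      have "(\<Sum>e\<in>edges D. summand e j u) = (\<Sum>e\<in>edges D - {s, t}. summand e j u) + (\<Sum>e\<in>{s, t}. summand e j u)"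
        using fin in_edges by (intro sum.subset_diff) auto
      then show ?thesis using vdeg(2) by simp
    qed
    finally have left: "\<phi> c (diff ?X n u) j = (\<Sum>e\<in>edges D - {s, t}. summand e j u) + summand t j u" .
    define extra where "extra e = (if target D e = j \<and> source D e = ?v'
      then path_map G I (weight D e) (edge_path D e) (path_map G I c p (u ?v)) else 0)" for e
    have "diff ?Y n (\<phi> c u) j = (\<Sum>e\<in>edges D - {s, t}. summand e j (\<phi> c u))"
      by (simp add: diagram_complex_def summand_def D' cong: if_cong)
    also have "\<dots> = (\<Sum>e\<in>edges D - {s, t}. summand e j u + extra e)"
      by (rule sum.cong) (auto simp: summand_def extra_def \<phi>_def path_map_add)
    also have "\<dots> = (\<Sum>e\<in>edges D - {s, t}. summand e j u) + (\<Sum>e\<in>edges D - {s, t}. extra e)"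
      by (rule sum.distrib)
    also have "(\<Sum>e\<in>edges D - {s, t}. extra e) = (\<Sum>e\<in>{y}. extra e)"
    proof (rule sum.mono_neutral_right)
      show "\<forall>e\<in>edges D - {s, t} - {y}. extra e = 0"
        using out E(4) factor(3) by (auto simp: extra_def path_map_comp)
    qed (use fin in_edges vdeg neq in auto)
    also have "\<dots> = summand t j u"
      using E(3)[OF in_edges(2)] E(4)[OF in_edges(4)] factor weights(2) square(4)
      by (simp add: extra_def summand_def path_map_comp)
    finally show ?thesis unfolding left ..
  qed
  have inv: "\<phi> (- b) (\<phi> b u) = u" for b u
  proof
    fix j
    have "\<phi> b u ?v = u ?v" using ne by (simp add: \<phi>_def)
    then show "\<phi> (- b) (\<phi> b u) j = u j"
      by (simp add: \<phi>_def path_map_uminus[symmetric])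
  qed
  show ?thesis
  proof (rule isomorphic_complexesI[where \<phi>="\<lambda>n. \<phi> c" and \<psi>="\<lambda>n. \<phi> (- c)"])
    have "\<phi> c (diff ?X n u) = diff ?Y n (\<phi> c u)" for n u by (rule ext) (rule comm)
    then show "cochain_map G I ?X ?Y (\<lambda>n. \<phi> c)"
      using hom by (simp add: cochain_map_def obj_eq)
    show "\<phi> c (\<phi> (- c) u) = u" for u using inv[of "- c" u] by simp
  qed (use hom inv diagram_diff_carrier[OF D] in \<open>simp_all add: obj_eq\<close>)
qed

end

section \<open>Closed strings and their diagrams\<close>

definition letters_composable :: "('v, 'a) pre_digraph \<Rightarrow> ('a \<times> 'a) set \<Rightarrow> 'a letter \<Rightarrow> 'a letter \<Rightarrow> bool" where
  "letters_composable Q I l l' \<longleftrightarrow> letter_start Q l = letter_end Q l' \<and> letters_compatible I l l'"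

text \<open>A homotopy band up to the requirement that it be no proper power.\<close>

definition closed_string :: "('v, 'a) pre_digraph \<Rightarrow> ('a \<times> 'a) set \<Rightarrow> 'a letter list \<Rightarrow> bool" where
  "closed_string Q I w \<longleftrightarrow> w \<noteq> [] \<and> (\<forall>l\<in>set w. nonzero_path Q I (letter_path l)) \<and>
     successively (letters_composable Q I) (w @ w) \<and>
     length (filter is_direct w) = length (filter (Not \<circ> is_direct) w)"

lemma word_power_2: "word_power w 2 = w @ w"
  by (simp add: word_power_def numeral_2_eq_2)

lemma homotopy_band_iff_closed_string:
  "homotopy_band Q I w \<longleftrightarrow> closed_string Q I w \<and> \<not> (\<exists>\<rho> m. m \<ge> 2 \<and> w = word_power \<rho> m)"
proof -
  have "(\<lambda>l l'. letter_start Q l = letter_end Q l' \<and> letters_compatible I l l') = letters_composable Q I"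
    by (auto simp: letters_composable_def fun_eq_iff)
  then show ?thesis
    by (auto simp: homotopy_band_def closed_string_def nontrivial_homotopy_string_def word_power_2
        successively_append_iff letters_composable_def)
qed

lemma length_word_power: "length (word_power w k) = k * length w"
  by (induction k) (simp_all add: word_power_def)

lemma word_power_nth: "l < k * length w \<Longrightarrow> word_power w k ! l = w ! (l mod length w)"
proof (induction k arbitrary: l)
  case (Suc k)
  have *: "word_power w (Suc k) = w @ word_power w k" by (simp add: word_power_def)
  show ?case
  proof (cases "l < length w")
    case False
    then have "word_power w (Suc k) ! l = w ! ((l - length w) mod length w)"
      using Suc unfolding * by (simp add: nth_append)
    then show ?thesis using False by (simp add: le_mod_geq)
  qed (simp add: * nth_append)
qed (simp add: word_power_def)

lemma next_vertex_less: "w \<noteq> [] \<Longrightarrow> next_vertex w i < length w"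
  by (simp add: next_vertex_def)

lemma next_vertex_if: "i < length w \<Longrightarrow> next_vertex w i = (if Suc i = length w then 0 else Suc i)"
  by (auto simp: next_vertex_def)

lemma next_vertex_bij: "bij_betw (next_vertex w) {..<length w} {..<length w}"
proof -
  have "inj_on (next_vertex w) {..<length w}"
    by (rule inj_onI) (auto simp: next_vertex_if split: if_splits)
  moreover have "next_vertex w ` {..<length w} \<subseteq> {..<length w}"
    by (auto intro!: next_vertex_less)
  ultimately show ?thesis by (simp add: bij_betw_def endo_inj_surj)
qed

lemma next_vertex_eq_iff:
  "i < length w \<Longrightarrow> j < length w \<Longrightarrow> next_vertex w i = next_vertex w j \<longleftrightarrow> i = j"
  using next_vertex_bij[of w] by (auto simp: bij_betw_def inj_on_eq_iff)

lemma next_vertex_surj: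
  assumes "j < length w"
  obtains i where "i < length w" "next_vertex w i = j"
proof -
  have "j \<in> next_vertex w ` {..<length w}"
    using next_vertex_bij[of w] assms by (simp add: bij_betw_def)
  then show ?thesis using that by auto
qed

lemma sum_list_letters:
  "(\<Sum>l\<leftarrow>w. if is_direct l then 1 else - 1 :: int) =
    int (length (filter is_direct w)) - int (length (filter (Not \<circ> is_direct) w))"
  by (induction w) auto

lemma vertex_degree_0 [simp]: "vertex_degree w d 0 = d"
  by (simp add: vertex_degree_def)

lemma vertex_degree_Suc:
  "i < length w \<Longrightarrow> vertex_degree w d (Suc i) = vertex_degree w d i + (if is_direct (w ! i) then 1 else - 1)"
  by (simp add: vertex_degree_def take_Suc_conv_app_nth)

lemma closed_string_vertex_degree:
  assumes "closed_string Q I w" "i < length w"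
  shows "vertex_degree w d (next_vertex w i) = vertex_degree w d i + (if is_direct (w ! i) then 1 else - 1)"
proof (cases "Suc i = length w")
  case True
  have "vertex_degree w d (Suc i) = d"
    unfolding True using assms(1) by (simp add: vertex_degree_def sum_list_letters closed_string_def)
  then show ?thesis
    using vertex_degree_Suc[OF assms(2), of d] assms(2) True by (simp add: next_vertex_if)
next
  case False
  then show ?thesis using vertex_degree_Suc[OF assms(2), of d] assms(2) by (simp add: next_vertex_if)
qed

lemma closed_string_composable:
  assumes "closed_string Q I w" "i < length w"
  shows "letters_composable Q I (w ! i) (w ! next_vertex w i)"
proof -
  have "letters_composable Q I ((w @ w) ! i) ((w @ w) ! Suc i)"
    using assms successively_nth[of "letters_composable Q I" "w @ w" i] by (simp add: closed_string_def)
  then show ?thesis using assms(2) by (auto simp: nth_append next_vertex_if split: if_splits)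
qed

lemma closed_string_nonzero:
  "closed_string Q I w \<Longrightarrow> i < length w \<Longrightarrow> nonzero_path Q I (letter_path (w ! i))"
  by (simp add: closed_string_def)

lemma closed_string_length:
  assumes "closed_string Q I w"
  shows "even (length w)" "2 \<le> length w"
proof -
  have "length w = 2 * length (filter is_direct w)"
    using assms sum_length_filter_compl[of is_direct w] by (simp add: closed_string_def comp_def)
  moreover have "length w \<noteq> 0" using assms by (simp add: closed_string_def)
  ultimately show "even (length w)" "2 \<le> length w" by presburger+
qed

text \<open>
  Scalars are allowed at all letters, because the word of a cone carries the scalars of both bands,
  those of the map and the signs of the shift all at once.
\<close>

definition word_diagram :: "('v, 'a) pre_digraph \<Rightarrow> 'a letter list \<Rightarrow> int \<Rightarrow> (nat \<Rightarrow> 'k) \<Rightarrow>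
    (nat, nat, 'v, 'a, 'k) diagram" where
  "word_diagram Q w d c = \<lparr>vertices = {..<length w}, place = \<lambda>i. letter_end Q (w ! i),
     vdeg = vertex_degree w d, edges = {..<length w}, left_end = \<lambda>i. i,
     right_end = next_vertex w, label = \<lambda>i. w ! i, weight = c\<rparr>"

lemma word_diagram_simps [simp]:
  "vertices (word_diagram Q w d c) = {..<length w}"
  "place (word_diagram Q w d c) i = letter_end Q (w ! i)"
  "vdeg (word_diagram Q w d c) = vertex_degree w d"
  "edges (word_diagram Q w d c) = {..<length w}"
  "left_end (word_diagram Q w d c) i = i"
  "right_end (word_diagram Q w d c) = next_vertex w"
  "label (word_diagram Q w d c) i = w ! i"
  "weight (word_diagram Q w d c) = c"
  by (simp_all add: word_diagram_def)

lemma band_complex_eq_diagram_complex: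
  "band_complex Q I w d r \<nu> =
    diagram_complex Q I (word_diagram Q w d (\<lambda>i. if i = r then \<nu> else 1))"
proof -
  have *: "(let c = (if i = r then \<nu> else 1) in case w ! i of
          Direct p \<Rightarrow> if j = next_vertex w i then path_map Q I c p (u i) else 0
        | Inverse p \<Rightarrow> if j = i then path_map Q I c p (u (next_vertex w i)) else 0) =
      (if target (word_diagram Q w d (\<lambda>i. if i = r then \<nu> else 1)) i = j
       then path_map Q I (if i = r then \<nu> else 1) (letter_path (w ! i))
         (u (source (word_diagram Q w d (\<lambda>i. if i = r then \<nu> else 1)) i)) else 0)" for i j u
    by (cases "w ! i") (auto simp: target_def source_def Let_def)
  show ?thesis
    unfolding band_complex_def diagram_complex_def * by (simp add: edge_path_def cong: if_cong)
qed

context wf_digraph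
begin

lemma letter_ends_in_verts:
  "nonzero_path G I (letter_path l) \<Longrightarrow> letter_end G l \<in> verts G"
  "nonzero_path G I (letter_path l) \<Longrightarrow> letter_start G l \<in> verts G"
  by (cases l; simp add: nonzero_path_ends)+

lemma wf_word_diagram:
  assumes "closed_string G I w"
  shows "wf_diagram G I (word_diagram G w d c)"
proof -
  have "letter_end G (w ! next_vertex w i) = letter_start G (w ! i)" if "i < length w" for i
    using closed_string_composable[OF assms that] by (simp add: letters_composable_def)
  moreover have "w \<noteq> []" using assms by (simp add: closed_string_def)
  moreover have "letter_end G (w ! i) \<in> verts G" if "i < length w" for i
    by (rule letter_ends_in_verts) (rule closed_string_nonzero[OF assms that])
  ultimately show ?thesis
    using closed_string_nonzero[OF assms] closed_string_vertex_degree[OF assms] next_vertex_less[of w]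
    by (auto simp: wf_diagram_def word_diagram_def edge_path_def)
qed

lemma null_word_diagram:
  assumes "closed_string G I w"
  shows "null_diagram I (word_diagram G w d c)"
  unfolding null_diagram_def
proof (intro ballI impI)
  let ?D = "word_diagram G w d c"
  fix e e' assume e: "e \<in> edges ?D" "e' \<in> edges ?D" "target ?D e = source ?D e'"
  then have less: "e < length w" "e' < length w" by (simp_all add: word_diagram_def)
  note comp = closed_string_composable[OF assms less(1)] closed_string_composable[OF assms less(2)]
  show "(last (edge_path ?D e), hd (edge_path ?D e')) \<in> I"
    using e comp less
    by (cases "w ! e"; cases "w ! e'")
      (auto simp: word_diagram_def target_def source_def edge_path_def letters_composable_def
        next_vertex_eq_iff)
qed

lemma bounded_complex_word_diagram:
  "closed_string G I w \<Longrightarrow> bounded_complex G I (diagram_complex G I (word_diagram G w d c))"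
  by (rule bounded_complex_diagram[OF wf_word_diagram null_word_diagram])

end

subsection \<open>Closed walks\<close>

text \<open>
  With walks, the rotation and inversion that \<open>\<tau>\<close> undergoes in the cone need no index arithmetic.
\<close>

fun walk :: "('i, 'l, 'v, 'a, 'k) diagram \<Rightarrow> 'i \<Rightarrow> 'l list \<Rightarrow> 'i \<Rightarrow> bool" where
  "walk D x [] y \<longleftrightarrow> x = y"
| "walk D x (e # es) y \<longleftrightarrow> left_end D e = x \<and> walk D (right_end D e) es y"

lemma walk_append: "walk D x (es @ fs) z \<longleftrightarrow> (\<exists>y. walk D x es y \<and> walk D y fs z)"
  by (induction es arbitrary: x) auto

lemma walk_nth:
  "walk D x es y \<Longrightarrow> i < length es \<Longrightarrow>
    right_end D (es ! i) = (if Suc i = length es then y else left_end D (es ! Suc i))"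
proof (induction es arbitrary: x i)
  case (Cons e es)
  show ?case
  proof (cases i)
    case 0
    then show ?thesis using Cons.prems by (cases es) auto
  next
    case (Suc j)
    then show ?thesis using Cons.IH[of "right_end D e" j] Cons.prems by auto
  qed
qed simp

lemma walk_edges_update [simp]: "walk (D\<lparr>edges := E\<rparr>) x es y = walk D x es y"
  by (induction es arbitrary: x) auto

lemma walk_appendI: "walk D x es y \<Longrightarrow> walk D y fs z \<Longrightarrow> walk D x (es @ fs) z"
  by (auto simp: walk_append)

lemma wf_diagram_edges_subset:
  assumes "wf_diagram Q I D" "E \<subseteq> edges D"
  shows "wf_diagram Q I (D\<lparr>edges := E\<rparr>)"
proof -
  have "edge_path (D\<lparr>edges := E\<rparr>) = edge_path D" by (simp add: edge_path_def fun_eq_iff)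
  then show ?thesis using assms by (auto simp: wf_diagram_def intro: finite_subset)
qed

context wf_digraph
begin

text \<open>
  The position of a letter in the word of the walk names an edge and also the left end of that edge,
  and the degrees agree because they agree at the start of the walk.
\<close>

lemma isomorphic_complexes_closed_walk:
  fixes D :: "('i, 'l, 'a, 'b, 'k::field) diagram"
  assumes D: "wf_diagram G I D"
    and es: "distinct es" "set es = edges D" "walk D x es x"
    and left: "bij_betw (left_end D) (edges D) (vertices D)"
    and w: "closed_string G I w" "map (label D) es = w"
  shows "isomorphic_complexes G I (diagram_complex G I D)
    (diagram_complex G I (word_diagram G w (vdeg D x) (\<lambda>l. weight D (es ! l))))"
proof -
  let ?W = "word_diagram G w (vdeg D x) (\<lambda>l. weight D (es ! l))"
  have lab: "label D (es ! l) = w ! l" if "l < length w" for l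
    using w(2) that by auto
  have len: "length es = length w" using w(2) by auto
  have "w \<noteq> []" using w(1) by (simp add: closed_string_def)
  then have es0: "left_end D (es ! 0) = x"
    using es(3) len by (cases es) auto
  have r: "bij_betw (\<lambda>l. es ! l) {..<length w} (edges D)"
    using bij_betw_nth[OF es(1)] es(2) len by simp
  have in_edges: "es ! l \<in> edges D" if "l < length w" for l
    using that es(2) len nth_mem by metis
  have right: "right_end D (es ! l) = left_end D (es ! next_vertex w l)" if "l < length w" for l
    using walk_nth[OF es(3), of l] that len es0 by (simp add: next_vertex_if)
  have edge: "place D (left_end D e) = letter_end G (label D e)"
    "vdeg D (right_end D e) = vdeg D (left_end D e) + (if is_direct (label D e) then 1 else - 1)"
    if "e \<in> edges D" for e
    using D that by (auto simp: wf_diagram_def)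
  have deg: "vdeg D (left_end D (es ! l)) = vertex_degree w (vdeg D x) l" if "l < length w" for l
    using that
  proof (induction l)
    case (Suc l)
    then have l: "l < length w" by simp
    have "left_end D (es ! Suc l) = right_end D (es ! l)"
      using right[OF l] Suc.prems by (simp add: next_vertex_if)
    then show ?case
      using edge(2)[OF in_edges[OF l]] Suc.IH[OF l] lab[OF l] by (simp add: vertex_degree_Suc[OF l])
  qed (simp add: es0)
  show ?thesis
  proof (rule isomorphic_complexes_relabel[OF D wf_word_diagram[OF w(1)],
        where \<rho>="\<lambda>l. left_end D (es ! l)" and r="\<lambda>l. es ! l"])
    show "bij_betw (\<lambda>l. left_end D (es ! l)) (vertices ?W) (vertices D)"
      using bij_betw_trans[OF r left] by (simp add: comp_def)
    show "bij_betw (\<lambda>l. es ! l) (edges ?W) (edges D)" using r by simp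
    show "place D (left_end D (es ! l)) = place ?W l \<and> vdeg D (left_end D (es ! l)) = vdeg ?W l"
      if "l \<in> vertices ?W" for l
      using that edge(1)[OF in_edges] lab deg by simp
    show "label D (es ! m) = label ?W m \<and> weight D (es ! m) = weight ?W m \<and>
        left_end D (es ! m) = left_end D (es ! left_end ?W m) \<and>
        right_end D (es ! m) = left_end D (es ! right_end ?W m)" if "m \<in> edges ?W" for m
      using that lab right by simp
  qed
qed

end

subsection \<open>Powers and inverses of words\<close>

lemma word_power_add: "word_power w (k + l) = word_power w k @ word_power w l"
  by (induction k) (simp_all add: word_power_def)

lemma word_power_mult: "word_power (word_power w k) l = word_power w (k * l)"
proof (induction l)
  case (Suc l)
  have "word_power (word_power w k) (Suc l) = word_power w k @ word_power (word_power w k) l"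
    by (simp add: word_power_def)
  then show ?case using Suc by (simp add: word_power_add)
qed (simp add: word_power_def)

lemma length_filter_word_power:
  "length (filter P (word_power w k)) = k * length (filter P w)"
  by (induction k) (simp_all add: word_power_def)

lemma set_word_power: "k \<ge> 1 \<Longrightarrow> set (word_power w k) = set w"
  by (simp add: word_power_def)

lemma closed_string_root:
  assumes w: "closed_string Q I (word_power \<rho> m)" and m: "m \<ge> 1"
  shows "closed_string Q I \<rho>"
proof -
  have "m + m = 2 + (2 * m - 2)" using m by simp
  then have "word_power \<rho> m @ word_power \<rho> m = word_power \<rho> (2 + (2 * m - 2))"
    by (simp only: word_power_add[symmetric])
  also have "\<dots> = (\<rho> @ \<rho>) @ word_power \<rho> (2 * m - 2)"
    by (simp only: word_power_add word_power_2)
  finally have "successively (letters_composable Q I) (\<rho> @ \<rho>)"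
    using w unfolding closed_string_def by (simp only: successively_append_iff)
  moreover have "\<rho> \<noteq> []"
    using w by (auto simp: closed_string_def word_power_def)
  ultimately show ?thesis
    using w m by (simp add: closed_string_def length_filter_word_power set_word_power)
qed

text \<open>
  A closed string that is a proper power is a power of a shorter closed string.
\<close>

lemma closed_string_power_of_band:
  assumes "closed_string Q I w"
  obtains \<theta> k where "homotopy_band Q I \<theta>" "k \<ge> 1" "word_power \<theta> k = w"
proof -
  have "\<exists>\<theta> k. homotopy_band Q I \<theta> \<and> k \<ge> 1 \<and> word_power \<theta> k = w"
    using assms
  proof (induction "length w" arbitrary: w rule: less_induct)
    case less
    show ?case
    proof (cases "\<exists>\<rho> m. m \<ge> 2 \<and> w = word_power \<rho> m")
      case False
      then show ?thesis using less.prems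
        by (intro exI[of _ w] exI[of _ 1]) (auto simp: homotopy_band_iff_closed_string word_power_def)
    next
      case True
      then obtain \<rho> m where m: "m \<ge> 2" "w = word_power \<rho> m" by blast
      then have \<rho>: "closed_string Q I \<rho>" using closed_string_root[of Q I \<rho> m] less.prems by simp
      have "length \<rho> > 0" using \<rho> by (simp add: closed_string_def)
      then have "length \<rho> < length w" using m by (simp add: length_word_power)
      from less.hyps[OF this \<rho>] obtain \<theta> k where
        "homotopy_band Q I \<theta>" "k \<ge> 1" "word_power \<theta> k = \<rho>" by blast
      then show ?thesis using m
        by (intro exI[of _ \<theta>] exI[of _ "k * m"]) (auto simp flip: word_power_mult)
    qed
  qed
  then show ?thesis using that by blast
qed

lemma inv_letter_simps [simp]:
  "letter_path (inv_letter l) = letter_path l"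
  "is_direct (inv_letter l) \<longleftrightarrow> \<not> is_direct l"
  "letter_start Q (inv_letter l) = letter_end Q l"
  "letter_end Q (inv_letter l) = letter_start Q l"
  by (cases l; simp)+

lemma letters_composable_inv:
  "letters_composable Q I (inv_letter l') (inv_letter l) \<longleftrightarrow> letters_composable Q I l l'"
  by (cases l; cases l') (auto simp: letters_composable_def)

lemma successively_inv_word:
  "successively (letters_composable Q I) (inv_word w) \<longleftrightarrow> successively (letters_composable Q I) w"
  unfolding inv_word_def successively_rev successively_map letters_composable_inv ..

lemma inv_word_append: "inv_word (v @ w) = inv_word w @ inv_word v"
  by (simp add: inv_word_def)

lemma length_filter_inv_word:
  "length (filter is_direct (inv_word w)) = length (filter (Not \<circ> is_direct) w)"
  "length (filter (Not \<circ> is_direct) (inv_word w)) = length (filter is_direct w)"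
  by (induction w) (auto simp: inv_word_def)

lemma successively_enclosed:
  "V \<noteq> [] \<Longrightarrow> successively P ([x] @ V @ [y]) \<longleftrightarrow> P x (hd V) \<and> successively P V \<and> P (last V) y"
  by (auto simp: successively_append_iff successively_Cons)

lemma successively_alternating:
  assumes "successively P X" "successively P Z" "X \<noteq> []" "Z \<noteq> []" "P (last X) (hd Z)" "P (last Z) (hd X)"
  shows "successively P (X @ Z @ X @ Z @ X)"
  using assms by (simp add: successively_append_iff)

text \<open>
  The word \<open>BA\<close> is what lies between two successive occurrences of \<open>l\<close> in the square.
\<close>

lemma closed_string_split:
  assumes "closed_string Q I (A @ [l] @ B)" "B @ A \<noteq> []"
  shows "successively (letters_composable Q I) (B @ A)"
    "letters_composable Q I l (hd (B @ A))" "letters_composable Q I (last (B @ A)) l"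
proof -
  have "successively (letters_composable Q I) (A @ ([l] @ (B @ A) @ [l]) @ B)"
    using assms(1) by (simp add: closed_string_def)
  then have "successively (letters_composable Q I) ([l] @ (B @ A) @ [l])"
    by (simp only: successively_append_iff)
  then show "successively (letters_composable Q I) (B @ A)"
    "letters_composable Q I l (hd (B @ A))" "letters_composable Q I (last (B @ A)) l"
    unfolding successively_enclosed[OF assms(2)] by simp_all
qed

lemma relation_if_product_zero:
  assumes "nonzero_path Q I p" "nonzero_path Q I q" "\<not> nonzero_path Q I (p @ q)" "path_start Q p = path_end Q q"
  shows "(last p, hd q) \<in> I"
proof -
  have "p \<noteq> []" "q \<noteq> []" using assms(1,2) by (simp_all add: nonzero_path_def)
  then show ?thesis using assms nonzero_path_append by blast
qed

lemma left_neighbour_eq: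
  assumes "i < length (U @ [Direct p] @ V)" "next_vertex (U @ [Direct p] @ V) i = length U" "V @ U \<noteq> []"
  shows "(U @ [Direct p] @ V) ! i = left_neighbour U V"
proof (cases "U = []")
  case True
  then have "i = length V" using assms by (auto simp: next_vertex_if split: if_splits)
  then show ?thesis using True assms(3) by (simp add: left_neighbour_def last_conv_nth nth_Cons')
next
  case False
  then have "Suc i = length U" using assms by (auto simp: next_vertex_if split: if_splits)
  then have "(U @ [Direct p] @ V) ! i = U ! (length U - 1)"
    by (auto simp: nth_append simp flip: \<open>Suc i = length U\<close>)
  then show ?thesis using False by (simp add: left_neighbour_def last_conv_nth[of U])
qed

lemma map_nth_middle:
  "map (\<lambda>i. (xs @ [x] @ ys) ! i) [0..<length xs] = xs"
  "map (\<lambda>i. (xs @ [x] @ ys) ! i) [Suc (length xs)..<length (xs @ [x] @ ys)] = ys"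
  by (rule nth_equalityI; simp add: nth_append del: upt_Suc)+

section \<open>Powers of a word as coverings\<close>

text \<open>
  The total scalar along the first \<open>l\<close> letters, inverse letters being passed against their arrows.
  Rescaling the vertices of a cyclic diagram does not change the transport around the whole cycle.
\<close>

definition transport :: "'a letter list \<Rightarrow> (nat \<Rightarrow> 'k::field) \<Rightarrow> nat \<Rightarrow> 'k" where
  "transport w c l = (\<Prod>m<l. if is_direct (w ! m) then c m else inverse (c m))"

lemma transport_Suc:
  "transport w c (Suc m) = transport w c m * (if is_direct (w ! m) then c m else inverse (c m))"
  by (simp add: transport_def)

lemma transport_nonzero: "(\<And>m. m < l \<Longrightarrow> c m \<noteq> 0) \<Longrightarrow> transport w c l \<noteq> 0"
  by (simp add: transport_def)

lemma prod_periodic_delta: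
  fixes z :: "'k::field"
  assumes "t < N"
  shows "(\<Prod>m<l. if m mod N = t then z else 1) = z ^ (l div N) * (if t < l mod N then z else 1)"
  by (induction l) (use assms in \<open>auto simp: div_Suc mod_Suc\<close>)

lemma sum_powers_root_of_unity:
  fixes z :: "'k::field"
  assumes "z ^ k = 1" "z \<noteq> 1"
  shows "(\<Sum>q<k. z ^ q) = 0" "(\<Sum>i=1..k. z ^ i) = 0"
proof -
  have "(z - 1) * (\<Sum>q<k. z ^ q) = 0"
    using power_diff_1_eq[of z k] assms(1) by simp
  then show *: "(\<Sum>q<k. z ^ q) = 0" using assms(2) by simp
  have "(\<Sum>i=1..k. z ^ i) = z * (\<Sum>q<k. z ^ q)"
    unfolding sum_distrib_left
    by (rule sum.reindex_bij_witness[of _ Suc "\<lambda>i. i - 1"]) (auto simp flip: power_Suc)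
  then show "(\<Sum>i=1..k. z ^ i) = 0" by (simp add: *)
qed

lemma primitive_root_power_eq_iff:
  fixes \<omega> :: "'k::field"
  assumes "primitive_root_of_unity k \<omega>" "k \<ge> 1" "i < j + k" "j < i + k"
  shows "\<omega> ^ i = \<omega> ^ j \<longleftrightarrow> i = j"
proof -
  have nz: "\<omega> \<noteq> 0" using assms(1,2) by (auto simp: primitive_root_of_unity_def power_0_left)
  have "i = j" if "\<omega> ^ i = \<omega> ^ j" "i \<le> j" "j < i + k" for i j
  proof (rule ccontr)
    assume "i \<noteq> j"
    have "\<omega> ^ i * \<omega> ^ (j - i) = \<omega> ^ i * 1"
      using that by (metis le_add_diff_inverse mult.right_neutral power_add)
    then have "\<omega> ^ (j - i) = 1" using nz by simp
    moreover have "0 < j - i" "j - i < k" using that \<open>i \<noteq> j\<close> by auto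
    ultimately show False using assms(1) by (auto simp: primitive_root_of_unity_def)
  qed
  from this[of i j] this[of j i] show ?thesis using assms(3,4) by (cases "i \<le> j") auto
qed

text \<open>
  Otherwise \<open>1 + X + \<dots> + X\<^bsup>k-1\<^esup>\<close> would vanish at the \<open>k\<close> powers of the root, at \<open>1\<close> because its
  value there is \<open>k\<close>.
\<close>

lemma primitive_root_of_nat_nonzero:
  fixes \<omega> :: "'k::field"
  assumes "primitive_root_of_unity k \<omega>" "k \<ge> 1"
  shows "of_nat k \<noteq> (0 :: 'k)"
proof
  assume k0: "of_nat k = (0 :: 'k)"
  define p where "p = (\<Sum>q<k. monom (1 :: 'k) q)"
  have "coeff p (k - 1) = 1"
    using assms(2) by (simp add: p_def coeff_sum)
  then have p: "p \<noteq> 0" by auto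
  have deg: "degree p < k"
    unfolding p_def using assms(2)
    by (intro degree_sum_less) (auto intro: le_less_trans[OF degree_monom_le])
  have "poly p (\<omega> ^ i) = 0" if "i < k" for i
  proof (cases "\<omega> ^ i = 1")
    case True
    then show ?thesis using k0 by (simp add: p_def poly_sum poly_monom)
  next
    case False
    have "(\<omega> ^ i) ^ k = 1"
      using assms(1) by (metis power_commutes power_mult power_one primitive_root_of_unity_def mult.commute)
    then show ?thesis using sum_powers_root_of_unity(1)[OF _ False] by (simp add: p_def poly_sum poly_monom)
  qed
  then have sub: "(\<lambda>i. \<omega> ^ i) ` {..<k} \<subseteq> {x. poly p x = 0}" by auto
  have inj: "inj_on (\<lambda>i. \<omega> ^ i) {..<k}"
    by (rule inj_onI) (use primitive_root_power_eq_iff[OF assms] in auto)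
  have "k \<le> card {x. poly p x = 0}"
    using card_mono[OF poly_roots_finite[OF p] sub] card_image[OF inj] by simp
  also have "\<dots> \<le> degree p" by (rule card_poly_roots_bound[OF p])
  finally show False using deg by simp
qed

lemma closed_string_power_degree:
  assumes \<theta>: "closed_string Q I \<theta>" and l: "l < k * length \<theta>"
  shows "vertex_degree (word_power \<theta> k) d l = vertex_degree \<theta> d (l mod length \<theta>)"
  using l
proof (induction l)
  case (Suc l)
  have N: "length \<theta> > 0" using \<theta> by (simp add: closed_string_def)
  have "vertex_degree (word_power \<theta> k) d (Suc l) =
      vertex_degree \<theta> d (l mod length \<theta>) + (if is_direct (\<theta> ! (l mod length \<theta>)) then 1 else - 1)"
    using Suc by (simp add: vertex_degree_Suc length_word_power word_power_nth)
  also have "\<dots> = vertex_degree \<theta> d (next_vertex \<theta> (l mod length \<theta>))"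
    using closed_string_vertex_degree[OF \<theta>, of "l mod length \<theta>" d] N by simp
  also have "next_vertex \<theta> (l mod length \<theta>) = Suc l mod length \<theta>"
    by (simp add: next_vertex_def mod_Suc_eq)
  finally show ?case .
qed simp

lemma next_vertex_power:
  "next_vertex (word_power \<theta> k) l mod length \<theta> = next_vertex \<theta> (l mod length \<theta>)"
  by (simp add: next_vertex_def length_word_power mod_mod_cancel mod_Suc_eq)

context wf_digraph
begin

text \<open>
  The cyclic diagram of \<open>\<theta>\<^sup>k\<close> is a \<open>k\<close>-fold covering of the diagram of \<open>\<theta>\<close>.  A band complex on
  \<open>\<theta>\<close> pulls back to it whenever the \<open>k\<close>-th power of its scalar is the total scalar around the
  large cycle, the rescaling \<open>h\<close> of the coordinates being the quotient of the two transports.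
  This applies to the \<open>k\<close> scalars \<open>\<omega>\<^sup>i\<nu>\<close>, and the sum of the \<open>k\<close> pullbacks is inverted by
  the discrete Fourier transform over the fibres.
\<close>

lemma isomorphic_complexes_power:
  fixes c :: "nat \<Rightarrow> 'k::field"
  assumes \<theta>: "closed_string G I \<theta>" and w: "closed_string G I w" and w_eq: "w = word_power \<theta> k" and k: "k \<ge> 1"
    and c: "\<And>l. l < length w \<Longrightarrow> c l \<noteq> 0"
    and \<omega>: "primitive_root_of_unity k \<omega>" and \<nu>: "\<nu> ^ k = transport w c (length w)"
    and t: "direct_position \<theta> t"
  shows "isomorphic_complexes G I (diagram_complex G I (word_diagram G w d c))
    (complex_dsum {1..k} (\<lambda>i. band_complex G I \<theta> d t (\<omega> ^ i * \<nu>)))"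
proof -
  define N where "N = length \<theta>"
  define \<kappa> where "\<kappa> i = \<omega> ^ i * \<nu>" for i
  define b where "b i = (\<lambda>j. if j = t then \<kappa> i else 1)" for i
  define P where "P = transport w c"
  define \<epsilon> where "\<epsilon> i j = (if t < j then \<kappa> i else 1)" for i j
  define h where "h i l = P l / transport w (\<lambda>m. b i (m mod N)) l" for i l
  let ?V = "word_diagram G w d c" and ?T = "\<lambda>i. word_diagram G \<theta> d (b i)"
  let ?W = "diagram_complex G I ?V" and ?B = "\<lambda>i. diagram_complex G I (?T i)"
  have B: "band_complex G I \<theta> d t (\<omega> ^ i * \<nu>) = ?B i" for i
    unfolding band_complex_eq_diagram_complex b_def \<kappa>_def ..
  have N: "N > 0" using \<theta> by (simp add: closed_string_def N_def)
  have len: "length w = k * N" by (simp add: w_eq length_word_power N_def)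
  have nth: "w ! l = \<theta> ! (l mod N)" if "l < k * N" for l
    using that by (simp add: w_eq word_power_nth N_def)
  have next_mod: "next_vertex w l mod N = next_vertex \<theta> (l mod N)" for l
    unfolding w_eq N_def by (rule next_vertex_power)
  have t_less: "t < N" and t_direct: "is_direct (\<theta> ! t)" using t by (auto simp: direct_position_def N_def)
  have P0: "P l \<noteq> 0" if "l \<le> k * N" for l
    unfolding P_def by (rule transport_nonzero) (use c that len in auto)
  have "\<nu> \<noteq> 0" using \<nu> k P0[of "k * N"] by (auto simp: P_def len power_0_left)
  moreover have "\<omega> \<noteq> 0" using \<omega> k by (auto simp: primitive_root_of_unity_def power_0_left)
  ultimately have nz: "\<nu> \<noteq> 0" "\<omega> \<noteq> 0" "\<kappa> i \<noteq> 0" "\<epsilon> i j \<noteq> 0" for i j by (auto simp: \<kappa>_def \<epsilon>_def)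
  have b0: "b i j \<noteq> 0" for i j using nz by (simp add: b_def)
  have k0: "of_nat k \<noteq> (0 :: 'k)" by (rule primitive_root_of_nat_nonzero[OF \<omega> k])
  have root: "(\<omega> ^ i) ^ k = 1" for i
    using \<omega> by (metis power_mult power_one primitive_root_of_unity_def mult.commute)
  have tr: "transport w (\<lambda>m. b i (m mod N)) l = \<kappa> i ^ (l div N) * \<epsilon> i (l mod N)" if "l \<le> k * N" for i l
  proof -
    have "transport w (\<lambda>m. b i (m mod N)) l = (\<Prod>m<l. if m mod N = t then \<kappa> i else 1)"
      unfolding transport_def by (rule prod.cong) (use that nth t_direct in \<open>auto simp: b_def\<close>)
    then show ?thesis using prod_periodic_delta[OF t_less, where l=l and z="\<kappa> i"] by (simp add: \<epsilon>_def)
  qed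
  have less: "q * N + j < k * N" if "q < k" "j < N" for q j
  proof -
    have "q * N + j < q * N + N" using that by simp
    also have "\<dots> = Suc q * N" by simp
    also have "\<dots> \<le> k * N" using that by (intro mult_le_mono1) simp
    finally show ?thesis .
  qed
  have h_eq: "h i (q * N + j) = P (q * N + j) / (\<kappa> i ^ q * \<epsilon> i j)" if "q < k" "j < N" for i q j
    using less[OF that] that by (simp add: h_def tr)
  (* The one place where the condition on the k-th power of the scalar enters. *)
  have h_wrap: "h i (k * N) = h i 0" for i
  proof -
    have "\<kappa> i ^ k = P (k * N)" using root[of i] \<nu> by (simp add: \<kappa>_def power_mult_distrib P_def len)
    moreover have "\<epsilon> i 0 = 1" "P 0 = 1" by (simp_all add: \<epsilon>_def P_def transport_def)
    ultimately show ?thesis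
      using N P0[of "k * N"] tr[of 0 i] tr[of "k * N" i] by (simp add: h_def)
  qed
  have h_next: "h i (next_vertex w m) = h i (Suc m)" if "m < k * N" for i m
    using that h_wrap by (simp add: next_vertex_if len)
  have h_Suc: "h i (Suc m) = h i m * (if is_direct (w ! m) then c m / b i (m mod N) else b i (m mod N) / c m)"
    if "m < k * N" for i m
    by (simp add: h_def P_def transport_Suc field_simps)
  define f where "f i = (\<lambda>(n :: int) u l. if l \<in> vertices ?V
      then (\<lambda>x. h i l * u (l mod N) x) else (0 :: ('a, 'b) path \<Rightarrow> 'k))" for i
  have source_mod: "source (?T i) (m mod N) = source ?V m mod N"
    and target_mod: "target (?T i) (m mod N) = target ?V m mod N"
    if "m < k * N" for i m
    using nth[OF that] by (auto simp: source_def target_def next_mod)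
  have cochain: "cochain_map G I (?B i) ?W (f i)" for i
    unfolding f_def
  proof (rule cochain_map_pullback[OF wf_word_diagram[OF \<theta>] wf_word_diagram[OF w], where r="\<lambda>m. m mod N"])
    fix l assume "l \<in> vertices ?V"
    then have l: "l < k * N" by (simp add: len)
    show "l mod N \<in> vertices (?T i) \<and>
        place (?T i) (l mod N) = place ?V l \<and>
        vdeg (?T i) (l mod N) = vdeg ?V l"
      using N l nth[OF l] closed_string_power_degree[OF \<theta>, of l k d] by (simp add: N_def w_eq)
    let ?M = "{m \<in> edges ?V. target ?V m = l}"
    have "inj_on (\<lambda>m. m mod N) ?M"
    proof (rule inj_onI)
      fix m m' assume m: "m \<in> ?M" "m' \<in> ?M" "m mod N = m' mod N"
      then have "w ! m = w ! m'" by (simp add: nth len)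
      then show "m = m'"
        using m by (auto simp: target_def next_vertex_eq_iff split: if_splits)
    qed
    moreover have "(\<lambda>m. m mod N) ` ?M =
        {e \<in> edges (?T i). target (?T i) e = l mod N}"
    proof (intro equalityI subsetI)
      fix e assume "e \<in> (\<lambda>m. m mod N) ` ?M"
      then show "e \<in> {e \<in> edges (?T i). target (?T i) e = l mod N}"
        using N target_mod by (auto simp: len N_def)
    next
      fix e assume "e \<in> {e \<in> edges (?T i). target (?T i) e = l mod N}"
      then have e: "e < N" "target (?T i) e = l mod N" by (simp_all add: N_def)
      show "e \<in> (\<lambda>m. m mod N) ` ?M"
      proof (cases "is_direct (\<theta> ! e)")
        case True
        obtain m where m: "m < length w" "next_vertex w m = l"
          using next_vertex_surj[of l w] l len by auto
        have "next_vertex \<theta> (m mod N) = next_vertex \<theta> e"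
          using e True m(2) by (simp add: target_def next_mod[symmetric])
        then have "m mod N = e" using e(1) N by (simp add: N_def next_vertex_eq_iff)
        then show ?thesis using m True nth[of m] len
          by (intro image_eqI[of _ _ m]) (auto simp: target_def)
      next
        case False
        then have "e = l mod N" using e by (simp add: target_def)
        then show ?thesis using l False nth[OF l] len
          by (intro image_eqI[of _ _ l]) (auto simp: target_def)
      qed
    qed
    ultimately show "bij_betw (\<lambda>m. m mod N) ?M
        {e \<in> edges (?T i). target (?T i) e = l mod N}"
      by (simp add: bij_betw_def)
  next
    fix m assume "m \<in> edges ?V"
    then have m: "m < k * N" by (simp add: len)
    show "edge_path (?T i) (m mod N) = edge_path ?V m \<and>
        source (?T i) (m mod N) = source ?V m mod N"
      using nth[OF m] source_mod[OF m] by (simp add: edge_path_def)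
    show "h i (source ?V m) * weight ?V m =
        h i (target ?V m) * weight (?T i) (m mod N)"
      using h_next[OF m] h_Suc[OF m] c[of m] b0[of i "m mod N"] m len
      by (auto simp: source_def target_def)
  qed
  define \<phi> where "\<phi> n v = (\<Sum>i\<in>{1..k}. f i n (v i))" for n v
  define g where "g i u = (\<lambda>j. if j < N
      then \<Sum>q<k. (\<lambda>x. inverse (of_nat k * h i (q * N + j)) * u (q * N + j) x)
      else (0 :: ('a, 'b) path \<Rightarrow> 'k))" for i and u :: "nat \<Rightarrow> ('a, 'b) path \<Rightarrow> 'k"
  define \<psi> where "\<psi> u = (\<lambda>i. if i \<in> {1..k} then g i u else 0)" for u
  have deg: "vertex_degree w d (q * N + j) = vertex_degree \<theta> d j" if "q < k" "j < N" for q j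
    using closed_string_power_degree[OF \<theta>, of "q * N + j" k d] less[OF that] that by (simp add: w_eq N_def)
  have "g i \<in> module_hom G I (obj ?W n) (obj (?B i) n)" for i n
    unfolding diagram_complex_def cpx.simps
  proof (rule module_hom_dsum_projI)
    fix u :: "nat \<Rightarrow> ('a, 'b) path \<Rightarrow> 'k"
    assume "u \<in> mcarrier (module_dsum {i \<in> vertices ?V. vdeg ?V i = n}
        (\<lambda>i. proj G I (place ?V i)))"
    then have u: "l < k * N \<Longrightarrow> vertex_degree w d l = n \<Longrightarrow> u l \<in> mcarrier (proj G I (letter_end G (w ! l)))"
      "\<not> (l < k * N \<and> vertex_degree w d l = n) \<Longrightarrow> u l = 0" for l
      by (auto simp: dsum_proj_carrier len)
    have "g i u j \<in> mcarrier (proj G I (letter_end G (\<theta> ! j)))"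
      if "j < N" "vertex_degree \<theta> d j = n" for j
      unfolding g_def using that less nth deg u(1)
      by (auto intro!: proj_sum proj_scale) (metis less mod_less mod_mult_self3 nth u(1) deg)
    moreover have "g i u j = 0" if "\<not> (j < N \<and> vertex_degree \<theta> d j = n)" for j
    proof (cases "j < N")
      case True
      then have "u (q * N + j) = 0" if "q < k" for q
        using that \<open>\<not> (j < N \<and> _)\<close> deg[OF that True] by (intro u(2)) auto
      then show ?thesis unfolding g_def by (auto intro!: sum.neutral)
    qed (simp add: g_def)
    ultimately show "g i u \<in> mcarrier (module_dsum {j \<in> vertices (?T i).
        vdeg (?T i) j = n} (\<lambda>j. proj G I (place (?T i) j)))"
      by (simp add: dsum_proj_carrier N_def)
  next
    fix u v :: "nat \<Rightarrow> ('a, 'b) path \<Rightarrow> 'k"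
    show "g i (u + v) = g i u + g i v"
      by (intro ext) (simp add: g_def sum_fun_apply distrib_left sum.distrib)
  next
    fix a and u :: "nat \<Rightarrow> ('a, 'b) path \<Rightarrow> 'k"
    show "g i (\<lambda>l. alg_mult G I a (u l)) = (\<lambda>j. alg_mult G I a (g i u j))"
      by (rule ext) (simp add: g_def alg_mult_sum_right alg_mult_scale_right)
  qed
  then have \<psi>_hom: "\<psi> \<in> module_hom G I (obj ?W n) (obj (complex_dsum {1..k} ?B) n)" for n
    unfolding \<psi>_def complex_dsum_def cpx.simps by (intro module_hom_into_dsum)
  have \<phi>_cochain: "cochain_map G I (complex_dsum {1..k} ?B) ?W \<phi>"
    unfolding \<phi>_def
    by (rule cochain_map_from_dsum) (use cochain bounded_complex_word_diagram[OF w] in auto)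
  (* The two orthogonality relations say that the normalised fibre sums invert the sum of pullbacks. *)
  have orth1: "(\<Sum>q<k. inverse (of_nat k * h i (q * N + j)) * h i' (q * N + j)) = (if i' = i then 1 else 0)"
    if "i \<in> {1..k}" "i' \<in> {1..k}" "j < N" for i i' j
  proof -
    let ?z = "\<omega> ^ i / \<omega> ^ i'"
    have "(\<Sum>q<k. inverse (of_nat k * h i (q * N + j)) * h i' (q * N + j)) =
        (\<Sum>q<k. \<epsilon> i j / (of_nat k * \<epsilon> i' j) * ?z ^ q)"
    proof (rule sum.cong[OF refl])
      fix q assume "q \<in> {..<k}"
      then have q: "q < k" by simp
      have "P (q * N + j) \<noteq> 0" using P0 less[OF q that(3)] by simp
      then show "inverse (of_nat k * h i (q * N + j)) * h i' (q * N + j) =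
          \<epsilon> i j / (of_nat k * \<epsilon> i' j) * ?z ^ q"
        using nz k0 unfolding h_eq[OF q that(3)] \<kappa>_def power_divide power_mult_distrib
        by (simp add: field_simps)
    qed
    also have "\<dots> = \<epsilon> i j / (of_nat k * \<epsilon> i' j) * (\<Sum>q<k. ?z ^ q)"
      by (rule sum_distrib_left[symmetric])
    also have "\<dots> = (if i' = i then 1 else 0)"
    proof (cases "i' = i")
      case True
      then show ?thesis using nz k0 by simp
    next
      case False
      then have "?z \<noteq> 1" using primitive_root_power_eq_iff[OF \<omega> k, of i i'] that nz by auto
      moreover have "?z ^ k = 1" by (simp add: power_divide root)
      ultimately have "(\<Sum>q<k. ?z ^ q) = 0" by (intro sum_powers_root_of_unity(1))
      then show ?thesis using False by (simp only: mult_zero_right if_False)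
    qed
    finally show ?thesis .
  qed
  have orth2: "(\<Sum>i\<in>{1..k}. h i (q' * N + j) * inverse (of_nat k * h i (q * N + j))) = (if q = q' then 1 else 0)"
    if "q < k" "q' < k" "j < N" for q q' j
  proof -
    let ?z = "\<omega> ^ q / \<omega> ^ q'"
    let ?a = "P (q' * N + j) * \<nu> ^ q / (P (q * N + j) * \<nu> ^ q' * of_nat k)"
    have Pq: "P (q * N + j) \<noteq> 0" "P (q' * N + j) \<noteq> 0" using P0 less[OF that(1,3)] less[OF that(2,3)] by simp_all
    have "(\<Sum>i\<in>{1..k}. h i (q' * N + j) * inverse (of_nat k * h i (q * N + j))) = (\<Sum>i\<in>{1..k}. ?a * ?z ^ i)"
    proof (rule sum.cong[OF refl])
      fix i
      have comm: "(\<omega> ^ i) ^ q = (\<omega> ^ q) ^ i" for q by (metis power_mult mult.commute)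
      show "h i (q' * N + j) * inverse (of_nat k * h i (q * N + j)) = ?a * ?z ^ i"
        using nz k0 Pq
        unfolding h_eq[OF that(1,3)] h_eq[OF that(2,3)] \<kappa>_def power_divide power_mult_distrib comm
        by (simp add: field_simps)
    qed
    also have "\<dots> = ?a * (\<Sum>i\<in>{1..k}. ?z ^ i)"
      by (rule sum_distrib_left[symmetric])
    also have "\<dots> = (if q = q' then 1 else 0)"
    proof (cases "q = q'")
      case True
      then show ?thesis using nz k0 Pq by simp
    next
      case False
      then have "?z \<noteq> 1" using primitive_root_power_eq_iff[OF \<omega> k, of q q'] that nz by auto
      moreover have "?z ^ k = 1" by (simp add: power_divide root)
      ultimately have "(\<Sum>i\<in>{1..k}. ?z ^ i) = 0" by (intro sum_powers_root_of_unity(2))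
      then show ?thesis using False by (simp only: mult_zero_right if_False)
    qed
    finally show ?thesis .
  qed
  have \<psi>\<phi>: "\<psi> (\<phi> n v) = v" if v: "v \<in> mcarrier (obj (complex_dsum {1..k} ?B) n)" for n v
  proof -
    have v0: "v i j = 0" if "\<not> j < N" "i \<in> {1..k}" for i j
      using v that by (auto simp: complex_dsum_def diagram_complex_def module_dsum_carrier N_def)
    have v1: "v i = 0" if "i \<notin> {1..k}" for i
      using v that by (auto simp: complex_dsum_def module_dsum_carrier)
    have "\<psi> (\<phi> n v) i j x = v i j x" for i j x
    proof (cases "i \<in> {1..k} \<and> j < N")
      case False
      then show ?thesis using v0 v1 by (auto simp: \<psi>_def g_def)
    next
      case True
      then have i: "i \<in> {1..k}" and j: "j < N" by auto
      have \<phi>: "\<phi> n v (q * N + j) x = (\<Sum>i'\<in>{1..k}. h i' (q * N + j) * v i' j x)" if "q < k" for q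
        using less[OF that j] j by (simp add: \<phi>_def f_def sum_fun_apply len)
      have "\<psi> (\<phi> n v) i j x = (\<Sum>q<k. \<Sum>i'\<in>{1..k}. inverse (of_nat k * h i (q * N + j)) * h i' (q * N + j) * v i' j x)"
        using i j \<phi> by (simp add: \<psi>_def g_def sum_fun_apply sum_distrib_left mult.assoc)
      also have "\<dots> = (\<Sum>i'\<in>{1..k}. (\<Sum>q<k. inverse (of_nat k * h i (q * N + j)) * h i' (q * N + j)) * v i' j x)"
        unfolding sum_distrib_right by (rule sum.swap)
      also have "\<dots> = (\<Sum>i'\<in>{1..k}. if i' = i then v i j x else 0)"
        by (rule sum.cong) (use orth1[OF i _ j] in auto)
      also have "\<dots> = v i j x" using i by simp
      finally show ?thesis .
    qed
    then show ?thesis by (intro ext)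
  qed
  have \<phi>\<psi>: "\<phi> n (\<psi> u) = u" if u: "u \<in> mcarrier (obj ?W n)" for n u
  proof -
    have u0: "u l = 0" if "\<not> l < k * N" for l
      using u that by (auto simp: diagram_complex_def module_dsum_carrier len)
    have "\<phi> n (\<psi> u) l x = u l x" for l x
    proof (cases "l < k * N")
      case False
      then show ?thesis using u0 by (simp add: \<phi>_def f_def sum_fun_apply len)
    next
      case True
      define q' j where "q' = l div N" and "j = l mod N"
      have j: "j < N" and q': "q' < k" and l: "l = q' * N + j"
        using True N by (auto simp: q'_def j_def less_mult_imp_div_less)
      have "\<phi> n (\<psi> u) l x = (\<Sum>i\<in>{1..k}. \<Sum>q<k. h i (q' * N + j) * inverse (of_nat k * h i (q * N + j)) * u (q * N + j) x)"
        using True j by (simp add: \<phi>_def f_def \<psi>_def g_def sum_fun_apply len l sum_distrib_left mult.assoc)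
      also have "\<dots> = (\<Sum>q<k. (\<Sum>i\<in>{1..k}. h i (q' * N + j) * inverse (of_nat k * h i (q * N + j))) * u (q * N + j) x)"
        unfolding sum_distrib_right by (rule sum.swap)
      also have "\<dots> = (\<Sum>q<k. if q = q' then u (q' * N + j) x else 0)"
        by (rule sum.cong) (use orth2[OF _ q' j] in auto)
      also have "\<dots> = u l x" using q' l by simp
      finally show ?thesis .
    qed
    then show ?thesis by (intro ext)
  qed
  have "bounded_complex G I (complex_dsum {1..k} ?B)"
    by (rule bounded_complex_dsum) (use bounded_complex_word_diagram[OF \<theta>] in auto)
  then have "diff (complex_dsum {1..k} ?B) n x \<in> mcarrier (obj (complex_dsum {1..k} ?B) (n + 1))"
    if "x \<in> mcarrier (obj (complex_dsum {1..k} ?B) n)" for n x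
    using that module_homD(1) unfolding bounded_complex_def by blast
  then have "isomorphic_complexes G I (complex_dsum {1..k} ?B) ?W"
    using \<phi>_cochain \<psi>_hom \<psi>\<phi> \<phi>\<psi> by (intro isomorphic_complexesI[where \<phi>=\<phi> and \<psi>="\<lambda>_. \<psi>"]) auto
  then show ?thesis unfolding B by (rule isomorphic_complexes_sym)
qed

end

section \<open>The word and the diagram of the cone\<close>

locale double_map_words = wf_digraph Q for Q :: "('v, 'a) pre_digraph" +
  fixes I :: "('a \<times> 'a) set" and A B A' B' :: "'a letter list" and \<sigma>C \<tau>C fL fR :: "'a list"
  assumes sigma_closed: "closed_string Q I (A @ [Direct \<sigma>C] @ B)"
    and tau_closed: "closed_string Q I (A' @ [Direct \<tau>C] @ B')"
    and paths: "double_map_paths Q I A \<sigma>C B A' \<tau>C B' fL fR"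
begin

abbreviation \<sigma> where "\<sigma> \<equiv> A @ [Direct \<sigma>C] @ B"
abbreviation \<tau> where "\<tau> \<equiv> A' @ [Direct \<tau>C] @ B'"
abbreviation iL where "iL \<equiv> length A"
abbreviation jL where "jL \<equiv> length A'"
abbreviation iR where "iR \<equiv> next_vertex \<sigma> iL"
abbreviation jR where "jR \<equiv> next_vertex \<tau> jL"

definition cone_word :: "'a letter list" where
  "cone_word = A @ [Direct fL] @ inv_word A' @ inv_word B' @ [Inverse fR] @ B"

lemma nth_middle: "\<sigma> ! iL = Direct \<sigma>C" "\<tau> ! jL = Direct \<tau>C" "iL < length \<sigma>" "jL < length \<tau>"
  by (simp_all add: nth_append)

lemma neighbours_nonempty: "B @ A \<noteq> []" "B' @ A' \<noteq> []"
  using closed_string_length(2)[OF sigma_closed] closed_string_length(2)[OF tau_closed] by auto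

lemma next_ne: "iR \<noteq> iL" "jR \<noteq> jL"
  using closed_string_length(2)[OF sigma_closed] closed_string_length(2)[OF tau_closed]
  by (auto simp: next_vertex_if)

lemma next_less: "iR < length \<sigma>" "jR < length \<tau>"
  by (rule next_vertex_less, simp)+

lemma right_neighbour_eq: "\<sigma> ! iR = right_neighbour A B" "\<tau> ! jR = right_neighbour A' B'"
  using neighbours_nonempty
  by (auto simp: right_neighbour_def next_vertex_if nth_append hd_append hd_conv_nth)

lemma middle_factor:
  obtains f' where "nonzero_path Q I f'" "f' \<noteq> []" "\<sigma>C = fL @ f'" "\<tau>C = f' @ fR"
  using paths by (auto simp: double_map_paths_def nonzero_path_def)

lemma component_paths:
  "nonzero_path Q I fL" "nonzero_path Q I fR" "fL \<noteq> []" "fR \<noteq> []"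
  "path_end Q fL = path_end Q \<sigma>C" "path_start Q fL = path_end Q \<tau>C"
  "path_end Q fR = path_start Q \<sigma>C" "path_start Q fR = path_start Q \<tau>C"
  "fL @ \<tau>C = \<sigma>C @ fR" "nonzero_path Q I (\<sigma>C @ fR)"
  using paths by (auto simp: double_map_paths_def nonzero_path_def)

lemma middle_nonempty: "\<sigma>C \<noteq> []" "\<tau>C \<noteq> []"
  using middle_factor component_paths by (metis append_is_Nil_conv)+

lemma hd_last_middle: "hd \<sigma>C = hd fL" "last \<tau>C = last fR"
  using middle_factor component_paths by (metis hd_append2 last_appendR)+

text \<open>
  The four new junctions of the word of the cone.  Since \<open>f\<^sub>L\<close> begins like \<open>\<sigma>\<^sub>C\<close> in written order and
  \<open>f\<^sub>R\<close> ends like \<open>\<tau>\<^sub>C\<close>, some of the cases are junctions of \<open>\<sigma>\<close> and \<open>\<tau>\<close>.  In the others two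
  letters in the same direction must meet in a relation, which the vanishing conditions of a double
  map provide, or two letters in opposite directions must have different arrows there; one of these
  lies in a relation with the next arrow of \<open>\<tau>\<^sub>C\<close> or \<open>\<sigma>\<^sub>C\<close>, the other does not because
  \<open>f\<^sub>L\<tau>\<^sub>C = \<sigma>\<^sub>Cf\<^sub>R\<close> is nonzero.
\<close>

lemma junctions:
  "letters_composable Q I (left_neighbour A B) (Direct fL)"
  "letters_composable Q I (Direct fL) (inv_letter (left_neighbour A' B'))"
  "letters_composable Q I (inv_letter (right_neighbour A' B')) (Inverse fR)"
  "letters_composable Q I (Inverse fR) (right_neighbour A B)"
proof -
  note s = closed_string_split(2,3)[OF sigma_closed neighbours_nonempty(1)]
  note t = closed_string_split(2,3)[OF tau_closed neighbours_nonempty(2)]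
  have in_\<sigma>: "nonzero_path Q I (letter_path l)" if "l \<in> set (B @ A)" for l
    using that sigma_closed by (auto simp: closed_string_def)
  have in_\<tau>: "nonzero_path Q I (letter_path l)" if "l \<in> set (B' @ A')" for l
    using that tau_closed by (auto simp: closed_string_def)
  have nz: "nonzero_path Q I (letter_path (right_neighbour A B))"
    "nonzero_path Q I (letter_path (left_neighbour A' B'))"
    "nonzero_path Q I (letter_path (right_neighbour A' B'))"
    unfolding left_neighbour_def right_neighbour_def
    by (rule in_\<sigma>[OF hd_in_set[OF neighbours_nonempty(1)]]
        in_\<tau>[OF last_in_set[OF neighbours_nonempty(2)]] in_\<tau>[OF hd_in_set[OF neighbours_nonempty(2)]])+
  have vanish: "left_neighbour A' B' = Inverse p \<Longrightarrow> \<not> nonzero_path Q I (fL @ p)"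
    "right_neighbour A B = Inverse p \<Longrightarrow> \<not> nonzero_path Q I (p @ fR)"
    "right_neighbour A' B' = Direct p \<Longrightarrow> \<not> nonzero_path Q I (fR @ p)" for p
    using paths by (simp_all add: double_map_paths_def)
  have nI: "(last fL, hd \<tau>C) \<notin> I" "(last \<sigma>C, hd fR) \<notin> I"
    using component_paths(9,10) nonzero_path_append[OF component_paths(3) middle_nonempty(2), of Q I]
      nonzero_path_append[OF middle_nonempty(1) component_paths(4), of Q I]
    by metis+
  note simps = letters_composable_def component_paths(5-8) hd_last_middle
  show "letters_composable Q I (left_neighbour A B) (Direct fL)"
    using s(2) unfolding left_neighbour_def[symmetric]
    by (cases "left_neighbour A B") (simp_all add: simps)
  show "letters_composable Q I (Direct fL) (inv_letter (left_neighbour A' B'))"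
  proof (cases "left_neighbour A' B'")
    case (Direct p)
    then show ?thesis using t(2) nI(1) unfolding left_neighbour_def[symmetric] by (auto simp: simps)
  next
    case (Inverse p)
    moreover have "path_start Q fL = path_end Q p"
      using t(2) Inverse unfolding left_neighbour_def[symmetric] by (simp add: simps)
    ultimately show ?thesis
      using relation_if_product_zero[OF component_paths(1) _ vanish(1)] nz(2) by (simp add: letters_composable_def)
  qed
  show "letters_composable Q I (inv_letter (right_neighbour A' B')) (Inverse fR)"
  proof (cases "right_neighbour A' B'")
    case (Inverse p)
    then show ?thesis using t(1) unfolding right_neighbour_def[symmetric] by (auto simp: simps)
  next
    case (Direct p)
    moreover have "path_start Q fR = path_end Q p"
      using t(1) Direct unfolding right_neighbour_def[symmetric] by (simp add: simps)
    ultimately show ?thesis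
      using relation_if_product_zero[OF component_paths(2) _ vanish(3)] nz(3) by (simp add: letters_composable_def)
  qed
  show "letters_composable Q I (Inverse fR) (right_neighbour A B)"
  proof (cases "right_neighbour A B")
    case (Direct p)
    then show ?thesis using s(1) nI(2) unfolding right_neighbour_def[symmetric] by (auto simp: simps)
  next
    case (Inverse p)
    moreover have "path_start Q p = path_end Q fR"
      using s(1) Inverse unfolding right_neighbour_def[symmetric] by (simp add: simps)
    ultimately show ?thesis
      using relation_if_product_zero[OF _ component_paths(2) vanish(2)] nz(1) by (simp add: letters_composable_def)
  qed
qed

text \<open>
  Up to rotation the word alternates between \<open>BA\<close> and the inverse of \<open>B'A'\<close> framed by \<open>f\<^sub>L\<close> and \<open>f\<^sub>R\<close>,
  so its square is a subword of a longer alternating word.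
\<close>

lemma cone_word_closed: "closed_string Q I cone_word"
proof -
  let ?R = "letters_composable Q I"
  let ?X = "B @ A" and ?V = "inv_word (B' @ A')"
  let ?Z = "[Direct fL] @ ?V @ [Inverse fR]"
  have V: "?V \<noteq> []" "hd ?V = inv_letter (left_neighbour A' B')" "last ?V = inv_letter (right_neighbour A' B')"
    using neighbours_nonempty(2)
    by (simp_all add: inv_word_def left_neighbour_def right_neighbour_def hd_rev last_rev last_map hd_map
        del: rev_append map_append)
  have sV: "successively ?R ?V"
    using closed_string_split(1)[OF tau_closed neighbours_nonempty(2)] by (simp add: successively_inv_word)
  have Z: "successively ?R ?Z"
    using V sV junctions(2,3) by (simp only: successively_enclosed[OF V(1)] simp_thms)
  have X: "successively ?R ?X" "?X \<noteq> []"
    using closed_string_split(1)[OF sigma_closed neighbours_nonempty(1)] neighbours_nonempty by simp_all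
  have J: "?R (last ?X) (hd ?Z)" "?R (last ?Z) (hd ?X)"
    using junctions(1,4) by (simp_all add: left_neighbour_def right_neighbour_def)
  have "successively ?R (?X @ ?Z @ ?X @ ?Z @ ?X)"
    using X Z J by (intro successively_alternating) auto
  moreover have "?X @ ?Z @ ?X @ ?Z @ ?X = B @ (cone_word @ cone_word) @ A"
    by (simp add: cone_word_def inv_word_append)
  ultimately have "successively ?R (cone_word @ cone_word)"
    by (simp only: successively_append_iff)
  moreover have "\<forall>l\<in>set cone_word. nonzero_path Q I (letter_path l)"
    using sigma_closed tau_closed component_paths by (auto simp: closed_string_def cone_word_def inv_word_def)
  moreover have "length (filter is_direct cone_word) = length (filter (Not \<circ> is_direct) cone_word)"
    using sigma_closed tau_closed by (simp add: closed_string_def cone_word_def length_filter_inv_word)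
  ultimately show ?thesis by (simp add: closed_string_def cone_word_def)
qed

end

datatype cone_edge = Source_Letter nat | Target_Letter nat | Left_Component | Right_Component

locale double_map_cone = double_map_words Q I A B A' B' \<sigma>C \<tau>C fL fR
  for Q :: "('v, 'a) pre_digraph" and I and A B A' B' :: "'a letter list" and \<sigma>C \<tau>C fL fR +
  fixes d d' :: int and c c' :: "nat \<Rightarrow> 'k::field" and a b :: 'k
    and f :: "int \<Rightarrow> (nat \<Rightarrow> ('v, 'a) path \<Rightarrow> 'k) \<Rightarrow> (nat \<Rightarrow> ('v, 'a) path \<Rightarrow> 'k)"
  assumes degrees: "vertex_degree \<sigma> d iL = vertex_degree \<tau> d' jL"
    and component_scalars: "a \<noteq> 0" "b \<noteq> 0"
    and chain_map: "cochain_map Q I (diagram_complex Q I (word_diagram Q \<sigma> d c))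
      (diagram_complex Q I (word_diagram Q \<tau> d' c')) f"
    and components: "\<And>n u. u \<in> mcarrier (obj (diagram_complex Q I (word_diagram Q \<sigma> d c)) n) \<Longrightarrow>
      f n u = (\<lambda>j. if j = jL then path_map Q I a fL (u iL)
                   else if j = jR then path_map Q I b fR (u iR) else 0)"
begin

(* Keeps the words in the form in which they are decomposed. *)
declare append.simps [simp del]

abbreviation D\<sigma> where "D\<sigma> \<equiv> word_diagram Q \<sigma> d c"
abbreviation D\<tau> where "D\<tau> \<equiv> word_diagram Q \<tau> d' c'"
abbreviation X where "X \<equiv> diagram_complex Q I D\<sigma>"
abbreviation Y where "Y \<equiv> diagram_complex Q I D\<tau>"

text \<open>
  The complex \<open>\<Sigma>X \<oplus> Y\<close> has the vertices of both words, those of \<open>\<sigma>\<close> tagged by \<open>0\<close> and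
  those of \<open>\<tau>\<close> by \<open>1\<close> as in the cone.  The letters of \<open>\<tau>\<close> are inverted because the word of
  the cone runs through \<open>\<tau>\<close> backwards, and so is \<open>fR\<close>.
\<close>

definition cone_diagram :: "(nat \<times> nat, cone_edge, 'v, 'a, 'k) diagram" where
  "cone_diagram = \<lparr>
     vertices = Pair 0 ` {..<length \<sigma>} \<union> Pair 1 ` {..<length \<tau>},
     place = (\<lambda>(x, i). if x = 0 then letter_end Q (\<sigma> ! i) else letter_end Q (\<tau> ! i)),
     vdeg = (\<lambda>(x, i). if x = 0 then vertex_degree \<sigma> d i - 1 else vertex_degree \<tau> d' i),
     edges = Source_Letter ` {..<length \<sigma>} \<union> Target_Letter ` {..<length \<tau>} \<union>
       {Left_Component, Right_Component},
     left_end = (\<lambda>e. case e of Source_Letter i \<Rightarrow> (0, i) | Target_Letter j \<Rightarrow> (1, next_vertex \<tau> j)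
       | Left_Component \<Rightarrow> (0, iL) | Right_Component \<Rightarrow> (1, jR)),
     right_end = (\<lambda>e. case e of Source_Letter i \<Rightarrow> (0, next_vertex \<sigma> i) | Target_Letter j \<Rightarrow> (1, j)
       | Left_Component \<Rightarrow> (1, jL) | Right_Component \<Rightarrow> (0, iR)),
     label = (\<lambda>e. case e of Source_Letter i \<Rightarrow> \<sigma> ! i | Target_Letter j \<Rightarrow> inv_letter (\<tau> ! j)
       | Left_Component \<Rightarrow> Direct fL | Right_Component \<Rightarrow> Inverse fR),
     weight = (\<lambda>e. case e of Source_Letter i \<Rightarrow> - c i | Target_Letter j \<Rightarrow> c' j
       | Left_Component \<Rightarrow> a | Right_Component \<Rightarrow> b)\<rparr>"

lemma cone_diagram_simps:
  "vertices cone_diagram = Pair 0 ` {..<length \<sigma>} \<union> Pair 1 ` {..<length \<tau>}"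
  "place cone_diagram (0, i) = letter_end Q (\<sigma> ! i)"
  "place cone_diagram (1, j) = letter_end Q (\<tau> ! j)"
  "vdeg cone_diagram (0, i) = vertex_degree \<sigma> d i - 1"
  "vdeg cone_diagram (1, j) = vertex_degree \<tau> d' j"
  "edges cone_diagram = Source_Letter ` {..<length \<sigma>} \<union> Target_Letter ` {..<length \<tau>} \<union>
       {Left_Component, Right_Component}"
  "left_end cone_diagram (Source_Letter i) = (0, i)"
  "left_end cone_diagram (Target_Letter j) = (1, next_vertex \<tau> j)"
  "left_end cone_diagram Left_Component = (0, iL)"
  "left_end cone_diagram Right_Component = (1, jR)"
  "right_end cone_diagram (Source_Letter i) = (0, next_vertex \<sigma> i)"
  "right_end cone_diagram (Target_Letter j) = (1, j)"
  "right_end cone_diagram Left_Component = (1, jL)"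
  "right_end cone_diagram Right_Component = (0, iR)"
  "label cone_diagram (Source_Letter i) = \<sigma> ! i"
  "label cone_diagram (Target_Letter j) = inv_letter (\<tau> ! j)"
  "label cone_diagram Left_Component = Direct fL"
  "label cone_diagram Right_Component = Inverse fR"
  "weight cone_diagram (Source_Letter i) = - c i"
  "weight cone_diagram (Target_Letter j) = c' j"
  "weight cone_diagram Left_Component = a"
  "weight cone_diagram Right_Component = b"
  by (simp_all add: cone_diagram_def)

lemmas cone_diagram_tag_1 [simp] = cone_diagram_simps(3,5)[unfolded One_nat_def]

lemma cone_source_target:
  "source cone_diagram (Source_Letter i) = (0, source D\<sigma> i)"
  "target cone_diagram (Source_Letter i) = (0, target D\<sigma> i)"
  "source cone_diagram (Target_Letter j) = (1, source D\<tau> j)"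
  "target cone_diagram (Target_Letter j) = (1, target D\<tau> j)"
  "source cone_diagram Left_Component = (0, iL)"
  "target cone_diagram Left_Component = (1, jL)"
  "source cone_diagram Right_Component = (0, iR)"
  "target cone_diagram Right_Component = (1, jR)"
  by (simp_all add: source_def target_def cone_diagram_simps)

lemma cone_edge_path:
  "edge_path cone_diagram (Source_Letter i) = edge_path D\<sigma> i"
  "edge_path cone_diagram (Target_Letter j) = edge_path D\<tau> j"
  "edge_path cone_diagram Left_Component = fL"
  "edge_path cone_diagram Right_Component = fR"
  by (simp_all add: edge_path_def cone_diagram_simps)

lemma middle_edges:
  "source D\<sigma> iL = iL" "target D\<sigma> iL = iR"
  "source D\<tau> jL = jL" "target D\<tau> jL = jR"
  "edge_path D\<sigma> iL = \<sigma>C" "edge_path D\<tau> jL = \<tau>C"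
  using nth_middle by (simp_all add: source_def target_def edge_path_def)

lemma middle_ends:
  "letter_end Q (\<sigma> ! iL) = path_end Q \<sigma>C" "letter_end Q (\<sigma> ! iR) = path_start Q \<sigma>C"
  "letter_end Q (\<tau> ! jL) = path_end Q \<tau>C" "letter_end Q (\<tau> ! jR) = path_start Q \<tau>C"
  "vertex_degree \<sigma> d iR = vertex_degree \<sigma> d iL + 1" "vertex_degree \<tau> d' jR = vertex_degree \<tau> d' jL + 1"
proof -
  show "letter_end Q (\<sigma> ! iL) = path_end Q \<sigma>C" "letter_end Q (\<tau> ! jL) = path_end Q \<tau>C"
    unfolding nth_middle by simp_all
  show "letter_end Q (\<sigma> ! iR) = path_start Q \<sigma>C" "letter_end Q (\<tau> ! jR) = path_start Q \<tau>C"
    using closed_string_composable[OF sigma_closed nth_middle(3)]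
      closed_string_composable[OF tau_closed nth_middle(4)]
    unfolding nth_middle letters_composable_def by simp_all
  show "vertex_degree \<sigma> d iR = vertex_degree \<sigma> d iL + 1" "vertex_degree \<tau> d' jR = vertex_degree \<tau> d' jL + 1"
    using closed_string_vertex_degree[OF sigma_closed nth_middle(3), of d]
      closed_string_vertex_degree[OF tau_closed nth_middle(4), of d']
    unfolding nth_middle by simp_all
qed

lemma wf_cone_diagram: "wf_diagram Q I cone_diagram"
proof -
  let ?S = D\<sigma> and ?T = D\<tau>
  have S: "wf_diagram Q I ?S" and T: "wf_diagram Q I ?T"
    by (rule wf_word_diagram[OF sigma_closed] wf_word_diagram[OF tau_closed])+
  have verts: "place cone_diagram ` vertices cone_diagram \<subseteq> verts Q"
    using S T by (auto simp: cone_diagram_simps wf_diagram_def)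
  have edge: "left_end cone_diagram e \<in> vertices cone_diagram \<and> right_end cone_diagram e \<in> vertices cone_diagram \<and>
        nonzero_path Q I (edge_path cone_diagram e) \<and>
        place cone_diagram (left_end cone_diagram e) = letter_end Q (label cone_diagram e) \<and>
        place cone_diagram (right_end cone_diagram e) = letter_start Q (label cone_diagram e) \<and>
        vdeg cone_diagram (right_end cone_diagram e) =
          vdeg cone_diagram (left_end cone_diagram e) + (if is_direct (label cone_diagram e) then 1 else - 1)"
    if e: "e \<in> edges cone_diagram" for e
  proof (cases e)
    case (Source_Letter i)
    then have "i \<in> edges ?S" using e by (auto simp: cone_diagram_simps)
    then have "left_end ?S i \<in> vertices ?S \<and> right_end ?S i \<in> vertices ?S \<and>
        nonzero_path Q I (edge_path ?S i) \<and>
        place ?S (left_end ?S i) = letter_end Q (label ?S i) \<and>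
        place ?S (right_end ?S i) = letter_start Q (label ?S i) \<and>
        vdeg ?S (right_end ?S i) = vdeg ?S (left_end ?S i) + (if is_direct (label ?S i) then 1 else - 1)"
      using S unfolding wf_diagram_def by blast
    then show ?thesis
      unfolding Source_Letter cone_diagram_simps cone_edge_path word_diagram_simps by auto
  next
    case (Target_Letter j)
    then have "j \<in> edges ?T" using e by (auto simp: cone_diagram_simps)
    then have "left_end ?T j \<in> vertices ?T \<and> right_end ?T j \<in> vertices ?T \<and>
        nonzero_path Q I (edge_path ?T j) \<and>
        place ?T (left_end ?T j) = letter_end Q (label ?T j) \<and>
        place ?T (right_end ?T j) = letter_start Q (label ?T j) \<and>
        vdeg ?T (right_end ?T j) = vdeg ?T (left_end ?T j) + (if is_direct (label ?T j) then 1 else - 1)"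
      using T unfolding wf_diagram_def by blast
    then show ?thesis
      unfolding Target_Letter cone_diagram_simps cone_edge_path word_diagram_simps by auto
  next
    case Left_Component
    then show ?thesis
      unfolding Left_Component cone_diagram_simps cone_edge_path middle_ends
      using nth_middle(3,4) component_paths degrees by auto
  next
    case Right_Component
    then show ?thesis
      unfolding Right_Component cone_diagram_simps cone_edge_path middle_ends
      using next_less component_paths degrees by auto
  qed
  show ?thesis
    unfolding wf_diagram_def using verts edge by (auto simp: cone_diagram_simps(1,6))
qed

lemma sum_cone_edges:
  fixes F :: "cone_edge \<Rightarrow> 'm::comm_monoid_add"
  shows "(\<Sum>e\<in>edges cone_diagram. F e) = (\<Sum>i<length \<sigma>. F (Source_Letter i)) +
    (\<Sum>j<length \<tau>. F (Target_Letter j)) + (F Left_Component + F Right_Component)"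
proof -
  have "(\<Sum>e\<in>edges cone_diagram. F e) = (\<Sum>e\<in>Source_Letter ` {..<length \<sigma>} \<union> Target_Letter ` {..<length \<tau>}. F e) +
      (\<Sum>e\<in>{Left_Component, Right_Component}. F e)"
    unfolding cone_diagram_simps by (rule sum.union_disjoint) auto
  also have "(\<Sum>e\<in>Source_Letter ` {..<length \<sigma>} \<union> Target_Letter ` {..<length \<tau>}. F e) =
      (\<Sum>e\<in>Source_Letter ` {..<length \<sigma>}. F e) + (\<Sum>e\<in>Target_Letter ` {..<length \<tau>}. F e)"
    by (rule sum.union_disjoint) auto
  also have "(\<Sum>e\<in>Source_Letter ` {..<length \<sigma>}. F e) = (\<Sum>i<length \<sigma>. F (Source_Letter i))"
    by (subst sum.reindex) (auto simp: inj_on_def)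
  also have "(\<Sum>e\<in>Target_Letter ` {..<length \<tau>}. F e) = (\<Sum>j<length \<tau>. F (Target_Letter j))"
    by (subst sum.reindex) (auto simp: inj_on_def)
  finally show ?thesis by simp
qed

lemma cone_carrier:
  "u \<in> mcarrier (obj (mapping_cone X Y f) n) \<longleftrightarrow>
    u 0 \<in> mcarrier (obj X (n + 1)) \<and> u 1 \<in> mcarrier (obj Y n) \<and> (\<forall>x. x \<noteq> 0 \<and> x \<noteq> 1 \<longrightarrow> u x = 0)"
  by (auto simp: mapping_cone_def module_dsum_carrier)

lemma cone_diagram_carrier:
  "v \<in> mcarrier (obj (diagram_complex Q I cone_diagram) n) \<longleftrightarrow>
    (\<lambda>i. v (0, i)) \<in> mcarrier (obj X (n + 1)) \<and> (\<lambda>j. v (1, j)) \<in> mcarrier (obj Y n) \<and>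
    (\<forall>x i. x \<noteq> 0 \<and> x \<noteq> 1 \<longrightarrow> v (x, i) = 0)"
  (is "?L \<longleftrightarrow> ?R")
proof
  assume L: ?L
  then have v: "p \<in> vertices cone_diagram \<Longrightarrow> vdeg cone_diagram p = n \<Longrightarrow> v p \<in> mcarrier (proj Q I (place cone_diagram p))"
    "\<not> (p \<in> vertices cone_diagram \<and> vdeg cone_diagram p = n) \<Longrightarrow> v p = 0" for p
    by (simp_all add: diagram_complex_def dsum_proj_carrier del: split_paired_All)
  show ?R
  proof (intro conjI allI impI)
    show "(\<lambda>i. v (0, i)) \<in> mcarrier (obj X (n + 1))"
      using v[of "(0, _)"] by (auto simp: diagram_complex_def dsum_proj_carrier cone_diagram_simps)
    show "(\<lambda>j. v (1, j)) \<in> mcarrier (obj Y n)"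
      using v[of "(1, _)"] unfolding cone_diagram_simps by (auto simp: diagram_complex_def dsum_proj_carrier)
    fix x i assume "x \<noteq> 0 \<and> x \<noteq> (1 :: nat)"
    then show "v (x, i) = 0" by (intro v(2)) (auto simp: cone_diagram_simps)
  qed
next
  assume R: ?R
  have *: "(if p \<in> vertices cone_diagram \<and> vdeg cone_diagram p = n
      then v p \<in> mcarrier (proj Q I (place cone_diagram p)) else v p = 0)" for p
  proof -
    obtain x i where p: "p = (x, i)" by (cases p)
    consider "x = 0" | "x = 1" | "x \<noteq> 0 \<and> x \<noteq> 1" by blast
    then show ?thesis
    proof cases
      case 1
      then show ?thesis using R unfolding p by (auto simp: diagram_complex_def dsum_proj_carrier cone_diagram_simps)
    next
      case 2
      then show ?thesis using R unfolding p 2 cone_diagram_simps by (auto simp: diagram_complex_def dsum_proj_carrier)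
    next
      case 3
      then show ?thesis using R unfolding p by (auto simp: cone_diagram_simps)
    qed
  qed
  show ?L
    unfolding diagram_complex_def cpx.simps dsum_proj_carrier mem_Collect_eq
  proof (intro conjI ballI allI impI)
    fix p assume "p \<in> {p \<in> vertices cone_diagram. vdeg cone_diagram p = n}"
    then show "v p \<in> mcarrier (proj Q I (place cone_diagram p))" using *[of p] by simp
  next
    fix p assume "\<not> (p \<in> vertices cone_diagram \<and> vdeg cone_diagram p = n)"
    then show "v p = 0" using *[of p] by (simp only: if_False)
  qed
qed

lemma cone_isomorphic_cone_diagram:
  "isomorphic_complexes Q I (mapping_cone X Y f) (diagram_complex Q I cone_diagram)"
proof -
  let ?C = "mapping_cone X Y f" and ?D = "diagram_complex Q I cone_diagram"
  define \<phi> :: "(nat \<Rightarrow> nat \<Rightarrow> ('v, 'a) path \<Rightarrow> 'k) \<Rightarrow> nat \<times> nat \<Rightarrow> ('v, 'a) path \<Rightarrow> 'k" where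
    "\<phi> u = (\<lambda>(x, i). u x i)" for u
  define \<psi> :: "(nat \<times> nat \<Rightarrow> ('v, 'a) path \<Rightarrow> 'k) \<Rightarrow> nat \<Rightarrow> nat \<Rightarrow> ('v, 'a) path \<Rightarrow> 'k" where
    "\<psi> v = (\<lambda>x i. v (x, i))" for v
  have bounded: "bounded_complex Q I ?C"
    by (rule bounded_complex_mapping_cone[OF bounded_complex_word_diagram[OF sigma_closed]
          bounded_complex_word_diagram[OF tau_closed] chain_map])
  have carr: "\<phi> u \<in> mcarrier (obj ?D n) \<longleftrightarrow> u \<in> mcarrier (obj ?C n)" for u n
    unfolding cone_diagram_carrier cone_carrier by (auto simp: \<phi>_def fun_eq_iff)
  have inv: "\<psi> (\<phi> u) = u" "\<phi> (\<psi> v) = v" for u v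
    by (auto simp: \<phi>_def \<psi>_def)
  have act: "act (obj ?C n) s u = (\<lambda>x i. alg_mult Q I s (u x i))"
    if u: "u \<in> mcarrier (obj ?C n)" for u n and s :: "('v, 'a) path \<Rightarrow> 'k"
  proof (rule ext)
    fix x
    have ux: "u 0 \<in> mcarrier (obj X (n + 1))" "u 1 \<in> mcarrier (obj Y n)" "x \<noteq> 0 \<Longrightarrow> x \<noteq> 1 \<Longrightarrow> u x = 0"
      using u by (simp_all add: cone_carrier)
    have "act (obj X (n + 1)) s (u 0) = (\<lambda>i. alg_mult Q I s (u 0 i))"
      "act (obj Y n) s (u 1) = (\<lambda>i. alg_mult Q I s (u 1 i))"
      by (rule diagram_complex_act[OF ux(1)] diagram_complex_act[OF ux(2)])+
    then show "act (obj ?C n) s u x = (\<lambda>i. alg_mult Q I s (u x i))"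
      using ux(3) by (cases "x = 0 \<or> x = 1") (auto simp: mapping_cone_def module_dsum_act)
  qed
  note actD = diagram_complex_act[where D=cone_diagram]
  have comm: "\<phi> (diff ?C n u) = diff ?D n (\<phi> u)" if u: "u \<in> mcarrier (obj ?C n)" for n u
  proof (rule ext, clarify)
    fix x i
    have fu: "f (n + 1) (u 0) i = (if jL = i then path_map Q I a fL (u 0 iL) else 0) +
        (if jR = i then path_map Q I b fR (u 0 iR) else 0)"
      using components[of "u 0" "n + 1"] u next_ne by (auto simp: cone_carrier)
    have D: "diff ?D n (\<phi> u) (x, i) = (\<Sum>i'<length \<sigma>. if 0 = x \<and> target D\<sigma> i' = i
          then path_map Q I (- c i') (edge_path D\<sigma> i') (u 0 (source D\<sigma> i')) else 0) +
        (\<Sum>j<length \<tau>. if 1 = x \<and> target D\<tau> j = i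
          then path_map Q I (c' j) (edge_path D\<tau> j) (u 1 (source D\<tau> j)) else 0) +
        ((if 1 = x \<and> jL = i then path_map Q I a fL (u 0 iL) else 0) +
         (if 1 = x \<and> jR = i then path_map Q I b fR (u 0 iR) else 0))"
      unfolding diagram_complex_def cpx.simps sum_cone_edges
      unfolding cone_source_target cone_edge_path cone_diagram_simps \<phi>_def prod.case prod.inject
      by (rule refl)
    have X: "- diff X (n + 1) (u 0) i = (\<Sum>i'<length \<sigma>. if target D\<sigma> i' = i
          then path_map Q I (- c i') (edge_path D\<sigma> i') (u 0 (source D\<sigma> i')) else 0)"
      unfolding diagram_complex_def cpx.simps word_diagram_simps sum_negf[symmetric]
      by (rule sum.cong) (auto simp: path_map_uminus)
    have Y: "diff Y n (u 1) i = (\<Sum>j<length \<tau>. if target D\<tau> j = i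
          then path_map Q I (c' j) (edge_path D\<tau> j) (u 1 (source D\<tau> j)) else 0)"
      unfolding diagram_complex_def cpx.simps word_diagram_simps ..
    consider "x = 0" | "x = 1" | "x \<noteq> 0 \<and> x \<noteq> 1" by blast
    then show "\<phi> (diff ?C n u) (x, i) = diff ?D n (\<phi> u) (x, i)"
    proof cases
      case 1
      then have "\<phi> (diff ?C n u) (x, i) = - diff X (n + 1) (u 0) i"
        by (simp add: \<phi>_def mapping_cone_def)
      then show ?thesis unfolding D X using 1 by simp
    next
      case 2
      then have "\<phi> (diff ?C n u) (x, i) = f (n + 1) (u 0) i + diff Y n (u 1) i"
        by (simp add: \<phi>_def mapping_cone_def)
      then show ?thesis unfolding D Y fu using 2 by (simp add: add.commute)
    next
      case 3
      then show ?thesis unfolding D by (simp add: \<phi>_def mapping_cone_def)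
    qed
  qed
  have "\<phi> \<in> module_hom Q I (obj ?C n) (obj ?D n)" for n
    unfolding module_hom_def using carr act actD[OF iffD2[OF carr]] by (auto simp: \<phi>_def fun_eq_iff)
  moreover have "\<psi> \<in> module_hom Q I (obj ?D n) (obj ?C n)" for n
  proof -
    have carr': "\<psi> v \<in> mcarrier (obj ?C n)" if "v \<in> mcarrier (obj ?D n)" for v
      using that carr[of "\<psi> v" n] inv(2) by simp
    then show ?thesis
      unfolding module_hom_def using act[OF carr'] actD by (auto simp: \<psi>_def fun_eq_iff)
  qed
  moreover have "diff ?C n u \<in> mcarrier (obj ?C (n + 1))" if "u \<in> mcarrier (obj ?C n)" for n u
  proof -
    have "diff ?C n \<in> module_hom Q I (obj ?C n) (obj ?C (n + 1))"
      using bounded by (simp add: bounded_complex_def)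
    then show ?thesis by (rule module_homD(1)) (rule that)
  qed
  ultimately show ?thesis
    using comm inv by (intro isomorphic_complexesI[where \<phi>="\<lambda>_. \<phi>" and \<psi>="\<lambda>_. \<psi>"])
      (auto simp: cochain_map_def)
qed

text \<open>
  The other edges at the corners of the square are neighbours of \<open>\<sigma>\<^sub>C\<close> or \<open>\<tau>\<^sub>C\<close>.  Their
  products with the sides of the square or with \<open>f'\<close> vanish by the string conditions on the bands
  or by the conditions on a double map.
\<close>

lemma source_into_iR:
  assumes "i < length \<sigma>" "target D\<sigma> i = iR" "i \<noteq> iL"
  shows "\<not> nonzero_path Q I (edge_path D\<sigma> i @ fR)"
proof (cases "\<sigma> ! i")
  case (Direct p)
  then have "next_vertex \<sigma> i = iR" using assms(2) by (simp add: target_def)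
  then show ?thesis using assms nth_middle(3) by (simp add: next_vertex_eq_iff)
next
  case (Inverse p)
  then have "right_neighbour A B = Inverse p"
    using assms(2) right_neighbour_eq(1) by (simp add: target_def)
  then show ?thesis using paths Inverse by (simp add: double_map_paths_def edge_path_def)
qed

lemma source_out_of_iR:
  assumes "i < length \<sigma>" "source D\<sigma> i = iR"
  shows "(last \<sigma>C, hd (edge_path D\<sigma> i)) \<in> I"
proof (cases "\<sigma> ! i")
  case (Direct p)
  then have "i = iR" using assms(2) by (simp add: source_def)
  then show ?thesis
    using closed_string_composable[OF sigma_closed nth_middle(3)] Direct
    unfolding nth_middle by (simp add: letters_composable_def edge_path_def)
next
  case (Inverse p)
  then have "next_vertex \<sigma> i = iR" using assms(2) by (simp add: source_def)
  then have "i = iL" using assms nth_middle(3) by (simp add: next_vertex_eq_iff)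
  then show ?thesis using Inverse nth_middle(1) by simp
qed

lemma target_into_jL:
  assumes "j < length \<tau>" "target D\<tau> j = jL"
  shows "(last (edge_path D\<tau> j), hd \<tau>C) \<in> I"
proof (cases "\<tau> ! j")
  case (Direct p)
  then have "next_vertex \<tau> j = jL" using assms(2) by (simp add: target_def)
  then show ?thesis
    using closed_string_composable[OF tau_closed assms(1)] Direct nth_middle(2)
    by (simp add: letters_composable_def edge_path_def)
next
  case (Inverse p)
  then have "j = jL" using assms(2) by (simp add: target_def)
  then show ?thesis using Inverse nth_middle(2) by simp
qed

lemma target_into_jR:
  assumes "j < length \<tau>" "target D\<tau> j = jR" "j \<noteq> jL"
    "source D\<tau> j = jL"
  shows "\<not> nonzero_path Q I (fL @ edge_path D\<tau> j)"
proof (cases "\<tau> ! j")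
  case (Direct p)
  then have "next_vertex \<tau> j = jR" using assms(2) by (simp add: target_def)
  then show ?thesis using assms nth_middle(4) by (simp add: next_vertex_eq_iff)
next
  case (Inverse p)
  then have "next_vertex \<tau> j = jL" using assms(4) by (simp add: source_def)
  then have "left_neighbour A' B' = Inverse p"
    using left_neighbour_eq[OF assms(1) _ neighbours_nonempty(2)] Inverse by simp
  then show ?thesis using paths Inverse by (simp add: double_map_paths_def edge_path_def)
qed

text \<open>
  Evaluating the chain map condition at the trivial path at the left end of \<open>\<sigma>\<^sub>C\<close> compares the
  two ways around the square; neighbouring letters contribute nothing.
\<close>

lemma square_scalars: "c iL * b = a * c' jL"
proof -
  let ?S = D\<sigma> and ?T = D\<tau>
  have S: "wf_diagram Q I ?S" and T: "wf_diagram Q I ?T"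
    by (rule wf_word_diagram[OF sigma_closed] wf_word_diagram[OF tau_closed])+
  define n where "n = vertex_degree \<sigma> d iL"
  define x where "x = path_end Q \<sigma>C"
  define e where "e = (basis_elt ([], x) :: ('v, 'a) path \<Rightarrow> 'k)"
  define u where "u = (\<lambda>i. if i = iL then e else 0)"
  have "nonzero_path Q I \<sigma>C"
    using closed_string_nonzero[OF sigma_closed nth_middle(3)] unfolding nth_middle by simp
  then have "x \<in> verts Q" unfolding x_def by (rule nonzero_path_ends)
  then have "e \<in> mcarrier (proj Q I x)"
    by (auto simp: e_def mcarrier_proj basis_elt_def path_basis_def split: if_splits)
  then have u: "u \<in> mcarrier (obj X n)"
    using nth_middle(3) by (auto simp: diagram_complex_def dsum_proj_carrier u_def n_def x_def middle_ends)
  have left: "f (n + 1) (diff X n u) jR = path_map Q I (c iL * b) (\<sigma>C @ fR) e"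
  proof -
    have fin: "finite {i \<in> edges ?S. target ?S i = iR}" by simp
    have "f (n + 1) (diff X n u) jR = path_map Q I b fR (diff X n u iR)"
      using components[OF diagram_diff_carrier[OF S u]] next_ne by simp
    also have "diff X n u iR = (\<Sum>i\<in>{i \<in> edges ?S. target ?S i = iR}.
        path_map Q I (c i) (edge_path ?S i) (u (source ?S i)))"
      by (subst diagram_diff) simp_all
    also have "path_map Q I b fR \<dots> = (\<Sum>i\<in>{i \<in> edges ?S. target ?S i = iR}.
        path_map Q I b fR (path_map Q I (c i) (edge_path ?S i) (u (source ?S i))))"
      by (rule path_map_sum)
    also have "\<dots> = (\<Sum>i\<in>{iL}. path_map Q I b fR (path_map Q I (c i) (edge_path ?S i) (u (source ?S i))))"
    proof (rule sum.mono_neutral_right[OF fin])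
      show "\<forall>i\<in>{i \<in> edges ?S. target ?S i = iR} - {iL}.
          path_map Q I b fR (path_map Q I (c i) (edge_path ?S i) (u (source ?S i))) = 0"
        using source_into_iR wf_diagram_edge(4)[OF S] component_paths(4) by (simp add: path_map_comp)
    qed (use nth_middle(3) middle_edges(2) in simp)
    also have "\<dots> = path_map Q I (c iL * b) (\<sigma>C @ fR) e"
      using component_paths middle_nonempty by (simp add: middle_edges u_def path_map_comp)
    finally show ?thesis .
  qed
  have fu: "f n u = (\<lambda>j. if j = jL then path_map Q I a fL e else 0)"
    unfolding components[OF u] using next_ne by (auto simp: u_def)
  have right: "diff Y n (f n u) jR = path_map Q I (a * c' jL) (fL @ \<tau>C) e"
  proof -
    have fin: "finite {j \<in> edges ?T. target ?T j = jR}" by simp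
    have "diff Y n (f n u) jR = (\<Sum>j\<in>{j \<in> edges ?T. target ?T j = jR}.
        path_map Q I (c' j) (edge_path ?T j) (f n u (source ?T j)))"
      by (subst diagram_diff) simp_all
    also have "\<dots> = (\<Sum>j\<in>{jL}. path_map Q I (c' j) (edge_path ?T j) (f n u (source ?T j)))"
    proof (rule sum.mono_neutral_right[OF fin])
      show "\<forall>j\<in>{j \<in> edges ?T. target ?T j = jR} - {jL}.
          path_map Q I (c' j) (edge_path ?T j) (f n u (source ?T j)) = 0"
        using target_into_jR wf_diagram_edge(4)[OF T] component_paths(3) by (auto simp: path_map_comp fu)
    qed (use nth_middle(4) middle_edges(4) in simp)
    also have "\<dots> = path_map Q I (a * c' jL) (fL @ \<tau>C) e"
      using component_paths middle_nonempty by (simp add: middle_edges fu path_map_comp)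
    finally show ?thesis .
  qed
  have "f (n + 1) (diff X n u) = diff Y n (f n u)"
    using chain_map u by (simp add: cochain_map_def)
  then have eq: "path_map Q I (c iL * b) (\<sigma>C @ fR) e = path_map Q I (a * c' jL) (\<sigma>C @ fR) e"
    using left right component_paths(9) by simp
  have "e = basis_elt ([], path_end Q (\<sigma>C @ fR))"
    by (simp add: e_def x_def path_end_append[OF middle_nonempty(1)])
  then have val: "path_map Q I s (\<sigma>C @ fR) e (\<sigma>C @ fR, path_start Q (\<sigma>C @ fR)) = s" for s
    using path_map_trivial_path[OF component_paths(10)] by (simp only:)
  show ?thesis
    using val[of "c iL * b"] val[of "a * c' jL"] unfolding eq by (rule trans[OF sym])
qed

text \<open>
  Here the two middle letters disappear.  The path \<open>f'\<close> leads from the left end of \<open>\<tau>\<^sub>C\<close> to the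
  right end of \<open>\<sigma>\<^sub>C\<close>, and in the cone \<open>\<sigma>\<^sub>C\<close> and \<open>\<tau>\<^sub>C\<close> are the sides of the square that
  factor through it.
\<close>

lemma cone_diagram_cancel:
  "isomorphic_complexes Q I (diagram_complex Q I cone_diagram)
    (diagram_complex Q I (cone_diagram\<lparr>edges := edges cone_diagram - {Source_Letter iL, Target_Letter jL}\<rparr>))"
proof -
  obtain f' where f': "nonzero_path Q I f'" "f' \<noteq> []" "\<sigma>C = fL @ f'" "\<tau>C = f' @ fR"
    by (rule middle_factor)
  have ends: "hd \<tau>C = hd f'" "last \<sigma>C = last f'"
    unfolding f'(3,4) using f'(2) by simp_all
  note st = cone_source_target middle_edges
  show ?thesis
  proof (rule isomorphic_complexes_cancel_square[OF wf_cone_diagram, where x=Left_Component and y=Right_Component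
        and p=f' and c="c iL / a"])
    show "Source_Letter iL \<in> edges cone_diagram" "Target_Letter jL \<in> edges cone_diagram"
      "Left_Component \<in> edges cone_diagram" "Right_Component \<in> edges cone_diagram"
      using nth_middle by (auto simp: cone_diagram_simps)
    show "edge_path cone_diagram (Source_Letter iL) = edge_path cone_diagram Left_Component @ f'"
      "edge_path cone_diagram (Target_Letter jL) = f' @ edge_path cone_diagram Right_Component"
      unfolding cone_edge_path middle_edges by (rule f')+
    show "f' \<noteq> []" by (rule f')
    show "weight cone_diagram (Source_Letter iL) = - (weight cone_diagram Left_Component * (c iL / a))"
      using component_scalars by (simp add: cone_diagram_simps)
    show "weight cone_diagram (Target_Letter jL) = c iL / a * weight cone_diagram Right_Component"
      using component_scalars square_scalars by (simp add: cone_diagram_simps field_simps)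
    show "source cone_diagram (Source_Letter iL) = source cone_diagram Left_Component"
      "target cone_diagram Left_Component = source cone_diagram (Target_Letter jL)"
      "target cone_diagram (Source_Letter iL) = source cone_diagram Right_Component"
      "target cone_diagram (Target_Letter jL) = target cone_diagram Right_Component"
      "source cone_diagram (Target_Letter jL) \<noteq> source cone_diagram Right_Component"
      by (simp_all add: st)
  next
    fix e assume e: "e \<in> edges cone_diagram"
      "target cone_diagram e = source cone_diagram (Target_Letter jL)" "e \<noteq> Left_Component"
    then obtain j where j: "e = Target_Letter j" "j < length \<tau>" "target D\<tau> j = jL"
      using next_ne by (auto simp: cone_diagram_simps st)
    have "(last (edge_path cone_diagram e), hd f') \<in> I"
      using target_into_jL[OF j(2,3)] unfolding j(1) cone_edge_path ends .
    then show "\<not> nonzero_path Q I (edge_path cone_diagram e @ f')"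
      using wf_diagram_edge(4)[OF wf_cone_diagram e(1)] f'(2) by (simp add: nonzero_path_append)
  next
    fix e assume e: "e \<in> edges cone_diagram"
      "source cone_diagram e = source cone_diagram Right_Component" "e \<noteq> Right_Component"
    then obtain i where i: "e = Source_Letter i" "i < length \<sigma>" "source D\<sigma> i = iR"
      using next_ne by (auto simp: cone_diagram_simps st)
    have "(last f', hd (edge_path cone_diagram e)) \<in> I"
      using source_out_of_iR[OF i(2,3)] unfolding i(1) cone_edge_path ends .
    then show "\<not> nonzero_path Q I (f' @ edge_path cone_diagram e)"
      using wf_diagram_edge(4)[OF wf_cone_diagram e(1)] f'(2) by (simp add: nonzero_path_append)
  qed
qed

text \<open>
  The edges left after the cancellation, in the order in which the word of the cone runs through them.
\<close>

definition cone_edges :: "cone_edge list" where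
  "cone_edges = map Source_Letter [0..<iL] @ [Left_Component] @ map Target_Letter (rev [0..<jL]) @
     map Target_Letter (rev [Suc jL..<length \<tau>]) @ [Right_Component] @ map Source_Letter [Suc iL..<length \<sigma>]"

lemma walk_source:
  "i \<le> l \<Longrightarrow> l \<le> length \<sigma> \<Longrightarrow>
    walk cone_diagram (0, i mod length \<sigma>) (map Source_Letter [i..<l]) (0, l mod length \<sigma>)"
proof (induction l)
  case (Suc l)
  then show ?case
    by (cases "i = Suc l") (auto simp: walk_append cone_diagram_simps next_vertex_def)
qed simp

lemma walk_target:
  "j \<le> l \<Longrightarrow> l \<le> length \<tau> \<Longrightarrow>
    walk cone_diagram (1, l mod length \<tau>) (map Target_Letter (rev [j..<l])) (1, j mod length \<tau>)"
proof (induction l)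
  case (Suc l)
  then show ?case
    by (cases "j = Suc l") (auto simp: walk_append append_Nil cone_diagram_simps next_vertex_def)
qed simp

lemma walk_cone_edges: "walk cone_diagram (0, 0) cone_edges (0, 0)"
proof -
  have w1: "walk cone_diagram (0, 0) (map Source_Letter [0..<iL]) (0, iL)"
    using walk_source[of 0 iL] nth_middle(3) by simp
  have w2: "walk cone_diagram (0, iL) [Left_Component] (1, jL)"
    by (simp add: cone_diagram_simps)
  have w3: "walk cone_diagram (1, jL) (map Target_Letter (rev [0..<jL])) (1, 0)"
    using walk_target[of 0 jL] nth_middle(4) by simp
  have w4: "walk cone_diagram (1, 0) (map Target_Letter (rev [Suc jL..<length \<tau>])) (1, jR)"
    using walk_target[of "Suc jL" "length \<tau>"] nth_middle(4) by (simp add: next_vertex_def)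
  have w5: "walk cone_diagram (1, jR) [Right_Component] (0, iR)"
    by (simp add: cone_diagram_simps)
  have w6: "walk cone_diagram (0, iR) (map Source_Letter [Suc iL..<length \<sigma>]) (0, 0)"
    using walk_source[of "Suc iL" "length \<sigma>"] nth_middle(3) by (simp add: next_vertex_def)
  show ?thesis
    unfolding cone_edges_def
    by (rule walk_appendI[OF w1 walk_appendI[OF w2 walk_appendI[OF w3 walk_appendI[OF w4
              walk_appendI[OF w5 w6]]]]])
qed

lemma set_cone_edges:
  "set cone_edges = Source_Letter ` ({..<length \<sigma>} - {iL}) \<union> Target_Letter ` ({..<length \<tau>} - {jL}) \<union>
    {Left_Component, Right_Component}"
proof -
  have split: "{0..<iL} \<union> {Suc iL..<length \<sigma>} = {..<length \<sigma>} - {iL}"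
    "{0..<jL} \<union> {Suc jL..<length \<tau>} = {..<length \<tau>} - {jL}"
    by auto
  show ?thesis
    unfolding cone_edges_def set_append set_map set_rev set_upt list.set split[symmetric] image_Un
    by blast
qed

lemma distinct_cone_edges: "distinct cone_edges"
  by (auto simp: cone_edges_def distinct_map inj_on_def)

lemma map_label_cone_edges: "map (label cone_diagram) cone_edges = cone_word"
proof -
  have "map (\<lambda>j. inv_letter (\<tau> ! j)) (rev [0..<jL]) = inv_word A'"
    "map (\<lambda>j. inv_letter (\<tau> ! j)) (rev [Suc jL..<length \<tau>]) = inv_word B'"
    using arg_cong[OF map_nth_middle(1)[of A' "Direct \<tau>C" B'], of "\<lambda>w. rev (map inv_letter w)"]
      arg_cong[OF map_nth_middle(2)[of A' "Direct \<tau>C" B'], of "\<lambda>w. rev (map inv_letter w)"]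
    by (simp_all add: inv_word_def comp_def flip: rev_map)
  moreover have "map (\<lambda>i. \<sigma> ! i) [0..<iL] = A" "map (\<lambda>i. \<sigma> ! i) [Suc iL..<length \<sigma>] = B"
    by (rule map_nth_middle)+
  ultimately show ?thesis
    by (simp add: cone_edges_def cone_word_def cone_diagram_simps comp_def append.simps)
qed

lemma left_end_cone_edges: "bij_betw (left_end cone_diagram) (set cone_edges) (vertices cone_diagram)"
proof -
  have "inj_on (left_end cone_diagram) (set cone_edges)"
    unfolding set_cone_edges
    by (rule inj_onI) (use nth_middle in \<open>auto simp: cone_diagram_simps next_vertex_eq_iff\<close>)
  moreover have "left_end cone_diagram ` set cone_edges = vertices cone_diagram"
  proof (intro equalityI subsetI)
    have "set cone_edges \<subseteq> edges cone_diagram"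
      by (auto simp: set_cone_edges cone_diagram_simps)
    moreover have "\<forall>e\<in>edges cone_diagram. left_end cone_diagram e \<in> vertices cone_diagram"
      using wf_cone_diagram unfolding wf_diagram_def by blast
    moreover fix v assume "v \<in> left_end cone_diagram ` set cone_edges"
    ultimately show "v \<in> vertices cone_diagram" by blast
  next
    fix v assume v: "v \<in> vertices cone_diagram"
    show "v \<in> left_end cone_diagram ` set cone_edges"
    proof (cases "fst v = 0")
      case True
      then obtain i where i: "v = (0, i)" "i < length \<sigma>" using v by (auto simp: cone_diagram_simps)
      then have "v = left_end cone_diagram (if i = iL then Left_Component else Source_Letter i)"
        by (simp add: cone_diagram_simps)
      then show ?thesis using i(2) unfolding set_cone_edges by (auto split: if_splits)
    next
      case False
      then obtain j where j: "v = (1, j)" "j < length \<tau>" using v by (auto simp: cone_diagram_simps)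
      obtain l where l: "l < length \<tau>" "next_vertex \<tau> l = j" using next_vertex_surj[OF j(2)] .
      then have "v = left_end cone_diagram (if l = jL then Right_Component else Target_Letter l)"
        using j by (auto simp: cone_diagram_simps)
      then show ?thesis using l(1) unfolding set_cone_edges by (auto split: if_splits)
    qed
  qed
  ultimately show ?thesis by (simp add: bij_betw_def)
qed

lemma cone_isomorphic_word_complex:
  "isomorphic_complexes Q I (mapping_cone X Y f) (diagram_complex Q I
    (word_diagram Q cone_word (d - 1) (\<lambda>l. weight cone_diagram (cone_edges ! l))))"
proof -
  let ?E = "edges cone_diagram - {Source_Letter iL, Target_Letter jL}"
  let ?D = "cone_diagram\<lparr>edges := ?E\<rparr>"
  have E: "set cone_edges = ?E"
    unfolding set_cone_edges cone_diagram_simps by auto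
  have "isomorphic_complexes Q I (diagram_complex Q I ?D) (diagram_complex Q I
      (word_diagram Q cone_word (vdeg ?D (0, 0)) (\<lambda>l. weight ?D (cone_edges ! l))))"
  proof (rule isomorphic_complexes_closed_walk)
    show "wf_diagram Q I ?D" by (rule wf_diagram_edges_subset[OF wf_cone_diagram]) auto
    show "bij_betw (left_end ?D) (edges ?D) (vertices ?D)"
      using left_end_cone_edges E by simp
  qed (use distinct_cone_edges E walk_cone_edges cone_word_closed map_label_cone_edges in simp_all)
  then have "isomorphic_complexes Q I (diagram_complex Q I ?D) (diagram_complex Q I
      (word_diagram Q cone_word (d - 1) (\<lambda>l. weight cone_diagram (cone_edges ! l))))"
    by (simp add: cone_diagram_simps)
  then show ?thesis
    by (rule isomorphic_complexes_trans[OF isomorphic_complexes_trans[OF cone_isomorphic_cone_diagram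
            cone_diagram_cancel]])
qed

lemma weights_nonzero:
  assumes "\<And>i. c i \<noteq> 0" "\<And>j. c' j \<noteq> 0"
  shows "weight cone_diagram e \<noteq> 0"
  using assms component_scalars by (cases e) (simp_all add: cone_diagram_simps)

text \<open>
  The remaining letters of \<open>\<sigma>\<close> are odd in number and have the sign of the shift.  A scalar at
  \<open>\<sigma>\<^sub>C\<close> or \<open>\<tau>\<^sub>C\<close> disappears with the cancelled letter, but the relation between the
  scalars of the two components restores it.
\<close>

lemma transport_cone_word:
  assumes r: "direct_position \<sigma> r" "direct_position \<tau> r'"
    and c: "c = (\<lambda>i. if i = r then lam else 1)" "c' = (\<lambda>j. if j = r' then mu else 1)"
    and nz: "lam \<noteq> 0" "mu \<noteq> 0"
  shows "transport cone_word (\<lambda>l. weight cone_diagram (cone_edges ! l)) (length cone_word) = - (lam * inverse mu)"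
proof -
  define g where "g e = (if is_direct (label cone_diagram e) then weight cone_diagram e
    else inverse (weight cone_diagram e))" for e
  have len: "length cone_edges = length cone_word"
    using arg_cong[OF map_label_cone_edges, of length] by simp
  have lab: "cone_word ! l = label cone_diagram (cone_edges ! l)" if "l < length cone_word" for l
  proof -
    have "map (label cone_diagram) cone_edges ! l = label cone_diagram (cone_edges ! l)"
      by (rule nth_map) (use that len in simp)
    then show ?thesis unfolding map_label_cone_edges .
  qed
  have cnz: "c i \<noteq> 0" "c' j \<noteq> 0" for i j
    using nz unfolding c by simp_all
  have c1: "\<not> is_direct (\<sigma> ! i) \<Longrightarrow> c i = 1" "\<not> is_direct (\<tau> ! j) \<Longrightarrow> c' j = 1" for i j
    using r unfolding c direct_position_def by auto
  have g: "g (Source_Letter i) = - 1 * c i" "g (Target_Letter j) = inverse (c' j)" for i j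
    using c1(1)[of i] c1(2)[of j] by (simp_all add: g_def cone_diagram_simps)
  have "transport cone_word (\<lambda>l. weight cone_diagram (cone_edges ! l)) (length cone_word) =
      (\<Prod>l<length cone_word. g (cone_edges ! l))"
    unfolding transport_def by (rule prod.cong) (simp_all add: g_def lab)
  also have "\<dots> = (\<Prod>e\<in>set cone_edges. g e)"
    using prod.reindex_bij_betw[OF bij_betw_nth[OF distinct_cone_edges refl refl], of g] len by simp
  also have "\<dots> = (\<Prod>e\<in>Source_Letter ` ({..<length \<sigma>} - {iL}) \<union> Target_Letter ` ({..<length \<tau>} - {jL}). g e) *
      (\<Prod>e\<in>{Left_Component, Right_Component}. g e)"
    unfolding set_cone_edges by (rule prod.union_disjoint) auto
  also have "(\<Prod>e\<in>Source_Letter ` ({..<length \<sigma>} - {iL}) \<union> Target_Letter ` ({..<length \<tau>} - {jL}). g e) =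
      (\<Prod>e\<in>Source_Letter ` ({..<length \<sigma>} - {iL}). g e) * (\<Prod>e\<in>Target_Letter ` ({..<length \<tau>} - {jL}). g e)"
    by (rule prod.union_disjoint) auto
  also have "(\<Prod>e\<in>Source_Letter ` ({..<length \<sigma>} - {iL}). g e) = (\<Prod>i\<in>{..<length \<sigma>} - {iL}. - 1 * c i)"
    by (subst prod.reindex) (simp_all only: g comp_def, simp_all add: inj_on_def)
  also have "\<dots> = - (\<Prod>i\<in>{..<length \<sigma>} - {iL}. c i)"
  proof -
    have "odd (length \<sigma> - 1)" using closed_string_length[OF sigma_closed] by simp
    then have "(\<Prod>i\<in>{..<length \<sigma>} - {iL}. - 1 :: 'k) = - 1"
      using nth_middle(3) by (simp add: card_Diff_singleton)
    then show ?thesis unfolding prod.distrib by simp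
  qed
  also have "(\<Prod>e\<in>Target_Letter ` ({..<length \<tau>} - {jL}). g e) = (\<Prod>j\<in>{..<length \<tau>} - {jL}. inverse (c' j))"
    by (subst prod.reindex) (simp_all only: g comp_def, simp_all add: inj_on_def)
  also have "\<dots> = inverse (\<Prod>j\<in>{..<length \<tau>} - {jL}. c' j)"
    using prod_inversef[of c' "{..<length \<tau>} - {jL}"] unfolding comp_def .
  also have "(\<Prod>e\<in>{Left_Component, Right_Component}. g e) = a * inverse b"
    by (simp add: g_def cone_diagram_simps)
  finally have total: "transport cone_word (\<lambda>l. weight cone_diagram (cone_edges ! l)) (length cone_word) =
      - (\<Prod>i\<in>{..<length \<sigma>} - {iL}. c i) * inverse (\<Prod>j\<in>{..<length \<tau>} - {jL}. c' j) * (a * inverse b)" .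
  have "c iL * (\<Prod>i\<in>{..<length \<sigma>} - {iL}. c i) = (\<Prod>i<length \<sigma>. c i)"
    by (rule prod.remove[symmetric]) (use nth_middle(3) in simp_all)
  also have "\<dots> = lam" unfolding c(1) using r(1)
    by (subst prod.delta) (simp_all add: direct_position_def del: length_append)
  finally have L: "(\<Prod>i\<in>{..<length \<sigma>} - {iL}. c i) = lam / c iL" using cnz(1)[of iL] by (simp add: field_simps)
  have "c' jL * (\<Prod>j\<in>{..<length \<tau>} - {jL}. c' j) = (\<Prod>j<length \<tau>. c' j)"
    by (rule prod.remove[symmetric]) (use nth_middle(4) in simp_all)
  also have "\<dots> = mu" unfolding c(2) using r(2)
    by (subst prod.delta) (simp_all add: direct_position_def del: length_append)
  finally have M: "(\<Prod>j\<in>{..<length \<tau>} - {jL}. c' j) = mu / c' jL" using cnz(2)[of jL] by (simp add: field_simps)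
  have ab: "a * inverse b = c iL / c' jL"
    using square_scalars cnz(2)[of jL] component_scalars(2) by (simp add: field_simps)
  show ?thesis
    unfolding total L M ab using cnz(1)[of iL] cnz(2)[of jL] nz by (simp add: field_simps)
qed

end

section \<open>Decomposition of the cone\<close>

theorem proposition4p2:
  fixes Q :: "('v, 'a) pre_digraph" and I :: "('a \<times> 'a) set"
    and \<sigma> \<tau> A B A' B' :: "'a letter list" and \<sigma>C \<tau>C fL fR :: "'a list"
    and d d' :: int and r r' :: nat and lam mu :: "'k::alg_closed_field"
    and f :: "int \<Rightarrow> (nat \<Rightarrow> ('v, 'a) path \<Rightarrow> 'k) \<Rightarrow> (nat \<Rightarrow> ('v, 'a) path \<Rightarrow> 'k)"
  assumes gentle: "gentle_algebra Q I"
    and sigma: "homotopy_band Q I \<sigma>" "direct_position \<sigma> r" "lam \<noteq> 0"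
    and tau: "homotopy_band Q I \<tau>" "direct_position \<tau> r'" "mu \<noteq> 0"
    and decomposition: "\<sigma> = A @ [Direct \<sigma>C] @ B" "\<tau> = A' @ [Direct \<tau>C] @ B'"
    and double: "double_map Q I A \<sigma>C B d r lam A' \<tau>C B' d' r' mu fL fR f"
  shows "\<exists>\<theta> k. homotopy_band Q I \<theta> \<and> k \<ge> 1 \<and>
    word_power \<theta> k =
      A @ [Direct fL] @ inv_word A' @ inv_word B' @ [Inverse fR] @ B \<and>
    (\<forall>\<omega> \<nu> t. primitive_root_of_unity k \<omega> \<and> \<nu> ^ k = - (lam * inverse mu) \<and>
        direct_position \<theta> t \<longrightarrow>
      derived_iso Q I
        (mapping_cone (band_complex Q I \<sigma> d r lam) (band_complex Q I \<tau> d' r' mu) f)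
        (complex_dsum {1..k} (\<lambda>i. band_complex Q I \<theta> (d - 1) t (\<omega> ^ i * \<nu>))))"
proof -
  define c where "c = (\<lambda>i. if i = r then lam else 1)"
  define c' where "c' = (\<lambda>j. if j = r' then mu else 1)"
  interpret wf_digraph Q
    using gentle by (simp add: gentle_algebra_def fin_digraph_def)
  have closed: "closed_string Q I (A @ [Direct \<sigma>C] @ B)" "closed_string Q I (A' @ [Direct \<tau>C] @ B')"
    using sigma(1) tau(1) unfolding homotopy_band_iff_closed_string decomposition by simp_all
  have bands: "band_complex Q I (A @ [Direct \<sigma>C] @ B) d r lam =
      diagram_complex Q I (word_diagram Q (A @ [Direct \<sigma>C] @ B) d c)"
    "band_complex Q I (A' @ [Direct \<tau>C] @ B') d' r' mu =
      diagram_complex Q I (word_diagram Q (A' @ [Direct \<tau>C] @ B') d' c')"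
    unfolding c_def c'_def by (rule band_complex_eq_diagram_complex)+
  obtain a b where ab: "double_map_cone Q I A B A' B' \<sigma>C \<tau>C fL fR d d' c c' a b f"
    using double wf_digraph closed
    unfolding double_map_def Let_def bands double_map_cone_def double_map_words_def
      double_map_words_axioms_def double_map_cone_axioms_def by blast
  then interpret double_map_cone Q I A B A' B' \<sigma>C \<tau>C fL fR d d' c c' a b f .
  let ?c = "\<lambda>l. weight cone_diagram (cone_edges ! l)"
  obtain \<theta> k where \<theta>: "homotopy_band Q I \<theta>" "k \<ge> 1" "word_power \<theta> k = cone_word"
    by (rule closed_string_power_of_band[OF cone_word_closed])
  have \<theta>_closed: "closed_string Q I \<theta>" using \<theta>(1) by (simp add: homotopy_band_iff_closed_string)
  have "derived_iso Q I (mapping_cone (band_complex Q I \<sigma> d r lam) (band_complex Q I \<tau> d' r' mu) f)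
      (complex_dsum {1..k} (\<lambda>i. band_complex Q I \<theta> (d - 1) t (\<omega> ^ i * \<nu>)))"
    if \<omega>: "primitive_root_of_unity k \<omega>" and \<nu>: "\<nu> ^ k = - (lam * inverse mu)" and t: "direct_position \<theta> t"
    for \<omega> \<nu> :: 'k and t
    unfolding decomposition bands
  proof (rule derived_iso_if_isomorphic)
    show "bounded_complex Q I (mapping_cone X Y f)"
      by (rule bounded_complex_mapping_cone[OF bounded_complex_word_diagram[OF closed(1)]
            bounded_complex_word_diagram[OF closed(2)] chain_map])
    show "bounded_complex Q I (complex_dsum {1..k} (\<lambda>i. band_complex Q I \<theta> (d - 1) t (\<omega> ^ i * \<nu>)))"
      unfolding band_complex_eq_diagram_complex
      by (intro bounded_complex_dsum bounded_complex_word_diagram[OF \<theta>_closed]) simp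
    have "isomorphic_complexes Q I (diagram_complex Q I (word_diagram Q cone_word (d - 1) ?c))
        (complex_dsum {1..k} (\<lambda>i. band_complex Q I \<theta> (d - 1) t (\<omega> ^ i * \<nu>)))"
    proof (rule isomorphic_complexes_power[OF \<theta>_closed cone_word_closed \<theta>(3)[symmetric] \<theta>(2) _ \<omega> _ t])
      show "?c l \<noteq> 0" for l
        by (rule weights_nonzero) (use sigma(3) tau(3) in \<open>simp_all add: c_def c'_def\<close>)
      show "\<nu> ^ k = transport cone_word ?c (length cone_word)"
        using transport_cone_word[OF _ _ c_def c'_def sigma(3) tau(3)] sigma(2) tau(2) \<nu>
        unfolding decomposition by simp
    qed
    then show "isomorphic_complexes Q I (mapping_cone X Y f)
        (complex_dsum {1..k} (\<lambda>i. band_complex Q I \<theta> (d - 1) t (\<omega> ^ i * \<nu>)))"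
      by (rule isomorphic_complexes_trans[OF cone_isomorphic_word_complex])
  qed
  then show ?thesis
    using \<theta> unfolding cone_word_def by blast
qed

end
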